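(* For each $N\in\mathbb{N}$ let $A_N$ be distributed according to the Haar probability measure on the orthogonal group $\mathcal{O}(N)$. Let $(m_N)_N$, $(k_N)_N$ be sequences of natural numbers such that $p_N := m_N k_N\to\infty$ and $p_N = o(N)$ as $N\to\infty$. Let $X_N$ be the $m_N\times k_N$ upper left block of $A_N$, let $y_{i,j}^{(N)} = \sqrt{N}\,(X_N)_{i,j}$ for $1\le i\le m_N$, $1\le j\le k_N$, and define the random empirical measure $$\nu_N := \frac{1}{p_N}\sum_{i=1}^{m_N}\sum_{j=1}^{k_N}\delta_{y_{i,j}^{(N)}}.$$ Then the sequence $(\nu_N)$ satisfies a large deviation principle on the space $\mathcal{P}(\mathbb{R})$ of probability measures on $\mathbb{R}$, equipped with the weak topology, with speed $p_N = m_Nk_N$ and good convex rate function $I$ given by the relative entropy with respect to the standard Gaussian measure $\gamma$ on $\mathbb{R}$: $$I(\mu) = H(\mu|\gamma) := \begin{cases}\int_{\mathbb{R}}\log\left(\frac{d\mu}{d\gamma}\right)d\mu & \text{if } \mu\ll\gamma,\\ +\infty & \text{otherwise.}\end{cases}$$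
   Context: $\mathcal{O}(N)$ is the group of real $N\times N$ matrices $A$ with $AA^\top=A^\top A=\operatorname{Id}_N$. $\delta_x$ is the Dirac measure at $x$. The weak topology on $\mathcal{P}(\mathbb{R})$ is the coarsest topology making $\mu\mapsto\int f\,d\mu$ continuous for every bounded continuous $f:\mathbb{R}\to\mathbb{R}$. The upper left $m_N\times k_N$ block makes sense when $m_N,k_N\le N$, which holds for all large $N$ since $m_Nk_N=o(N)$. Large deviation principle (LDP): for a topological space $\mathbb{X}$, a function $I:\mathbb{X}\to[0,\infty]$ is a rate function if it is lower semicontinuous, i.e. its sublevel sets $\{x: I(x)\le y\}$ are closed for all $y\ge 0$; it is a good rate function if these sets are moreover compact. A sequence of $\mathbb{X}$-valued random variables $X_N$ satisfies an LDP with speed $s_N\to\infty$ and rate function $I$ if $$\liminf_{N\to\infty}\frac{1}{s_N}\log\mathbb{P}(X_N\in O)\ge-\inf_{x\in O}I(x)\ \text{ for all open } O\subseteq\mathbb{X},\qquad \limsup_{N\to\infty}\frac{1}{s_N}\log\mathbb{P}(X_N\in C)\le-\inf_{x\in C}I(x)\ \text{ for all closed } C\subseteq\mathbb{X}.$$ *)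

theory Defs
  imports "HOL-Probability.Probability" "Jordan_Normal_Form.Matrix"
begin

text \<open>The orthogonal group of size \<open>N\<close>. Matrices have the type \<open>real mat\<close> so that the size can
  vary with the index of a sequence.\<close>

definition orthogonal_group :: "nat \<Rightarrow> real mat set" where
  "orthogonal_group N =
    {A \<in> carrier_mat N N. A * A\<^sup>T = 1\<^sub>m N \<and> A\<^sup>T * A = 1\<^sub>m N}"

text \<open>The Borel sigma-algebra of the orthogonal group: its topology is induced by the embedding
  into the finite power of \<open>\<real>\<close> given by the entries, and the Borel sigma-algebra of that power is
  the product sigma-algebra. Only the space and the measurable sets of this measure matter.\<close>

definition orthogonal_borel :: "nat \<Rightarrow> real mat measure" where
  "orthogonal_borel N =
    vimage_algebra (orthogonal_group N)
      (\<lambda>A. \<lambda>ij\<in>{..<N} \<times> {..<N}. A $$ ij) (\<Pi>\<^sub>M ij\<in>{..<N} \<times> {..<N}. borel)"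

text \<open>Left invariance determines the Haar probability measure of a compact group uniquely.\<close>

definition is_haar_orthogonal :: "nat \<Rightarrow> real mat measure \<Rightarrow> bool" where
  "is_haar_orthogonal N \<mu> \<longleftrightarrow>
    prob_space \<mu> \<and> sets \<mu> = sets (orthogonal_borel N) \<and>
    (\<forall>Q\<in>orthogonal_group N. distr \<mu> \<mu> (\<lambda>A. Q * A) = \<mu>)"

text \<open>This block is meaningful for \<open>m \<le> dim_row A\<close> and \<open>k \<le> dim_col A\<close>; the entries outside of
  \<open>A\<close> are unspecified.\<close>

definition upper_left_block :: "nat \<Rightarrow> nat \<Rightarrow> 'a mat \<Rightarrow> 'a mat" where
  "upper_left_block m k A = mat m k (\<lambda>(i, j). A $$ (i, j))"

text \<open>The point masses are \<open>return borel\<close>. For a matrix without entries the result is the null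
  measure.\<close>

definition entry_empirical_measure :: "real mat \<Rightarrow> real measure" where
  "entry_empirical_measure Y =
    measure_of UNIV (sets borel)
      (\<lambda>B. (\<Sum>i<dim_row Y. \<Sum>j<dim_col Y. emeasure (return borel (Y $$ (i, j))) B)
            / of_nat (dim_row Y * dim_col Y))"

lemma sets_entry_empirical_measure [simp]: "sets (entry_empirical_measure Y) = sets borel"
  unfolding entry_empirical_measure_def by (metis sets.sigma_sets_eq sets_measure_of
      sets.space_closed space_borel)

lemma emeasure_entry_empirical_measure:
  assumes B: "B \<in> sets borel"
  shows "emeasure (entry_empirical_measure Y) B =
    (\<Sum>i<dim_row Y. \<Sum>j<dim_col Y. indicator B (Y $$ (i, j))) / of_nat (dim_row Y * dim_col Y)"
proof -
  let ?f = "\<lambda>B. (\<Sum>i<dim_row Y. \<Sum>j<dim_col Y. emeasure (return borel (Y $$ (i, j))) B)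
            / of_nat (dim_row Y * dim_col Y) :: ennreal"
  have "emeasure (entry_empirical_measure Y) B = ?f B"
  proof (rule emeasure_measure_of[OF entry_empirical_measure_def])
    show "positive (sets (entry_empirical_measure Y)) ?f"
      by (simp add: positive_def)
    show "countably_additive (sets (entry_empirical_measure Y)) ?f"
    proof (rule countably_additiveI)
      fix E :: "nat \<Rightarrow> real set"
      assume "range E \<subseteq> sets (entry_empirical_measure Y)" "disjoint_family E"
      then have "(\<Sum>n. emeasure (return borel y) (E n)) = emeasure (return borel y) (\<Union>n. E n)"
        for y :: real
        by (intro suminf_emeasure) auto
      then show "(\<Sum>n. ?f (E n)) = ?f (\<Union>n. E n)"
        by (simp add: divide_ennreal_def suminf_sum del: emeasure_return)
    qed
  qed (use B in auto)
  then show ?thesis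
    using B by simp
qed

text \<open>The space of Borel probability measures on \<open>\<real>\<close> with the weak topology.\<close>

definition prob_measures :: "real measure set" where
  "prob_measures = {\<mu>. prob_space \<mu> \<and> sets \<mu> = sets borel}"

definition weak_topology :: "real measure topology" where
  "weak_topology =
    topology_generated_by
      {{\<mu> \<in> prob_measures. (\<integral>x. f x \<partial>\<mu>) \<in> U} | (f :: real \<Rightarrow> real) (U :: real set).
        continuous_on UNIV f \<and> bounded (range f) \<and> open U}"

lemma topspace_weak_topology [simp]: "topspace weak_topology = prob_measures"
proof -
  have "prob_measures \<in> {{\<mu> \<in> prob_measures. (\<integral>x. f x \<partial>\<mu>) \<in> U} | f U.
        continuous_on UNIV f \<and> bounded (range f) \<and> open U}"
    by (rule CollectI, rule exI[of _ "\<lambda>_. 0"], rule exI[of _ UNIV]) auto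
  then show ?thesis
    unfolding weak_topology_def topology_generated_by_topspace by blast
qed

text \<open>\<open>relative_entropy \<mu> \<gamma>\<close> is \<open>H(\<mu> | \<gamma>)\<close>. The Bochner integral is \<open>0\<close> for functions that are not
  integrable, hence the integral of the logarithm is written as the difference of the integrals of
  its positive and its negative part. For probability measures the latter is always finite.\<close>

definition relative_entropy :: "'a measure \<Rightarrow> 'a measure \<Rightarrow> ereal" where
  "relative_entropy \<mu> \<gamma> =
    (if absolutely_continuous \<gamma> \<mu>
     then enn2ereal (\<integral>\<^sup>+x. ennreal (ln (enn2real (RN_deriv \<gamma> \<mu> x))) \<partial>\<mu>)
        - enn2ereal (\<integral>\<^sup>+x. ennreal (- ln (enn2real (RN_deriv \<gamma> \<mu> x))) \<partial>\<mu>)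
     else \<infinity>)"

lemma relative_entropy_eq_KL_divergence:
  assumes "absolutely_continuous \<gamma> \<mu>" "integrable \<mu> (entropy_density (exp 1) \<gamma> \<mu>)"
  shows "relative_entropy \<mu> \<gamma> = ereal (KL_divergence (exp 1) \<gamma> \<mu>)"
proof -
  let ?g = "\<lambda>x. ln (enn2real (RN_deriv \<gamma> \<mu> x))"
  have eq: "entropy_density (exp 1) \<gamma> \<mu> = ?g"
    by (auto simp: entropy_density_def log_def fun_eq_iff)
  have int: "integrable \<mu> ?g"
    using assms(2) by (simp add: eq)
  have fin: "(\<integral>\<^sup>+x. ennreal (?g x) \<partial>\<mu>) \<noteq> \<infinity>" "(\<integral>\<^sup>+x. ennreal (- ?g x) \<partial>\<mu>) \<noteq> \<infinity>"
    using int by (auto simp: real_integrable_def)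
  have ereal_eq: "enn2ereal a = ereal (enn2real a)" if "a \<noteq> \<infinity>" for a :: ennreal
    using that by (cases a) auto
  have "KL_divergence (exp 1) \<gamma> \<mu> =
      enn2real (\<integral>\<^sup>+x. ennreal (?g x) \<partial>\<mu>) - enn2real (\<integral>\<^sup>+x. ennreal (- ?g x) \<partial>\<mu>)"
    unfolding KL_divergence_def eq by (rule real_lebesgue_integral_def[OF int])
  then show ?thesis
    using assms(1) fin by (simp add: relative_entropy_def ereal_eq)
qed

definition mixture :: "real \<Rightarrow> 'a measure \<Rightarrow> 'a measure \<Rightarrow> 'a measure" where
  "mixture t \<mu> \<nu> =
    measure_of (space \<mu>) (sets \<mu>) (\<lambda>B. ennreal t * emeasure \<mu> B + ennreal (1 - t) * emeasure \<nu> B)"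

lemma emeasure_mixture:
  assumes "sets \<nu> = sets \<mu>" "B \<in> sets \<mu>"
  shows "emeasure (mixture t \<mu> \<nu>) B = ennreal t * emeasure \<mu> B + ennreal (1 - t) * emeasure \<nu> B"
proof (rule emeasure_measure_of[OF mixture_def])
  let ?f = "\<lambda>B. ennreal t * emeasure \<mu> B + ennreal (1 - t) * emeasure \<nu> B"
  have S: "sets (mixture t \<mu> \<nu>) = sets \<mu>"
    by (simp add: mixture_def)
  show "positive (sets (mixture t \<mu> \<nu>)) ?f"
    by (simp add: positive_def)
  show "countably_additive (sets (mixture t \<mu> \<nu>)) ?f"
  proof (rule countably_additiveI)
    fix E :: "nat \<Rightarrow> 'a set"
    assume "range E \<subseteq> sets (mixture t \<mu> \<nu>)" "disjoint_family E"
    then have "(\<Sum>n. emeasure \<mu> (E n)) = emeasure \<mu> (\<Union>n. E n)"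
      "(\<Sum>n. emeasure \<nu> (E n)) = emeasure \<nu> (\<Union>n. E n)"
      using S assms(1) by (auto intro!: suminf_emeasure)
    then show "(\<Sum>n. ?f (E n)) = ?f (\<Union>n. E n)"
      by (simp add: suminf_add[symmetric])
  qed
qed (use assms sets.space_closed in \<open>auto simp: mixture_def\<close>)

definition convex_rate :: "(real measure \<Rightarrow> ereal) \<Rightarrow> bool" where
  "convex_rate I \<longleftrightarrow>
    (\<forall>\<mu>\<in>prob_measures. \<forall>\<nu>\<in>prob_measures. \<forall>t\<in>{0..1}.
      I (mixture t \<mu> \<nu>) \<le> ereal t * I \<mu> + ereal (1 - t) * I \<nu>)"

definition rate_function :: "'a topology \<Rightarrow> ('a \<Rightarrow> ereal) \<Rightarrow> bool" where
  "rate_function X I \<longleftrightarrow>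
    (\<forall>x\<in>topspace X. 0 \<le> I x) \<and>
    (\<forall>y::real. 0 \<le> y \<longrightarrow> closedin X {x \<in> topspace X. I x \<le> ereal y})"

definition good_rate_function :: "'a topology \<Rightarrow> ('a \<Rightarrow> ereal) \<Rightarrow> bool" where
  "good_rate_function X I \<longleftrightarrow>
    rate_function X I \<and>
    (\<forall>y::real. 0 \<le> y \<longrightarrow> compactin X {x \<in> topspace X. I x \<le> ereal y})"

definition log_ereal :: "real \<Rightarrow> ereal" where
  "log_ereal x = (if x \<le> 0 then -\<infinity> else ereal (ln x))"

text \<open>The random variables \<open>Y N\<close>, each on its own probability space \<open>M N\<close>, are measurable for the
  Borel sigma-algebra of \<open>X\<close>. As everything here is asymptotic, this is only required for all large
  \<open>N\<close>.\<close>

definition satisfies_LDP ::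
  "'a topology \<Rightarrow> (nat \<Rightarrow> 'w measure) \<Rightarrow> (nat \<Rightarrow> 'w \<Rightarrow> 'a) \<Rightarrow> (nat \<Rightarrow> real) \<Rightarrow> ('a \<Rightarrow> ereal) \<Rightarrow> bool"
where
  "satisfies_LDP X M Y s I \<longleftrightarrow>
    (\<forall>\<^sub>F N in sequentially. Y N \<in> M N \<rightarrow>\<^sub>M sigma (topspace X) {U. openin X U}) \<and>
    filterlim s at_top sequentially \<and>
    rate_function X I \<and>
    (\<forall>U. openin X U \<longrightarrow>
      liminf (\<lambda>N. ereal (1 / s N) * log_ereal (measure (M N) {\<omega> \<in> space (M N). Y N \<omega> \<in> U}))
        \<ge> - (INF x\<in>U. I x)) \<and>
    (\<forall>C. closedin X C \<longrightarrow>
      limsup (\<lambda>N. ereal (1 / s N) * log_ereal (measure (M N) {\<omega> \<in> space (M N). Y N \<omega> \<in> C}))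
        \<le> - (INF x\<in>C. I x))"

end

theory Submission
  imports Defs "HOL-Real_Asymp.Real_Asymp"
begin

text \<open>
  The entries of a small block of a Haar distributed orthogonal matrix, multiplied by
  \<open>sqrt N\<close>, are nearly independent standard Gaussian variables. For independent variables the
  statement is Sanov's theorem, so the task is to make \<open>nearly\<close> strong enough for events whose
  probability is exponentially small in the number \<open>p = m * k\<close> of entries.

  The coupling behind this runs from the Haar matrix \<open>A\<close> to a Gaussian matrix. Let \<open>G\<close> be an
  independent \<open>m \<times> N\<close> matrix of standard Gaussian entries, and let \<open>G = L W\<close> be its Gram-Schmidt
  factorisation with a lower triangular \<open>m \<times> m\<close> matrix \<open>L\<close>. The matrix \<open>G A\<close> is again Gaussian by
  rotation invariance. On the other hand, for a fixed matrix \<open>H\<close> the law of \<open>H A\<close> depends only on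
  \<open>H H\<^sup>T\<close>, because matrices with the same Gram matrix differ by an orthogonal factor, which the Haar
  measure absorbs. As \<open>L L\<^sup>T = G G\<^sup>T\<close>, the block \<open>X\<close> of \<open>A\<close> has the property that \<open>L X\<close>, with \<open>L\<close>
  independent of \<open>X\<close>, is distributed like an \<open>m \<times> k\<close> matrix of independent standard Gaussian
  entries (\<open>gauss_block_eq_haar_block\<close>). The diagonal of \<open>L\<close> is close to \<open>sqrt N\<close> and its other
  entries are of order one. For every fixed \<open>X\<close> the inequality
  \<open>|L X - sqrt N X|\<^sup>2 \<le> \<epsilon> |sqrt N X|\<^sup>2\<close> fails with probability at most
  \<open>(1 + 3 m) * sqrt 2 ^ p * exp (- \<epsilon> N / 256)\<close> (\<open>gs_close\<close>), and this is superexponentially small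
  in \<open>p\<close> precisely because \<open>p = o(N)\<close>. Bounded continuous functions of the entries
  are thus exchangeable between \<open>L X\<close> and \<open>sqrt N X\<close>, and
  \<open>1/p * ln E exp (\<Sum> f (sqrt N X\<^sub>i\<^sub>j)) \<longlonglongrightarrow> ln (\<integral> exp f d\<gamma>)\<close> for every bounded continuous \<open>f\<close>
  (\<open>laplace_functional_limit\<close>). The Gaussian tails of \<open>L X\<close> also make the second moments
  of the empirical measures exponentially tight (\<open>sq_norm_exponentially_tight\<close>).

  The second half deduces the large deviation principle from these two facts. The
  Donsker-Varadhan formula writes the relative entropy as the supremum of
  \<open>\<integral> f d\<mu> - ln (\<integral> exp f d\<gamma>)\<close> over bounded continuous \<open>f\<close> (\<open>donsker_varadhan_le\<close>,
  \<open>donsker_varadhan_ge\<close>). This makes its sublevel sets intersections of closed half spaces and the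
  entropy convex. The sublevel sets are compact since they have bounded second moments
  (\<open>compactin_moment_set\<close>). The upper bound is the exponential Chebyshev inequality on half
  spaces, a finite cover of a compact set, and exponential tightness. For the lower bound, the
  law of the empirical measure is reweighted by \<open>exp (p * \<integral> f d\<nu>)\<close>: under the new weights the
  empirical measure concentrates at \<open>tilted f\<close>, the measure with density proportional to \<open>exp f\<close>,
  and every measure of finite entropy is approximated by such measures together with its
  entropy (\<open>tilted_approximation\<close>).
\<close>

section \<open>Gaussian vectors and their rotation invariance\<close>

lemma prob_space_std_normal: "prob_space std_normal_distribution"
  using prob_space_normal_density[of 1 0] by simp

lemma nn_integral_exp_square:
  assumes "\<theta> < 1/2"
  shows "(\<integral>\<^sup>+x. ennreal (exp (\<theta> * x\<^sup>2)) \<partial>std_normal_distribution) = ennreal (1 / sqrt (1 - 2 * \<theta>))"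
proof -
  define \<sigma> where "\<sigma> = 1 / sqrt (1 - 2 * \<theta>)"
  have s: "\<sigma> > 0" "\<sigma>\<^sup>2 = 1 / (1 - 2 * \<theta>)" using assms by (auto simp: \<sigma>_def power_divide)
  have eq: "std_normal_density x * exp (\<theta> * x\<^sup>2) = \<sigma> * normal_density 0 \<sigma> x" for x
  proof -
    have "\<sigma> * normal_density 0 \<sigma> x = 1 / sqrt (2 * pi) * exp (- (x\<^sup>2 * (1 - 2 * \<theta>)) / 2)"
      using s(1) assms unfolding normal_density_def
      by (simp add: real_sqrt_mult real_sqrt_divide s(2)) (simp add: \<sigma>_def)
    also have "\<dots> = 1 / sqrt (2 * pi) * (exp (- x\<^sup>2 / 2) * exp (\<theta> * x\<^sup>2))"
      by (simp add: exp_add[symmetric] field_simps)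
    finally show ?thesis by (simp add: std_normal_density_def)
  qed
  have "(\<integral>\<^sup>+x. ennreal (exp (\<theta> * x\<^sup>2)) \<partial>std_normal_distribution)
      = (\<integral>\<^sup>+x. ennreal \<sigma> * ennreal (normal_density 0 \<sigma> x) \<partial>lborel)"
    using s by (subst nn_integral_density) (auto simp: ennreal_mult[symmetric] eq)
  also have "\<dots> = ennreal \<sigma> * (\<integral>\<^sup>+x. ennreal (normal_density 0 \<sigma> x) \<partial>lborel)"
    by (rule nn_integral_cmult) simp
  also have "(\<integral>\<^sup>+x. ennreal (normal_density 0 \<sigma> x) \<partial>lborel) = 1"
    using prob_space.emeasure_space_1[OF prob_space_normal_density[OF s(1), of 0]]
    by (simp add: emeasure_density)
  finally show ?thesis by (simp add: \<sigma>_def)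
qed

lemma nn_integral_exp_linear:
  "(\<integral>\<^sup>+x. ennreal (exp (t * x)) \<partial>std_normal_distribution) = ennreal (exp (t\<^sup>2 / 2))"
proof -
  have eq: "std_normal_density x * exp (t * x) = exp (t\<^sup>2 / 2) * normal_density t 1 x" for x
    by (simp add: normal_density_def exp_add[symmetric] power2_diff field_simps)
  have "(\<integral>\<^sup>+x. ennreal (exp (t * x)) \<partial>std_normal_distribution)
      = (\<integral>\<^sup>+x. ennreal (exp (t\<^sup>2 / 2)) * ennreal (normal_density t 1 x) \<partial>lborel)"
    by (subst nn_integral_density) (auto simp: ennreal_mult[symmetric] eq)
  also have "\<dots> = ennreal (exp (t\<^sup>2 / 2)) * (\<integral>\<^sup>+x. ennreal (normal_density t 1 x) \<partial>lborel)"
    by (rule nn_integral_cmult) simp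
  also have "(\<integral>\<^sup>+x. ennreal (normal_density t 1 x) \<partial>lborel) = 1"
    using prob_space.emeasure_space_1[OF prob_space_normal_density[of 1 t]]
    by (simp add: emeasure_density)
  finally show ?thesis by simp
qed

definition gauss :: "nat \<Rightarrow> (nat \<Rightarrow> real) measure" where
  "gauss N = (\<Pi>\<^sub>M l\<in>{..<N}. std_normal_distribution)"

lemma sets_gauss [measurable_cong]: "sets (gauss N) = sets (\<Pi>\<^sub>M l\<in>{..<N}. borel)"
  unfolding gauss_def by (rule sets_PiM_cong) auto

interpretation std_normal: prob_space std_normal_distribution
  by (rule prob_space_std_normal)

interpretation std_normal_product: product_sigma_finite "\<lambda>_::nat. std_normal_distribution"
  by standard

interpretation lborel_product: product_sigma_finite "\<lambda>_::nat. lborel :: real measure"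
  by standard

lemma prob_space_gauss: "prob_space (gauss N)"
  unfolding gauss_def by (rule prob_space_PiM) (rule prob_space_std_normal)

lemma nn_integral_gauss_prod:
  assumes "\<And>l. l < N \<Longrightarrow> f l \<in> borel_measurable borel"
  shows "(\<integral>\<^sup>+x. (\<Prod>l<N. f l (x l)) \<partial>gauss N) = (\<Prod>l<N. \<integral>\<^sup>+t. f l t \<partial>std_normal_distribution)"
  unfolding gauss_def using assms
  by (intro std_normal_product.product_nn_integral_prod) auto

lemma nn_integral_gauss_exp_sum:
  assumes [measurable]: "\<And>l. l < N \<Longrightarrow> f l \<in> borel_measurable borel"
  shows "(\<integral>\<^sup>+x. ennreal (exp (\<Sum>l<N. f l (x l))) \<partial>gauss N)
    = (\<Prod>l<N. \<integral>\<^sup>+t. ennreal (exp (f l t)) \<partial>std_normal_distribution)"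
  by (subst nn_integral_gauss_prod[symmetric]) (auto simp: exp_sum prod_ennreal)

lemma nn_integral_gauss_exp_inner:
  "(\<integral>\<^sup>+x. ennreal (exp (\<Sum>l<N. u l * x l)) \<partial>gauss N) = ennreal (exp ((\<Sum>l<N. (u l)\<^sup>2) / 2))"
  by (subst nn_integral_gauss_exp_sum)
     (auto simp: nn_integral_exp_linear prod_ennreal exp_sum[symmetric] sum_divide_distrib)

lemma nn_integral_gauss_exp_norm:
  assumes "\<theta> < 1/2"
  shows "(\<integral>\<^sup>+x. ennreal (exp (\<theta> * (\<Sum>l<N. (x l)\<^sup>2))) \<partial>gauss N) = ennreal ((1 / sqrt (1 - 2 * \<theta>)) ^ N)"
  unfolding sum_distrib_left using assms
  by (subst nn_integral_gauss_exp_sum)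
     (auto simp: nn_integral_exp_square ennreal_power)

text \<open>Since \<open>exp (y\<^sup>2 / 2)\<close> is the expectation of \<open>exp (y * \<xi>)\<close> for a standard Gaussian \<open>\<xi>\<close>, the squares
  become linear at the cost of an auxiliary Gaussian vector \<open>z\<close>. After an exchange of the two
  integrals the one over \<open>x\<close> is explicit; by the hypothesis, which bounds the squared operator norm of
  \<open>u\<close>, what remains is at most the integral of \<open>exp (|z|\<^sup>2 / 4)\<close>.\<close>

lemma nn_integral_gauss_exp_inner_squares_le:
  fixes u :: "nat \<Rightarrow> nat \<Rightarrow> real"
  assumes u: "\<And>z. (\<Sum>l<N. (\<Sum>c<n. z c * u c l)\<^sup>2) \<le> \<tau> * (\<Sum>c<n. (z c)\<^sup>2)"
    and \<alpha>: "0 \<le> \<alpha>" "\<alpha> * \<tau> \<le> 1/4"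
  shows "(\<integral>\<^sup>+x. ennreal (exp (\<alpha> * (\<Sum>c<n. (\<Sum>l<N. u c l * x l)\<^sup>2))) \<partial>gauss N) \<le> ennreal (sqrt 2 ^ n)"
proof -
  define s where "s = sqrt (2 * \<alpha>)"
  have s2: "s\<^sup>2 = 2 * \<alpha>" using \<alpha> by (simp add: s_def)
  have half: "(\<Sum>j<J. (s * w j)\<^sup>2) / 2 = \<alpha> * (\<Sum>j<J. (w j)\<^sup>2)" for w :: "nat \<Rightarrow> real" and J
    by (simp add: power_mult_distrib s2 sum_distrib_left sum_divide_distrib)
  interpret pair_sigma_finite "gauss N" "gauss n"
    by (intro pair_sigma_finite.intro prob_space_imp_sigma_finite prob_space_gauss)
  have "(\<integral>\<^sup>+x. ennreal (exp (\<alpha> * (\<Sum>c<n. (\<Sum>l<N. u c l * x l)\<^sup>2))) \<partial>gauss N)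
     = (\<integral>\<^sup>+x. \<integral>\<^sup>+z. ennreal (exp (\<Sum>c<n. (s * (\<Sum>l<N. u c l * x l)) * z c)) \<partial>gauss n \<partial>gauss N)"
    unfolding nn_integral_gauss_exp_inner half ..
  also have "\<dots> = (\<integral>\<^sup>+x. \<integral>\<^sup>+z. ennreal (exp (\<Sum>l<N. (s * (\<Sum>c<n. z c * u c l)) * x l)) \<partial>gauss n \<partial>gauss N)"
  proof -
    have "(\<Sum>c<n. (s * (\<Sum>l<N. u c l * x l)) * z c) = (\<Sum>l<N. (s * (\<Sum>c<n. z c * u c l)) * x l)"
      for x z :: "nat \<Rightarrow> real"
      by (simp add: sum_distrib_left sum_distrib_right ac_simps) (rule sum.swap)
    then show ?thesis by simp
  qed
  also have "\<dots> = (\<integral>\<^sup>+z. \<integral>\<^sup>+x. ennreal (exp (\<Sum>l<N. (s * (\<Sum>c<n. z c * u c l)) * x l)) \<partial>gauss N \<partial>gauss n)"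
    by (rule Fubini'[symmetric]) measurable
  also have "\<dots> = (\<integral>\<^sup>+z. ennreal (exp (\<alpha> * (\<Sum>l<N. (\<Sum>c<n. z c * u c l)\<^sup>2))) \<partial>gauss n)"
    unfolding nn_integral_gauss_exp_inner half ..
  also have "\<dots> \<le> (\<integral>\<^sup>+z. ennreal (exp (1/4 * (\<Sum>c<n. (z c)\<^sup>2))) \<partial>gauss n)"
  proof (intro nn_integral_mono ennreal_leI, unfold exp_le_cancel_iff)
    fix z
    have "\<alpha> * (\<Sum>l<N. (\<Sum>c<n. z c * u c l)\<^sup>2) \<le> \<alpha> * (\<tau> * (\<Sum>c<n. (z c)\<^sup>2))"
      by (rule mult_left_mono[OF u \<alpha>(1)])
    also have "\<dots> \<le> 1/4 * (\<Sum>c<n. (z c)\<^sup>2)"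
      using mult_right_mono[OF \<alpha>(2) sum_nonneg[of "{..<n}" "\<lambda>c. (z c)\<^sup>2"]] by (simp add: mult.assoc)
    finally show "\<alpha> * (\<Sum>l<N. (\<Sum>c<n. z c * u c l)\<^sup>2) \<le> 1/4 * (\<Sum>c<n. (z c)\<^sup>2)" .
  qed
  also have "\<dots> = ennreal (sqrt 2 ^ n)"
    by (subst nn_integral_gauss_exp_norm) (simp_all add: real_sqrt_divide)
  finally show ?thesis .
qed

text \<open>Arrays indexed by all natural numbers stand for the orthogonal matrices in the coordinate
  computations. Both identities are included so that the transpose is immediate.\<close>

definition orthogonal_array :: "nat \<Rightarrow> (nat \<Rightarrow> nat \<Rightarrow> real) \<Rightarrow> bool" where
  "orthogonal_array N a \<longleftrightarrow>
    (\<forall>i<N. \<forall>j<N. (\<Sum>l<N. a i l * a j l) = (if i = j then 1 else 0)) \<and>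
    (\<forall>i<N. \<forall>j<N. (\<Sum>l<N. a l i * a l j) = (if i = j then 1 else 0))"

lemma orthogonal_array_transpose:
  "orthogonal_array N a \<Longrightarrow> orthogonal_array N (\<lambda>i j. a j i)"
  by (auto simp: orthogonal_array_def)

text \<open>The restriction to \<open>{..<N}\<close> puts the product of a row vector and a matrix into the extensional
  function space that carries \<open>gauss N\<close>.\<close>

definition row_times :: "nat \<Rightarrow> (nat \<Rightarrow> nat \<Rightarrow> real) \<Rightarrow> (nat \<Rightarrow> real) \<Rightarrow> nat \<Rightarrow> real" where
  "row_times N a x = (\<lambda>c\<in>{..<N}. \<Sum>l<N. x l * a l c)"

lemma row_times_inner:
  assumes "orthogonal_array N a"
  shows "(\<Sum>c<N. row_times N a x c * row_times N a y c) = (\<Sum>l<N. x l * y l)"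
proof -
  have "(\<Sum>c<N. row_times N a x c * row_times N a y c)
    = (\<Sum>c<N. \<Sum>l<N. \<Sum>l'<N. (x l * y l') * (a l c * a l' c))"
    by (simp add: row_times_def sum_product ac_simps)
  also have "\<dots> = (\<Sum>l<N. \<Sum>l'<N. (x l * y l') * (\<Sum>c<N. a l c * a l' c))"
    unfolding sum_distrib_left
    by (subst sum.swap, rule sum.cong[OF refl], rule sum.swap)
  also have "\<dots> = (\<Sum>l<N. \<Sum>l'<N. if l = l' then x l * y l' else 0)"
    using assms by (intro sum.cong refl) (auto simp: orthogonal_array_def)
  finally show ?thesis by simp
qed

lemma row_times_transpose:
  assumes "orthogonal_array N a" "c < N"
  shows "row_times N a (row_times N (\<lambda>i j. a j i) x) c = x c"
proof -
  have "row_times N a (row_times N (\<lambda>i j. a j i) x) c = (\<Sum>l<N. \<Sum>r<N. x r * (a l r * a l c))"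
    using assms(2) by (simp add: row_times_def sum_distrib_right mult.assoc)
  also have "\<dots> = (\<Sum>r<N. x r * (\<Sum>l<N. a l r * a l c))"
    by (subst sum.swap) (simp add: sum_distrib_left)
  also have "\<dots> = (\<Sum>r<N. if r = c then x r else 0)"
    using assms by (intro sum.cong refl) (auto simp: orthogonal_array_def)
  also have "\<dots> = x c" using assms(2) by simp
  finally show ?thesis .
qed

abbreviation lebesgue_pi :: "nat \<Rightarrow> (nat \<Rightarrow> real) measure" where
  "lebesgue_pi N \<equiv> (\<Pi>\<^sub>M l\<in>{..<N}. lborel)"

lemma sets_lebesgue_pi: "sets (lebesgue_pi N) = sets (\<Pi>\<^sub>M l\<in>{..<N}. borel)"
  by (rule sets_PiM_cong) auto

definition gauss_density :: "nat \<Rightarrow> (nat \<Rightarrow> real) \<Rightarrow> ennreal" where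
  "gauss_density N x = ennreal (\<Prod>l<N. std_normal_density (x l))"

lemma borel_measurable_gauss_density [measurable]:
  "gauss_density N \<in> borel_measurable (\<Pi>\<^sub>M l\<in>{..<N}. borel)"
  unfolding gauss_density_def by measurable

lemma gauss_eq_density: "gauss N = density (lebesgue_pi N) (gauss_density N)"
  unfolding gauss_def
proof (rule std_normal_product.PiM_eqI[symmetric])
  note sets_lebesgue_pi[measurable_cong]
  show "sets (density (lebesgue_pi N) (gauss_density N)) = sets (\<Pi>\<^sub>M l\<in>{..<N}. std_normal_distribution)"
    by (simp, rule sets_PiM_cong) auto
  fix A :: "nat \<Rightarrow> real set"
  assume A: "\<And>i. i \<in> {..<N} \<Longrightarrow> A i \<in> sets std_normal_distribution"
  then have [measurable]: "A i \<in> sets borel" if "i < N" for i using that by simp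
  have "emeasure (density (lebesgue_pi N) (gauss_density N)) (Pi\<^sub>E {..<N} A)
    = (\<integral>\<^sup>+x. gauss_density N x * indicator (Pi\<^sub>E {..<N} A) x \<partial>lebesgue_pi N)"
    by (rule emeasure_density) (auto intro!: sets_PiM_I_finite A)
  also have "\<dots> = (\<integral>\<^sup>+x. (\<Prod>i<N. ennreal (std_normal_density (x i)) * indicator (A i) (x i)) \<partial>lebesgue_pi N)"
  proof (rule nn_integral_cong)
    fix x assume "x \<in> space (lebesgue_pi N)"
    then have "indicator (Pi\<^sub>E {..<N} A) x = (\<Prod>i<N. indicator (A i) (x i) :: ennreal)"
      by (auto simp: indicator_def space_PiM PiE_iff)
    then show "gauss_density N x * indicator (Pi\<^sub>E {..<N} A) x
        = (\<Prod>i<N. ennreal (std_normal_density (x i)) * indicator (A i) (x i))"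
      by (simp add: gauss_density_def prod_ennreal[symmetric] prod.distrib)
  qed
  also have "\<dots> = (\<Prod>i<N. \<integral>\<^sup>+t. ennreal (std_normal_density t) * indicator (A i) t \<partial>lborel)"
    by (rule lborel_product.product_nn_integral_prod) auto
  also have "\<dots> = (\<Prod>i\<in>{..<N}. emeasure std_normal_distribution (A i))"
    by (intro prod.cong refl) (simp add: emeasure_density)
  finally show "emeasure (density (lebesgue_pi N) (gauss_density N)) (Pi\<^sub>E {..<N} A)
    = (\<Prod>i\<in>{..<N}. emeasure std_normal_distribution (A i))" .
qed simp

lemma gauss_density_eq:
  "gauss_density N x = ennreal ((1 / sqrt (2 * pi)) ^ N * exp (- (\<Sum>l<N. x l * x l) / 2))"
  by (simp add: gauss_density_def std_normal_density_def prod_dividef prod.distrib exp_sum[symmetric]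
      sum_negf sum_divide_distrib power2_eq_square power_divide)

lemma nn_integral_lebesgue_pi_shift:
  assumes [measurable]: "F \<in> borel_measurable (\<Pi>\<^sub>M l\<in>{..<N}. borel)"
  shows "(\<integral>\<^sup>+x. F (\<lambda>c\<in>{..<N}. x c + v c) \<partial>lebesgue_pi N) = (\<integral>\<^sup>+x. F x \<partial>lebesgue_pi N)"
proof -
  note sets_lebesgue_pi[measurable_cong]
  let ?s = "\<lambda>x. \<lambda>c\<in>{..<N}. x c + v c"
  have s[measurable]: "?s \<in> lebesgue_pi N \<rightarrow>\<^sub>M lebesgue_pi N" by measurable
  have "distr (lebesgue_pi N) (lebesgue_pi N) ?s = lebesgue_pi N"
  proof (rule lborel_product.PiM_eqI)
    fix A :: "nat \<Rightarrow> real set" assume A: "\<And>i. i \<in> {..<N} \<Longrightarrow> A i \<in> sets lborel"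
    have A': "(\<lambda>t. t + v i) -` A i \<in> sets borel" if "i < N" for i
      using measurable_sets[of "\<lambda>t. t + v i" borel borel "A i"] A that by simp
    have "emeasure (distr (lebesgue_pi N) (lebesgue_pi N) ?s) (Pi\<^sub>E {..<N} A)
      = emeasure (lebesgue_pi N) (?s -` Pi\<^sub>E {..<N} A \<inter> space (lebesgue_pi N))"
      by (rule emeasure_distr) (auto intro!: sets_PiM_I_finite A s)
    also have "?s -` Pi\<^sub>E {..<N} A \<inter> space (lebesgue_pi N) = (\<Pi>\<^sub>E i\<in>{..<N}. (\<lambda>t. t + v i) -` A i)"
      by (auto simp: space_PiM PiE_iff)
    also have "emeasure (lebesgue_pi N) \<dots> = (\<Prod>i<N. emeasure lborel ((\<lambda>t. t + v i) -` A i))"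
      using A' by (intro lborel_product.emeasure_PiM) auto
    also have "\<dots> = (\<Prod>i<N. emeasure lborel (A i))"
    proof (intro prod.cong refl)
      fix i assume i: "i \<in> {..<N}"
      have "emeasure lborel ((\<lambda>t. t + v i) -` A i) = emeasure (distr lborel borel ((+) (v i))) (A i)"
        using A[OF i] by (subst emeasure_distr) (auto simp: vimage_def add.commute)
      then show "emeasure lborel ((\<lambda>t. t + v i) -` A i) = emeasure lborel (A i)"
        by (simp add: lborel_distr_plus)
    qed
    finally show "emeasure (distr (lebesgue_pi N) (lebesgue_pi N) ?s) (Pi\<^sub>E {..<N} A)
      = (\<Prod>i\<in>{..<N}. emeasure lborel (A i))" .
  qed simp_all
  then have "(\<integral>\<^sup>+x. F x \<partial>lebesgue_pi N) = (\<integral>\<^sup>+x. F x \<partial>distr (lebesgue_pi N) (lebesgue_pi N) ?s)" by simp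
  also have "\<dots> = (\<integral>\<^sup>+x. F (?s x) \<partial>lebesgue_pi N)"
    by (rule nn_integral_distr) measurable
  finally show ?thesis by simp
qed

lemma measurable_row_times [measurable]:
  "row_times N a \<in> (\<Pi>\<^sub>M l\<in>{..<N}. borel) \<rightarrow>\<^sub>M (\<Pi>\<^sub>M l\<in>{..<N}. borel)"
  unfolding row_times_def by measurable

lemma gauss_density_row_times:
  assumes "orthogonal_array N a"
  shows "gauss_density N (row_times N a x) = gauss_density N x"
  by (simp add: gauss_density_eq row_times_inner[OF assms])

text \<open>The Gaussian density \<open>f\<close> is a rotation invariant weight of total mass one, and it replaces the theory
  of determinants. With \<open>T\<close> the rotation, \<open>\<integral> F (T x) dx = \<integral>\<integral> f y * F (T x) dx dy\<close>; a translation of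
  \<open>x\<close> turns this into \<open>\<integral>\<integral> f y * F (T x + y) dx dy\<close>, a translation of \<open>y\<close> into
  \<open>\<integral>\<integral> f (y - T x) * F y dx dy\<close>. Because \<open>f (y - T x)\<close> equals \<open>f\<close> at \<open>x - T\<^sup>T y\<close>, the integral over
  \<open>x\<close> is one, and \<open>\<integral> F y dy\<close> is left.\<close>

lemma nn_integral_lebesgue_pi_row_times:
  assumes a: "orthogonal_array N a" and [measurable]: "F \<in> borel_measurable (\<Pi>\<^sub>M l\<in>{..<N}. borel)"
  shows "(\<integral>\<^sup>+x. F (row_times N a x) \<partial>lebesgue_pi N) = (\<integral>\<^sup>+x. F x \<partial>lebesgue_pi N)"
proof -
  note sets_lebesgue_pi[measurable_cong]
  let ?L = "lebesgue_pi N" and ?f = "gauss_density N" and ?T = "row_times N a"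
  let ?T' = "row_times N (\<lambda>i j. a j i)"
  let ?add = "\<lambda>x v. \<lambda>c\<in>{..<N}. x c + v c :: real"
  let ?sub = "\<lambda>x v. \<lambda>c\<in>{..<N}. x c + - v c :: real"
  interpret L: sigma_finite_measure ?L
    by (rule lborel_product.sigma_finite) simp
  interpret LL: pair_sigma_finite ?L ?L ..
  have f1: "(\<integral>\<^sup>+x. ?f x \<partial>?L) = 1"
    using prob_space.emeasure_space_1[OF prob_space_gauss[of N]]
    by (simp add: gauss_eq_density emeasure_density)
  have f_cong: "?f x = ?f y" if "\<And>c. c < N \<Longrightarrow> x c = y c" for x y
    using that by (auto simp: gauss_density_def intro!: prod.cong arg_cong[of _ _ ennreal])
  have f_sym: "?f (?sub y (?T x)) = ?f (?sub x (?T' y))" for x y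
  proof -
    have "?f (?sub y (?T x)) = ?f (?T (?sub (?T' y) x))"
      by (rule f_cong)
         (simp add: row_times_transpose[OF a, of _ y, symmetric],
          simp add: row_times_def sum_subtractf left_diff_distrib)
    also have "\<dots> = ?f (?sub (?T' y) x)" by (rule gauss_density_row_times[OF a])
    also have "\<dots> = ?f (?sub x (?T' y))"
      by (auto simp: gauss_density_eq algebra_simps intro!: sum.cong)
    finally show ?thesis .
  qed
  have T_add: "?T (?add x (?T' y)) = ?add (?T x) y" for x y
  proof
    fix c
    show "?T (?add x (?T' y)) c = ?add (?T x) y c"
    proof (cases "c < N")
      case True
      have "?T (?add x (?T' y)) c = ?T x c + ?T (?T' y) c"
        using True by (simp add: row_times_def sum.distrib distrib_right)
      then show ?thesis using row_times_transpose[OF a True, of y] True by simp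
    qed (simp add: row_times_def)
  qed
  have "(\<integral>\<^sup>+x. F (?T x) \<partial>?L) = (\<integral>\<^sup>+x. \<integral>\<^sup>+y. ?f y * F (?T x) \<partial>?L \<partial>?L)"
    by (simp add: nn_integral_multc f1)
  also have "\<dots> = (\<integral>\<^sup>+y. \<integral>\<^sup>+x. ?f y * F (?T x) \<partial>?L \<partial>?L)"
    by (rule LL.Fubini'[symmetric]) measurable
  also have "\<dots> = (\<integral>\<^sup>+y. \<integral>\<^sup>+x. ?f y * F (?T (?add x (?T' y))) \<partial>?L \<partial>?L)"
  proof (rule nn_integral_cong)
    fix y
    show "(\<integral>\<^sup>+x. ?f y * F (?T x) \<partial>?L) = (\<integral>\<^sup>+x. ?f y * F (?T (?add x (?T' y))) \<partial>?L)"
      by (rule nn_integral_lebesgue_pi_shift[symmetric, of "\<lambda>x. ?f y * F (?T x)"]) measurable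
  qed
  also have "\<dots> = (\<integral>\<^sup>+y. \<integral>\<^sup>+x. ?f y * F (?add y (?T x)) \<partial>?L \<partial>?L)"
    unfolding T_add by (simp add: add.commute)
  also have "\<dots> = (\<integral>\<^sup>+x. \<integral>\<^sup>+y. ?f y * F (?add y (?T x)) \<partial>?L \<partial>?L)"
    by (rule LL.Fubini') measurable
  also have "\<dots> = (\<integral>\<^sup>+x. \<integral>\<^sup>+y. ?f (?sub y (?T x)) * F y \<partial>?L \<partial>?L)"
  proof (rule nn_integral_cong)
    fix x
    have "(\<integral>\<^sup>+y. ?f (?sub y (?T x)) * F y \<partial>?L)
        = (\<integral>\<^sup>+y. ?f (?sub (?add y (?T x)) (?T x)) * F (?add y (?T x)) \<partial>?L)"
      by (subst nn_integral_lebesgue_pi_shift) auto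
    also have "\<dots> = (\<integral>\<^sup>+y. ?f y * F (?add y (?T x)) \<partial>?L)"
      by (intro nn_integral_cong arg_cong2[of _ _ _ _ "(*)"] f_cong refl) auto
    finally show "(\<integral>\<^sup>+y. ?f y * F (?add y (?T x)) \<partial>?L) = (\<integral>\<^sup>+y. ?f (?sub y (?T x)) * F y \<partial>?L)" ..
  qed
  also have "\<dots> = (\<integral>\<^sup>+x. \<integral>\<^sup>+y. ?f (?sub x (?T' y)) * F y \<partial>?L \<partial>?L)"
    unfolding f_sym ..
  also have "\<dots> = (\<integral>\<^sup>+y. \<integral>\<^sup>+x. ?f (?sub x (?T' y)) * F y \<partial>?L \<partial>?L)"
    by (rule LL.Fubini'[symmetric]) measurable
  also have "\<dots> = (\<integral>\<^sup>+y. (\<integral>\<^sup>+x. ?f (?sub x (?T' y)) \<partial>?L) * F y \<partial>?L)"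
    by (intro nn_integral_cong nn_integral_multc) measurable
  also have "\<dots> = (\<integral>\<^sup>+y. F y \<partial>?L)"
    by (intro nn_integral_cong) (subst nn_integral_lebesgue_pi_shift, auto simp: f1)
  finally show ?thesis .
qed

text \<open>Lebesgue measure and the Gaussian density are both invariant under rotations.\<close>

lemma distr_gauss_row_times:
  assumes a: "orthogonal_array N a"
  shows "distr (gauss N) (gauss N) (row_times N a) = gauss N"
proof (rule measure_eqI)
  note sets_lebesgue_pi[measurable_cong]
  fix A assume "A \<in> sets (distr (gauss N) (gauss N) (row_times N a))"
  then have A[measurable]: "A \<in> sets (\<Pi>\<^sub>M l\<in>{..<N}. borel)" by (simp add: sets_gauss)
  have T[measurable]: "row_times N a \<in> gauss N \<rightarrow>\<^sub>M gauss N" by measurable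
  have "emeasure (distr (gauss N) (gauss N) (row_times N a)) A
    = (\<integral>\<^sup>+x. indicator A (row_times N a x) \<partial>gauss N)"
    by (subst nn_integral_indicator[symmetric], simp add: sets_gauss)
       (rule nn_integral_distr, measurable)
  also have "\<dots> = (\<integral>\<^sup>+x. gauss_density N (row_times N a x) * indicator A (row_times N a x) \<partial>lebesgue_pi N)"
    unfolding gauss_eq_density gauss_density_row_times[OF a]
    by (rule nn_integral_density) measurable
  also have "\<dots> = (\<integral>\<^sup>+x. gauss_density N x * indicator A x \<partial>lebesgue_pi N)"
    by (rule nn_integral_lebesgue_pi_row_times[OF a]) measurable
  also have "\<dots> = emeasure (gauss N) A"
    unfolding gauss_eq_density by (rule emeasure_density[symmetric]) measurable
  finally show "emeasure (distr (gauss N) (gauss N) (row_times N a)) A = emeasure (gauss N) A" .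
qed simp

section \<open>Orthogonal factors and the Gram-Schmidt process\<close>

definition dot :: "nat \<Rightarrow> (nat \<Rightarrow> real) \<Rightarrow> (nat \<Rightarrow> real) \<Rightarrow> real" where
  "dot N x y = (\<Sum>l<N. x l * y l)"

lemma dot_commute: "dot N x y = dot N y x"
  by (simp add: dot_def mult.commute)

lemma dot_self_nonneg: "0 \<le> dot N x x"
  by (simp add: dot_def sum_nonneg)

lemma dot_self_eq_0_iff: "dot N x x = 0 \<longleftrightarrow> (\<forall>l<N. x l = 0)"
  unfolding dot_def by (subst sum_nonneg_eq_0_iff) auto

lemma dot_add_left: "dot N (\<lambda>l. x l + y l) z = dot N x z + dot N y z"
  by (simp add: dot_def distrib_right sum.distrib)

lemma dot_diff_left: "dot N (\<lambda>l. x l - y l) z = dot N x z - dot N y z"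
  by (simp add: dot_def left_diff_distrib sum_subtractf)

lemma dot_diff_right: "dot N z (\<lambda>l. x l - y l) = dot N z x - dot N z y"
  by (simp add: dot_def right_diff_distrib sum_subtractf)

lemma dot_scale_left: "dot N (\<lambda>l. c * x l) z = c * dot N x z"
  by (simp add: dot_def sum_distrib_left mult.assoc)

lemma dot_scale_right: "dot N z (\<lambda>l. c * x l) = c * dot N z x"
  by (simp add: dot_def sum_distrib_left mult.left_commute)

lemma dot_sum_left: "dot N (\<lambda>l. \<Sum>i\<in>J. z i * w i l) y = (\<Sum>i\<in>J. z i * dot N (w i) y)"
proof -
  have "dot N (\<lambda>l. \<Sum>i\<in>J. z i * w i l) y = (\<Sum>l<N. \<Sum>i\<in>J. z i * (w i l * y l))"
    by (simp add: dot_def sum_distrib_right mult.assoc)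
  also have "\<dots> = (\<Sum>i\<in>J. \<Sum>l<N. z i * (w i l * y l))" by (rule sum.swap)
  finally show ?thesis by (simp add: dot_def sum_distrib_left)
qed

lemma dot_cong: "(\<And>l. l < N \<Longrightarrow> x l = x' l) \<Longrightarrow> (\<And>l. l < N \<Longrightarrow> y l = y' l) \<Longrightarrow> dot N x y = dot N x' y'"
  by (simp add: dot_def)

lemma dot_row_times:
  "orthogonal_array N a \<Longrightarrow> dot N (row_times N a x) (row_times N a y) = dot N x y"
  unfolding dot_def by (rule row_times_inner)

lemma orthogonal_array_mult:
  assumes a: "orthogonal_array N a" and b: "orthogonal_array N b"
  shows "orthogonal_array N (\<lambda>i j. \<Sum>l<N. a i l * b l j)"
proof -
  have "(\<Sum>c<N. (\<Sum>l<N. a i l * b l c) * (\<Sum>l<N. a j l * b l c)) = (\<Sum>l<N. a i l * a j l)" for i j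
    using row_times_inner[OF b, of "a i" "a j"] by (simp add: row_times_def)
  moreover have "(\<Sum>c<N. (\<Sum>l<N. a c l * b l i) * (\<Sum>l<N. a c l * b l j)) = (\<Sum>l<N. b l i * b l j)" for i j
    using row_times_inner[OF orthogonal_array_transpose[OF a], of "\<lambda>l. b l i" "\<lambda>l. b l j"]
    by (simp add: row_times_def mult.commute)
  ultimately show ?thesis using a b by (simp add: orthogonal_array_def)
qed

lemma row_times_mult:
  assumes "c < N"
  shows "row_times N (\<lambda>i j. \<Sum>l<N. a i l * b l j) x c = row_times N b (row_times N a x) c"
  using assms unfolding row_times_def
  by (simp add: sum_distrib_left sum_distrib_right mult.assoc) (rule sum.swap)

text \<open>The matrix \<open>Id - 2 u u\<^sup>T / |u|\<^sup>2\<close> is the Householder reflection in the hyperplane orthogonal to \<open>u\<close>.\<close>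

lemma orthogonal_array_reflection:
  fixes u :: "nat \<Rightarrow> real"
  assumes s: "dot N u u \<noteq> 0"
  shows "orthogonal_array N (\<lambda>i j. (if i = j then 1 else 0) - 2 * u i * u j / dot N u u)"
proof -
  let ?s = "dot N u u"
  define e :: "nat \<Rightarrow> nat \<Rightarrow> real" where "e = (\<lambda>i l. if i = l then 1 else 0)"
  define r where "r = (\<lambda>i l. e i l - 2 * u i / ?s * u l)"
  have e: "dot N (e i) x = x i" "dot N x (e i) = x i" if "i < N" for i x
    using that by (simp_all add: dot_def e_def if_distrib if_distribR cong: if_cong)
  have rr: "dot N (r i) (r j) = (if i = j then 1 else 0)" if ij: "i < N" "j < N" for i j
  proof -
    define a b where "a = 2 * u i / ?s" and "b = 2 * u j / ?s"
    have "b * ?s = 2 * u j" "b * u i = a * u j" using s by (simp_all add: a_def b_def)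
    moreover have "dot N (r i) (r j) = (e i j - b * u i) - a * (u j - b * ?s)"
      unfolding r_def a_def[symmetric] b_def[symmetric] dot_diff_left dot_diff_right dot_scale_left dot_scale_right
      using ij by (simp add: e right_diff_distrib)
    ultimately have "dot N (r i) (r j) = e i j" by (simp add: right_diff_distrib)
    then show ?thesis by (simp add: e_def)
  qed
  have "(\<Sum>l<N. r l i * r l j) = dot N (r i) (r j)" for i j
    unfolding dot_def by (rule sum.cong) (auto simp: r_def e_def)
  then have "orthogonal_array N r"
    using rr unfolding orthogonal_array_def dot_def by simp
  then show ?thesis by (simp add: r_def e_def)
qed

lemma row_times_reflection:
  assumes "c < N"
  shows "row_times N (\<lambda>i j. (if i = j then 1 else 0) - 2 * u i * u j / s) x c = x c - 2 * dot N x u / s * u c"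
proof -
  have "(\<Sum>l<N. x l * ((if l = c then 1 else 0) - 2 * u l * u c / s))
      = (\<Sum>l<N. (if l = c then x l else 0) - (2 / s * u c) * (x l * u l))"
    by (rule sum.cong) (auto simp: algebra_simps)
  also have "\<dots> = x c - (2 / s * u c) * dot N x u"
    using assms by (simp add: sum_subtractf sum_distrib_left dot_def)
  finally show ?thesis using assms by (simp add: row_times_def)
qed

text \<open>The orthogonal matrix is a product of reflections, at most one for each row. If the first \<open>m\<close> rows
  agree after multiplication by \<open>q\<close>, then the difference \<open>u\<close> of the two rows with index \<open>m\<close> is
  orthogonal to the rows that agree already, and the two rows have the same length. Hence the
  reflection along \<open>u\<close> exchanges them and fixes all earlier rows.\<close>

lemma equal_gram_imp_orthogonal:
  fixes m :: nat
  assumes "\<And>i j. i < m \<Longrightarrow> j < m \<Longrightarrow> dot N (H i) (H j) = dot N (H' i) (H' j)"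
  shows "\<exists>q. orthogonal_array N q \<and> (\<forall>i<m. \<forall>c<N. row_times N q (H i) c = H' i c)"
  using assms
proof (induction m)
  case 0
  have "(\<Sum>l<N. (if i = l then 1 else 0) * (if j = l then 1 else 0)) = (if i = j then 1 else (0 :: real))"
    if "i < N" for i j
  proof -
    have "(\<Sum>l<N. (if i = l then 1 else 0) * (if j = l then 1 else 0))
        = (\<Sum>l<N. if i = l then (if j = i then 1 else 0) else (0 :: real))"
      by (intro sum.cong) auto
    then show ?thesis using that by auto
  qed
  moreover have "(if i = j then 1 else 0) = (if j = i then 1 else (0 :: real))" for i j :: nat by auto
  ultimately have "orthogonal_array N (\<lambda>i j. if i = j then 1 else 0)"
    unfolding orthogonal_array_def by presburger
  then show ?case by auto
next
  case (Suc m)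
  have "\<exists>q. orthogonal_array N q \<and> (\<forall>i<m. \<forall>c<N. row_times N q (H i) c = H' i c)"
    by (rule Suc.IH) (rule Suc.prems; simp)
  then obtain q where q: "orthogonal_array N q" and qH: "\<And>i c. i < m \<Longrightarrow> c < N \<Longrightarrow> row_times N q (H i) c = H' i c"
    by auto
  define g where "g = row_times N q (H m)"
  define u where "u = (\<lambda>l. g l - H' m l)"
  have gg: "dot N g g = dot N (H' m) (H' m)"
    using Suc.prems[of m m] by (simp add: g_def dot_row_times[OF q])
  have gH: "dot N (H' i) u = 0" if "i < m" for i
  proof -
    have "dot N (H' i) g = dot N (row_times N q (H i)) g"
      using qH[OF that] by (intro dot_cong) auto
    also have "\<dots> = dot N (H' i) (H' m)"
      using Suc.prems[of i m] that by (simp add: g_def dot_row_times[OF q])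
    finally show ?thesis by (simp add: u_def dot_diff_right)
  qed
  show ?case
  proof (cases "dot N u u = 0")
    case True
    then have "row_times N q (H m) c = H' m c" if "c < N" for c
      using that by (simp add: dot_self_eq_0_iff u_def g_def)
    with q qH show ?thesis by (intro exI[of _ q]) (auto simp: less_Suc_eq)
  next
    case False
    let ?s = "dot N u u"
    define r where "r = (\<lambda>i j. (if i = j then 1 else 0) - 2 * u i * u j / ?s)"
    have r: "orthogonal_array N r" unfolding r_def by (rule orthogonal_array_reflection[OF False])
    have rx: "row_times N r x c = x c - 2 * dot N x u / ?s * u c" if "c < N" for x c
      unfolding r_def by (rule row_times_reflection[OF that])
    have su: "?s = 2 * dot N g u"
      by (simp add: u_def dot_diff_right dot_diff_left gg dot_commute[of N "H' m" g])
    have "row_times N (\<lambda>i j. \<Sum>l<N. q i l * r l j) (H i) c = H' i c" if i: "i < Suc m" and c: "c < N" for i c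
    proof (cases "i = m")
      case True
      then show ?thesis
        using False su by (simp add: row_times_mult[OF c] rx[OF c] g_def[symmetric]) (simp add: u_def)
    next
      case False
      with i have i: "i < m" by simp
      have "dot N (row_times N q (H i)) u = dot N (H' i) u"
        using qH[OF i] by (intro dot_cong) auto
      then show ?thesis using gH[OF i] qH[OF i c] by (simp add: row_times_mult[OF c] rx[OF c])
    qed
    with orthogonal_array_mult[OF q r] show ?thesis by blast
  qed
qed

text \<open>A row that depends linearly on its predecessors gives a zero vector, by \<open>x / 0 = 0\<close>. The vectors are
  orthonormal up to such zero vectors, and all identities below hold without a rank condition; in
  particular no null set of degenerate Gaussian matrices has to be removed.\<close>

function gram_schmidt :: "nat \<Rightarrow> (nat \<Rightarrow> nat \<Rightarrow> real) \<Rightarrow> nat \<Rightarrow> nat \<Rightarrow> real" where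
  "gram_schmidt N g j =
    (let r = (\<lambda>l. g j l - (\<Sum>i\<in>{..<j}. dot N (g j) (gram_schmidt N g i) * gram_schmidt N g i l))
     in (\<lambda>l. r l / sqrt (dot N r r)))"
  by pat_completeness auto
termination by (relation "Wellfounded.measure (\<lambda>(N, g, j). j)") auto

declare gram_schmidt.simps [simp del]

text \<open>The factor \<open>L\<close> of the decomposition \<open>g = L W\<close>, where the rows of \<open>W\<close> are the Gram-Schmidt vectors.\<close>

definition gs_coeff :: "nat \<Rightarrow> (nat \<Rightarrow> nat \<Rightarrow> real) \<Rightarrow> nat \<Rightarrow> nat \<Rightarrow> real" where
  "gs_coeff N g j i = dot N (g j) (gram_schmidt N g i)"

definition gs_residual :: "nat \<Rightarrow> (nat \<Rightarrow> nat \<Rightarrow> real) \<Rightarrow> nat \<Rightarrow> nat \<Rightarrow> real" where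
  "gs_residual N g j l = g j l - (\<Sum>i<j. gs_coeff N g j i * gram_schmidt N g i l)"

lemma gram_schmidt_eq:
  "gram_schmidt N g j = (\<lambda>l. gs_residual N g j l / sqrt (dot N (gs_residual N g j) (gs_residual N g j)))"
  by (subst gram_schmidt.simps) (simp add: Let_def gs_residual_def[abs_def] gs_coeff_def)

lemma gram_schmidt_dot_self: "dot N (gram_schmidt N g j) (gram_schmidt N g j) \<in> {0, 1}"
proof -
  let ?r = "gs_residual N g j"
  have "dot N (gram_schmidt N g j) (gram_schmidt N g j) = dot N ?r ?r / (sqrt (dot N ?r ?r) * sqrt (dot N ?r ?r))"
    unfolding gram_schmidt_eq by (simp add: dot_def sum_divide_distrib)
  then show ?thesis using dot_self_nonneg[of N ?r] by simp
qed

lemma gs_coeff_gram_schmidt_zero: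
  assumes "dot N (gram_schmidt N g i) (gram_schmidt N g i) = 0"
  shows "gs_coeff N g j i = 0"
  using assms by (simp add: dot_self_eq_0_iff gs_coeff_def) (simp add: dot_def)

lemma gram_schmidt_orthogonal:
  "i < j \<Longrightarrow> dot N (gram_schmidt N g i) (gram_schmidt N g j) = 0"
proof (induction j arbitrary: i rule: less_induct)
  case (less j)
  let ?w = "gram_schmidt N g"
  have orth: "dot N (?w i') (?w i) = 0" if "i' < j" "i' \<noteq> i" for i'
    using less.IH[of i i'] less.IH[of i' i] that less.prems dot_commute[of N "?w i'" "?w i"]
    by (cases "i' < i") auto
  have "dot N (gs_residual N g j) (?w i)
      = gs_coeff N g j i - (\<Sum>i'<j. gs_coeff N g j i' * dot N (?w i') (?w i))"
    unfolding gs_residual_def[abs_def] by (simp add: dot_diff_left dot_sum_left gs_coeff_def)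
  also have "(\<Sum>i'<j. gs_coeff N g j i' * dot N (?w i') (?w i))
      = (\<Sum>i'<j. if i' = i then gs_coeff N g j i * dot N (?w i) (?w i) else 0)"
    using orth by (intro sum.cong) auto
  also have "\<dots> = gs_coeff N g j i * dot N (?w i) (?w i)" using less.prems by simp
  also have "gs_coeff N g j i - \<dots> = 0"
    using gram_schmidt_dot_self[of N g i] gs_coeff_gram_schmidt_zero[of N g i j] by auto
  finally have "dot N (gs_residual N g j) (?w i) = 0" .
  then have "dot N (?w j) (?w i) = 0"
    by (subst (1) gram_schmidt_eq) (simp add: dot_def sum_divide_distrib[symmetric])
  then show ?case by (simp add: dot_commute)
qed

lemma gs_coeff_diag: "gs_coeff N g j j = sqrt (dot N (gs_residual N g j) (gs_residual N g j))"
proof -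
  let ?r = "gs_residual N g j" and ?w = "gram_schmidt N g"
  have "gs_coeff N g j j = dot N (\<lambda>l. ?r l + (\<Sum>i<j. gs_coeff N g j i * ?w i l)) (?w j)"
    unfolding gs_coeff_def[of N g j j] by (rule dot_cong) (auto simp: gs_residual_def)
  also have "\<dots> = dot N ?r (?w j)"
    by (simp add: dot_add_left dot_sum_left gram_schmidt_orthogonal)
  also have "\<dots> = dot N ?r ?r / sqrt (dot N ?r ?r)"
    unfolding gram_schmidt_eq by (simp add: dot_def sum_divide_distrib)
  finally show ?thesis using dot_self_nonneg[of N ?r] by (simp add: real_div_sqrt)
qed

lemma gram_schmidt_expansion:
  assumes "l < N"
  shows "g j l = (\<Sum>i<Suc j. gs_coeff N g j i * gram_schmidt N g i l)"
proof -
  let ?r = "gs_residual N g j"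
  have "gs_coeff N g j j * gram_schmidt N g j l = ?r l"
  proof (cases "dot N ?r ?r = 0")
    case True
    then show ?thesis using assms by (simp add: gs_coeff_diag) (simp add: dot_self_eq_0_iff)
  next
    case False
    then show ?thesis by (simp add: gs_coeff_diag gram_schmidt_eq)
  qed
  then show ?thesis by (simp add: gs_residual_def)
qed

lemma gs_coeff_above_diag:
  assumes "j < i"
  shows "gs_coeff N g j i = 0"
proof -
  have "gs_coeff N g j i = dot N (\<lambda>l. \<Sum>i'<Suc j. gs_coeff N g j i' * gram_schmidt N g i' l) (gram_schmidt N g i)"
    unfolding gs_coeff_def[of N g j i] by (rule dot_cong[OF gram_schmidt_expansion refl])
  also have "\<dots> = 0"
    unfolding dot_sum_left using assms by (intro sum.neutral) (auto simp: gram_schmidt_orthogonal)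
  finally show ?thesis .
qed

text \<open>In matrix form \<open>g g\<^sup>T = L L\<^sup>T\<close>, the Cholesky decomposition of the Gram matrix.\<close>

lemma gs_coeff_gram:
  assumes "j' < m"
  shows "dot N (g j) (g j') = (\<Sum>i<m. gs_coeff N g j i * gs_coeff N g j' i)"
proof -
  have "dot N (g j) (g j') = dot N (\<lambda>l. \<Sum>i<Suc j'. gs_coeff N g j' i * gram_schmidt N g i l) (g j)"
    by (subst dot_commute) (rule dot_cong[OF gram_schmidt_expansion refl])
  also have "\<dots> = (\<Sum>i<Suc j'. gs_coeff N g j' i * gs_coeff N g j i)"
    unfolding dot_sum_left by (simp add: gs_coeff_def dot_commute)
  also have "\<dots> = (\<Sum>i<m. gs_coeff N g j' i * gs_coeff N g j i)"
    using assms by (intro sum.mono_neutral_left) (auto simp: gs_coeff_above_diag)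
  finally show ?thesis by (simp add: mult.commute)
qed

lemma gs_coeff_diag_square: "(gs_coeff N g j j)\<^sup>2 = dot N (g j) (g j) - (\<Sum>i<j. (gs_coeff N g j i)\<^sup>2)"
  using gs_coeff_gram[of j "Suc j" N g j] by (simp add: power2_eq_square)

text \<open>The transpose of \<open>W\<close> is a contraction; zero rows are the reason why it need not be an isometry.\<close>

lemma gram_schmidt_bessel:
  "(\<Sum>l<N. (\<Sum>i<n. z i * gram_schmidt N g i l)\<^sup>2) \<le> (\<Sum>i<n. (z i)\<^sup>2)"
proof -
  let ?w = "gram_schmidt N g" and ?W = "\<lambda>l. \<Sum>i<n. z i * gram_schmidt N g i l"
  have W: "dot N (?w i) ?W = z i * dot N (?w i) (?w i)" if "i < n" for i
  proof -
    have 0: "dot N (?w i') (?w i) = 0" if "i' \<noteq> i" for i'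
      using that gram_schmidt_orthogonal[of i i' N g] gram_schmidt_orthogonal[of i' i N g]
        dot_commute[of N "?w i" "?w i'"] by (cases i i' rule: linorder_cases) simp_all
    have "dot N (?w i) ?W = dot N ?W (?w i)" by (rule dot_commute)
    also have "\<dots> = (\<Sum>i'<n. z i' * dot N (?w i') (?w i))" by (rule dot_sum_left)
    also have "\<dots> = (\<Sum>i'<n. if i' = i then z i * dot N (?w i) (?w i) else 0)"
      by (rule sum.cong[OF refl]) (simp add: 0)
    finally show ?thesis using that by simp
  qed
  have "(\<Sum>l<N. (?W l)\<^sup>2) = dot N ?W ?W"
    by (simp add: dot_def power2_eq_square)
  also have "\<dots> = (\<Sum>i<n. z i * dot N (?w i) ?W)" by (rule dot_sum_left)
  also have "\<dots> \<le> (\<Sum>i<n. (z i)\<^sup>2)"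
  proof (rule sum_mono)
    fix i assume "i \<in> {..<n}"
    then have "z i * dot N (?w i) ?W = (z i)\<^sup>2 * dot N (?w i) (?w i)"
      by (simp add: W power2_eq_square)
    also have "\<dots> \<le> (z i)\<^sup>2 * 1"
      using gram_schmidt_dot_self[of N g i] by (intro mult_left_mono) auto
    finally show "z i * dot N (?w i) ?W \<le> (z i)\<^sup>2" by simp
  qed
  finally show ?thesis .
qed

lemma gram_schmidt_cong:
  "(\<And>i. i \<le> j \<Longrightarrow> g i = g' i) \<Longrightarrow> gram_schmidt N g j = gram_schmidt N g' j"
proof (induction j rule: less_induct)
  case (less j)
  have "gram_schmidt N g i = gram_schmidt N g' i" if "i < j" for i
    using less that by auto
  then have "gs_residual N g j = gs_residual N g' j"
    using less.prems[of j] by (auto simp: gs_residual_def[abs_def] gs_coeff_def)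
  then show ?case by (simp add: gram_schmidt_eq)
qed

section \<open>The triangular factor of a Gaussian matrix\<close>

definition gauss_rows :: "nat \<Rightarrow> nat \<Rightarrow> (nat \<Rightarrow> nat \<Rightarrow> real) measure" where
  "gauss_rows m N = (\<Pi>\<^sub>M j\<in>{..<m}. gauss N)"

lemma sets_gauss_rows [measurable_cong]:
  "sets (gauss_rows m N) = sets (\<Pi>\<^sub>M j\<in>{..<m}. \<Pi>\<^sub>M l\<in>{..<N}. borel)"
  unfolding gauss_rows_def by (rule sets_PiM_cong) (auto simp: sets_gauss)

lemma product_sigma_finite_gauss: "product_sigma_finite (\<lambda>_::nat. gauss N)"
  by (intro product_sigma_finite.intro prob_space_imp_sigma_finite prob_space_gauss)

lemma prob_space_gauss_rows: "prob_space (gauss_rows m N)"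
  unfolding gauss_rows_def by (rule prob_space_PiM) (rule prob_space_gauss)

lemma measurable_gauss_entry: "l < N \<Longrightarrow> (\<lambda>x. x l) \<in> borel_measurable (gauss N)"
  unfolding measurable_cong_sets[OF sets_gauss refl] by (intro measurable_component_singleton) simp

lemma measurable_gauss_rows_entry:
  assumes "j < m" "l < N"
  shows "(\<lambda>g. g j l) \<in> borel_measurable (gauss_rows m N)"
proof -
  have "(\<lambda>g. g j) \<in> gauss_rows m N \<rightarrow>\<^sub>M gauss N"
    unfolding gauss_rows_def using assms by (intro measurable_component_singleton) simp
  from this measurable_gauss_entry[OF assms(2)] show ?thesis by (rule measurable_compose)
qed

lemma measurable_gram_schmidt:
  "i < m \<Longrightarrow> l < N \<Longrightarrow> (\<lambda>g. gram_schmidt N g i l) \<in> borel_measurable (gauss_rows m N)"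
proof (induction i arbitrary: l rule: less_induct)
  case (less i)
  have [measurable]: "(\<lambda>g. gram_schmidt N g i' l) \<in> borel_measurable (gauss_rows m N)" if "i' < i" "l < N" for i' l
    using less that by auto
  have [measurable]: "(\<lambda>g. g i l) \<in> borel_measurable (gauss_rows m N)" if "l < N" for l
    using less.prems that by (rule_tac measurable_gauss_rows_entry)
  have [measurable]: "(\<lambda>g. gs_residual N g i l) \<in> borel_measurable (gauss_rows m N)" if "l < N" for l
    unfolding gs_residual_def gs_coeff_def dot_def using that by measurable
  show ?case
    unfolding gram_schmidt_eq dot_def using less.prems by measurable
qed

lemma measurable_gs_coeff:
  assumes "j < m" "i < m"
  shows "(\<lambda>g. gs_coeff N g j i) \<in> borel_measurable (gauss_rows m N)"
proof -
  have [measurable]: "(\<lambda>g. g j l) \<in> borel_measurable (gauss_rows m N)"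
    "(\<lambda>g. gram_schmidt N g i l) \<in> borel_measurable (gauss_rows m N)" if "l \<in> {..<N}" for l
    using that assms by (auto intro: measurable_gauss_rows_entry measurable_gram_schmidt)
  show ?thesis unfolding gs_coeff_def dot_def by measurable
qed

text \<open>A bound that holds conditionally on all other rows, uniformly in them, holds without conditioning.\<close>

lemma nn_integral_gauss_rows_fix_row_le:
  assumes j: "j < m" and [measurable]: "f \<in> borel_measurable (gauss_rows m N)"
    and le: "\<And>g. (\<integral>\<^sup>+y. f (g(j := y)) \<partial>gauss N) \<le> K"
  shows "(\<integral>\<^sup>+g. f g \<partial>gauss_rows m N) \<le> K"
proof -
  interpret product_sigma_finite "\<lambda>_::nat. gauss N" by (rule product_sigma_finite_gauss)
  interpret P: prob_space "Pi\<^sub>M ({..<m} - {j}) (\<lambda>_. gauss N)"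
    by (rule prob_space_PiM) (rule prob_space_gauss)
  have eq: "insert j ({..<m} - {j}) = {..<m}" using j by auto
  have "(\<integral>\<^sup>+g. f g \<partial>gauss_rows m N)
      = (\<integral>\<^sup>+g. \<integral>\<^sup>+y. f (g(j := y)) \<partial>gauss N \<partial>Pi\<^sub>M ({..<m} - {j}) (\<lambda>_. gauss N))"
    using product_nn_integral_insert[of "{..<m} - {j}" j f] assms(2)
    unfolding eq gauss_rows_def by simp
  also have "\<dots> \<le> (\<integral>\<^sup>+g. K \<partial>Pi\<^sub>M ({..<m} - {j}) (\<lambda>_. gauss N))"
    by (intro nn_integral_mono le)
  also have "\<dots> = K" by (simp add: P.emeasure_space_1)
  finally show ?thesis .
qed

text \<open>The last factor is the only one that involves the last row. Integrating this row first, for fixed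
  earlier rows, gives a factor of at most \<open>K\<close>, and induction does the rest.\<close>

lemma nn_integral_gauss_rows_prod_le:
  fixes \<phi> :: "nat \<Rightarrow> (nat \<Rightarrow> nat \<Rightarrow> real) \<Rightarrow> ennreal"
  assumes meas: "\<And>j n. j < n \<Longrightarrow> n \<le> m \<Longrightarrow> \<phi> j \<in> borel_measurable (gauss_rows n N)"
    and dep: "\<And>j g g'. (\<And>i. i \<le> j \<Longrightarrow> g i = g' i) \<Longrightarrow> \<phi> j g = \<phi> j g'"
    and le: "\<And>j g. j < m \<Longrightarrow> (\<integral>\<^sup>+y. \<phi> j (g(j := y)) \<partial>gauss N) \<le> K"
  shows "(\<integral>\<^sup>+g. (\<Prod>j<m. \<phi> j g) \<partial>gauss_rows m N) \<le> K ^ m"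
proof -
  interpret product_sigma_finite "\<lambda>_::nat. gauss N" by (rule product_sigma_finite_gauss)
  have "(\<integral>\<^sup>+g. (\<Prod>j<n. \<phi> j g) \<partial>gauss_rows n N) \<le> K ^ n" if "n \<le> m" for n
    using that
  proof (induction n)
    case 0
    then show ?case
      using prob_space.emeasure_space_1[OF prob_space_gauss_rows[of 0 N]] by simp
  next
    case (Suc n)
    have [measurable]: "\<phi> j \<in> borel_measurable (gauss_rows (Suc n) N)" if "j < Suc n" for j
      using meas[OF that] Suc.prems by simp
    have [measurable]: "\<phi> j \<in> borel_measurable (gauss_rows n N)" if "j < n" for j
      using meas[OF that] Suc.prems by simp
    have "(\<integral>\<^sup>+g. (\<Prod>j<Suc n. \<phi> j g) \<partial>gauss_rows (Suc n) N)
      = (\<integral>\<^sup>+g. \<integral>\<^sup>+y. (\<Prod>j<Suc n. \<phi> j (g(n := y))) \<partial>gauss N \<partial>gauss_rows n N)"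
    proof -
      have "(\<lambda>g. \<Prod>j<Suc n. \<phi> j g) \<in> borel_measurable (gauss_rows (Suc n) N)" by measurable
      then show ?thesis
        using product_nn_integral_insert[of "{..<n}" n "\<lambda>g. \<Prod>j<Suc n. \<phi> j g"]
        by (simp only: gauss_rows_def lessThan_Suc[symmetric]) simp
    qed
    also have "\<dots> = (\<integral>\<^sup>+g. \<integral>\<^sup>+y. (\<Prod>j<n. \<phi> j g) * \<phi> n (g(n := y)) \<partial>gauss N \<partial>gauss_rows n N)"
    proof -
      have "\<phi> j (g(n := y)) = \<phi> j g" if "j < n" for j g y
        using that by (intro dep) auto
      then show ?thesis by simp
    qed
    also have "\<dots> \<le> (\<integral>\<^sup>+g. (\<Prod>j<n. \<phi> j g) * K \<partial>gauss_rows n N)"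
    proof (rule nn_integral_mono)
      fix g assume g: "g \<in> space (gauss_rows n N)"
      have "(\<lambda>y. g(n := y)) \<in> gauss N \<rightarrow>\<^sub>M gauss_rows (Suc n) N"
        using g unfolding gauss_rows_def lessThan_Suc
        by (intro measurable_component_update) auto
      then have "(\<lambda>y. \<phi> n (g(n := y))) \<in> borel_measurable (gauss N)"
        by (rule measurable_compose) measurable
      then have "(\<integral>\<^sup>+y. (\<Prod>j<n. \<phi> j g) * \<phi> n (g(n := y)) \<partial>gauss N)
          = (\<Prod>j<n. \<phi> j g) * (\<integral>\<^sup>+y. \<phi> n (g(n := y)) \<partial>gauss N)"
        by (rule nn_integral_cmult)
      also have "\<dots> \<le> (\<Prod>j<n. \<phi> j g) * K"
        using le[of n g] Suc.prems by (intro mult_left_mono) auto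
      finally show "(\<integral>\<^sup>+y. (\<Prod>j<n. \<phi> j g) * \<phi> n (g(n := y)) \<partial>gauss N) \<le> (\<Prod>j<n. \<phi> j g) * K" .
    qed
    also have "\<dots> = (\<integral>\<^sup>+g. (\<Prod>j<n. \<phi> j g) \<partial>gauss_rows n N) * K"
      by (rule nn_integral_multc) measurable
    also have "\<dots> \<le> K ^ n * K"
      using Suc by (intro mult_right_mono) auto
    finally show ?case by (simp add: mult.commute)
  qed
  then show ?thesis by simp
qed

lemma exponential_markov:
  assumes [measurable]: "f \<in> borel_measurable M"
  shows "emeasure M {x \<in> space M. t < f x} \<le> ennreal (exp (- t)) * (\<integral>\<^sup>+x. ennreal (exp (f x)) \<partial>M)"
proof -
  have "emeasure M {x \<in> space M. t < f x} = (\<integral>\<^sup>+x. indicator {x \<in> space M. t < f x} x \<partial>M)"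
    by simp
  also have "\<dots> \<le> (\<integral>\<^sup>+x. ennreal (exp (- t)) * ennreal (exp (f x)) \<partial>M)"
    by (intro nn_integral_mono) (auto simp: indicator_def ennreal_mult[symmetric] exp_add[symmetric])
  also have "\<dots> = ennreal (exp (- t)) * (\<integral>\<^sup>+x. ennreal (exp (f x)) \<partial>M)"
    by (rule nn_integral_cmult) measurable
  finally show ?thesis .
qed

lemma gs_coeff_fun_upd:
  assumes "i < j"
  shows "gs_coeff N (g(j := y)) j i = dot N y (gram_schmidt N g i)"
proof -
  have "gram_schmidt N (g(j := y)) i = gram_schmidt N g i"
    using assms by (intro gram_schmidt_cong) auto
  then show ?thesis by (simp add: gs_coeff_def)
qed

lemma gs_coeff_cong:
  assumes "\<And>i. i \<le> j \<Longrightarrow> g i = g' i" "i \<le> j"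
  shows "gs_coeff N g j i = gs_coeff N g' j i"
proof -
  have "gram_schmidt N g i = gram_schmidt N g' i"
    using assms by (intro gram_schmidt_cong) auto
  then show ?thesis using assms(1)[of j] by (simp add: gs_coeff_def)
qed

text \<open>For fixed rows \<open>0, \<dots>, j - 1\<close> the off-diagonal coefficients of row \<open>j\<close> are the inner products of a
  Gaussian vector with fixed Gram-Schmidt vectors. By Bessel's inequality the composition of these
  inner products with \<open>X\<close> has the same bound \<open>\<tau>\<close> on its squared norm as \<open>X\<close> itself.\<close>

lemma nn_integral_gs_row_le:
  fixes X :: "nat \<Rightarrow> nat \<Rightarrow> real"
  assumes \<tau>: "\<And>z. (\<Sum>i<j. (\<Sum>c<k. z c * X i c)\<^sup>2) \<le> \<tau> * (\<Sum>c<k. (z c)\<^sup>2)"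
    and \<alpha>: "0 \<le> \<alpha>" "\<alpha> * \<tau> \<le> 1/4"
  shows "(\<integral>\<^sup>+y. ennreal (exp (\<alpha> * (\<Sum>c<k. (\<Sum>i<j. gs_coeff N (g(j := y)) j i * X i c)\<^sup>2))) \<partial>gauss N)
    \<le> ennreal (sqrt 2 ^ k)"
proof -
  define u where "u = (\<lambda>c l. \<Sum>i<j. X i c * gram_schmidt N g i l)"
  have eq: "(\<Sum>i<j. gs_coeff N (g(j := y)) j i * X i c) = (\<Sum>l<N. u c l * y l)" for y c
  proof -
    have "(\<Sum>i<j. gs_coeff N (g(j := y)) j i * X i c) = (\<Sum>i<j. X i c * dot N (gram_schmidt N g i) y)"
      by (intro sum.cong) (auto simp: gs_coeff_fun_upd dot_commute)
    also have "\<dots> = dot N (u c) y" unfolding u_def dot_sum_left ..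
    finally show ?thesis by (simp add: dot_def)
  qed
  have "(\<Sum>l<N. (\<Sum>c<k. z c * u c l)\<^sup>2) \<le> \<tau> * (\<Sum>c<k. (z c)\<^sup>2)" for z
  proof -
    have "(\<Sum>c<k. z c * u c l) = (\<Sum>i<j. (\<Sum>c<k. z c * X i c) * gram_schmidt N g i l)" for l
      unfolding u_def sum_distrib_left sum_distrib_right mult.assoc by (rule sum.swap)
    then have "(\<Sum>l<N. (\<Sum>c<k. z c * u c l)\<^sup>2) \<le> (\<Sum>i<j. (\<Sum>c<k. z c * X i c)\<^sup>2)"
      by (simp add: gram_schmidt_bessel)
    also note \<tau>
    finally show ?thesis .
  qed
  from nn_integral_gauss_exp_inner_squares_le[OF this \<alpha>] show ?thesis unfolding eq .
qed

lemma sum_Cauchy_Schwarz_rows: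
  fixes X :: "nat \<Rightarrow> nat \<Rightarrow> real"
  shows "(\<Sum>i<j. (\<Sum>c<k. z c * X i c)\<^sup>2) \<le> (\<Sum>i<j. \<Sum>c<k. (X i c)\<^sup>2) * (\<Sum>c<k. (z c)\<^sup>2)"
proof -
  have "(\<Sum>i<j. (\<Sum>c<k. z c * X i c)\<^sup>2) \<le> (\<Sum>i<j. (\<Sum>c<k. (z c)\<^sup>2) * (\<Sum>c<k. (X i c)\<^sup>2))"
    by (intro sum_mono Cauchy_Schwarz_ineq_sum)
  then show ?thesis by (simp add: sum_distrib_left sum_distrib_right mult.commute)
qed

text \<open>The off-diagonal part of \<open>L X\<close>, estimated row by row: the squared Hilbert-Schmidt norm of \<open>X\<close> bounds
  the squared operator norm, so every row contributes a factor of at most \<open>sqrt 2 ^ k\<close>.\<close>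

lemma nn_integral_gs_off_diagonal_le:
  fixes X :: "nat \<Rightarrow> nat \<Rightarrow> real"
  assumes \<alpha>: "0 \<le> \<alpha>" "\<alpha> * (\<Sum>i<m. \<Sum>c<k. (X i c)\<^sup>2) \<le> 1/4"
  shows "(\<integral>\<^sup>+g. ennreal (exp (\<alpha> * (\<Sum>j<m. \<Sum>c<k. (\<Sum>i<j. gs_coeff N g j i * X i c)\<^sup>2))) \<partial>gauss_rows m N)
    \<le> ennreal (sqrt 2 ^ (m * k))"
proof -
  define \<phi> where "\<phi> = (\<lambda>j g. ennreal (exp (\<alpha> * (\<Sum>c<k. (\<Sum>i<j. gs_coeff N g j i * X i c)\<^sup>2))))"
  have "(\<integral>\<^sup>+g. (\<Prod>j<m. \<phi> j g) \<partial>gauss_rows m N) \<le> ennreal (sqrt 2 ^ k) ^ m"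
  proof (rule nn_integral_gauss_rows_prod_le)
    show "\<phi> j \<in> borel_measurable (gauss_rows n N)" if "j < n" for j n
    proof -
      have [measurable]: "(\<lambda>g. gs_coeff N g j i) \<in> borel_measurable (gauss_rows n N)" if "i \<in> {..<j}" for i
        using that \<open>j < n\<close> by (intro measurable_gs_coeff) auto
      show ?thesis unfolding \<phi>_def by measurable
    qed
    show "\<phi> j g = \<phi> j g'" if "\<And>i. i \<le> j \<Longrightarrow> g i = g' i" for j g g'
      using gs_coeff_cong[of j g g'] that unfolding \<phi>_def by simp
    show "(\<integral>\<^sup>+y. \<phi> j (g(j := y)) \<partial>gauss N) \<le> ennreal (sqrt 2 ^ k)" if "j < m" for j g
      unfolding \<phi>_def
    proof (rule nn_integral_gs_row_le)
      fix z
      have "(\<Sum>i<j. (\<Sum>c<k. z c * X i c)\<^sup>2) \<le> (\<Sum>i<j. \<Sum>c<k. (X i c)\<^sup>2) * (\<Sum>c<k. (z c)\<^sup>2)"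
        by (rule sum_Cauchy_Schwarz_rows)
      also have "\<dots> \<le> (\<Sum>i<m. \<Sum>c<k. (X i c)\<^sup>2) * (\<Sum>c<k. (z c)\<^sup>2)"
        using that by (intro mult_right_mono sum_mono2 sum_nonneg) auto
      finally show "(\<Sum>i<j. (\<Sum>c<k. z c * X i c)\<^sup>2) \<le> (\<Sum>i<m. \<Sum>c<k. (X i c)\<^sup>2) * (\<Sum>c<k. (z c)\<^sup>2)" .
    qed (fact \<alpha>)+
  qed
  then show ?thesis
    by (simp add: \<phi>_def prod_ennreal exp_sum[symmetric] sum_distrib_left ennreal_power power_mult[symmetric] mult.commute)
qed

text \<open>Chernoff's method for the chi-square distribution. The exponent per degree of freedom is
  \<open>- \<theta> * (1 + \<eta>) - ln (1 - 2 * \<theta>) / 2 \<le> - \<theta> * \<eta> + 4 * \<theta>\<^sup>2\<close>, and \<open>\<theta> = \<eta> / 8\<close> minimises this bound.\<close>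

lemma gauss_norm_upper_tail:
  assumes \<eta>: "0 < \<eta>" "\<eta> \<le> 1"
  shows "emeasure (gauss N) {y \<in> space (gauss N). (1 + \<eta>) * N < dot N y y} \<le> ennreal (exp (- \<eta>\<^sup>2 * N / 16))"
proof -
  define \<theta> where "\<theta> = \<eta> / 8"
  have \<theta>: "0 < \<theta>" "\<theta> \<le> 1/8" using \<eta> by (auto simp: \<theta>_def)
  have [measurable]: "(\<lambda>y. dot N y y) \<in> borel_measurable (gauss N)" unfolding dot_def by measurable
  have "- (2 * \<theta>) - 2 * (2 * \<theta>)\<^sup>2 \<le> ln (1 - 2 * \<theta>)"
    using \<theta> by (intro ln_one_minus_pos_lower_bound) auto
  then have ln: "ln (1 / sqrt (1 - 2 * \<theta>)) \<le> \<theta> + 4 * \<theta>\<^sup>2"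
    using \<theta> by (simp add: ln_div ln_sqrt power2_eq_square)
  have "emeasure (gauss N) {y \<in> space (gauss N). (1 + \<eta>) * N < dot N y y}
     = emeasure (gauss N) {y \<in> space (gauss N). \<theta> * ((1 + \<eta>) * N) < \<theta> * dot N y y}"
    using \<theta> by simp
  also have "\<dots> \<le> ennreal (exp (- (\<theta> * ((1 + \<eta>) * N)))) * (\<integral>\<^sup>+y. ennreal (exp (\<theta> * dot N y y)) \<partial>gauss N)"
    by (rule exponential_markov) measurable
  also have "(\<integral>\<^sup>+y. ennreal (exp (\<theta> * dot N y y)) \<partial>gauss N) = ennreal ((1 / sqrt (1 - 2 * \<theta>)) ^ N)"
    using nn_integral_gauss_exp_norm[of \<theta> N] \<theta> by (simp add: dot_def power2_eq_square)
  also have "(1 / sqrt (1 - 2 * \<theta>)) ^ N = exp (N * ln (1 / sqrt (1 - 2 * \<theta>)))"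
    using \<theta> by (subst exp_of_nat_mult) simp
  also have "ennreal (exp (- (\<theta> * ((1 + \<eta>) * N)))) * ennreal (exp (N * ln (1 / sqrt (1 - 2 * \<theta>))))
     = ennreal (exp (- (\<theta> * ((1 + \<eta>) * N)) + N * ln (1 / sqrt (1 - 2 * \<theta>))))"
    by (simp only: exp_add minus_minus) (simp add: ennreal_mult[symmetric])
  also have "\<dots> \<le> ennreal (exp (- \<eta>\<^sup>2 * N / 16))"
  proof (intro ennreal_leI, unfold exp_le_cancel_iff)
    have "- (\<theta> * ((1 + \<eta>) * N)) + N * ln (1 / sqrt (1 - 2 * \<theta>)) \<le> - (\<theta> * ((1 + \<eta>) * N)) + N * (\<theta> + 4 * \<theta>\<^sup>2)"
      by (intro add_left_mono mult_left_mono ln) auto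
    also have "\<dots> = - \<eta>\<^sup>2 * N / 16"
      by (simp add: \<theta>_def power2_eq_square field_simps)
    finally show "- (\<theta> * ((1 + \<eta>) * N)) + N * ln (1 / sqrt (1 - 2 * \<theta>)) \<le> - \<eta>\<^sup>2 * N / 16" .
  qed
  finally show ?thesis .
qed

lemma gauss_norm_lower_tail:
  assumes \<eta>: "0 < \<eta>" "\<eta> \<le> 1"
  shows "emeasure (gauss N) {y \<in> space (gauss N). dot N y y < (1 - \<eta>) * N} \<le> ennreal (exp (- \<eta>\<^sup>2 * N / 16))"
proof -
  define \<theta> where "\<theta> = \<eta> / 8"
  have \<theta>: "0 < \<theta>" "\<theta> \<le> 1/8" using \<eta> by (auto simp: \<theta>_def)
  have [measurable]: "(\<lambda>y. dot N y y) \<in> borel_measurable (gauss N)" unfolding dot_def by measurable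
  have lnp: "2 * \<theta> - (2 * \<theta>)\<^sup>2 \<le> ln (1 + 2 * \<theta>)"
    using \<theta> by (intro ln_one_plus_pos_lower_bound) auto
  have ln: "ln (1 / sqrt (1 + 2 * \<theta>)) \<le> - \<theta> + 4 * \<theta>\<^sup>2"
  proof -
    have "ln (1 / sqrt (1 + 2 * \<theta>)) = - (ln (1 + 2 * \<theta>) / 2)"
      using \<theta> by (simp add: ln_div ln_sqrt)
    moreover have "(2 * \<theta>)\<^sup>2 = 4 * \<theta>\<^sup>2" by (simp add: power2_eq_square)
    ultimately show ?thesis using lnp zero_le_power2[of \<theta>] by linarith
  qed
  have "emeasure (gauss N) {y \<in> space (gauss N). dot N y y < (1 - \<eta>) * N}
     = emeasure (gauss N) {y \<in> space (gauss N). - (\<theta> * ((1 - \<eta>) * N)) < - \<theta> * dot N y y}"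
    using \<theta> by simp
  also have "\<dots> \<le> ennreal (exp (- (- (\<theta> * ((1 - \<eta>) * N))))) * (\<integral>\<^sup>+y. ennreal (exp (- \<theta> * dot N y y)) \<partial>gauss N)"
    by (rule exponential_markov) measurable
  also have "(\<integral>\<^sup>+y. ennreal (exp (- \<theta> * dot N y y)) \<partial>gauss N) = ennreal ((1 / sqrt (1 + 2 * \<theta>)) ^ N)"
    using nn_integral_gauss_exp_norm[of "- \<theta>" N] \<theta> by (simp add: dot_def power2_eq_square)
  also have "(1 / sqrt (1 + 2 * \<theta>)) ^ N = exp (N * ln (1 / sqrt (1 + 2 * \<theta>)))"
    using \<theta> by (subst exp_of_nat_mult) simp
  also have "ennreal (exp (- (- (\<theta> * ((1 - \<eta>) * N))))) * ennreal (exp (N * ln (1 / sqrt (1 + 2 * \<theta>))))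
     = ennreal (exp (\<theta> * ((1 - \<eta>) * N) + N * ln (1 / sqrt (1 + 2 * \<theta>))))"
    by (simp only: exp_add minus_minus) (simp add: ennreal_mult[symmetric])
  also have "\<dots> \<le> ennreal (exp (- \<eta>\<^sup>2 * N / 16))"
  proof (intro ennreal_leI, unfold exp_le_cancel_iff)
    have "\<theta> * ((1 - \<eta>) * N) + N * ln (1 / sqrt (1 + 2 * \<theta>)) \<le> \<theta> * ((1 - \<eta>) * N) + N * (- \<theta> + 4 * \<theta>\<^sup>2)"
      by (intro add_left_mono mult_left_mono ln) auto
    also have "\<dots> = - \<eta>\<^sup>2 * N / 16"
      by (simp add: \<theta>_def power2_eq_square field_simps)
    finally show "\<theta> * ((1 - \<eta>) * N) + N * ln (1 / sqrt (1 + 2 * \<theta>)) \<le> - \<eta>\<^sup>2 * N / 16" .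
  qed
  finally show ?thesis .
qed

lemma emeasure_pred_eq_nn_integral:
  assumes [measurable]: "Measurable.pred M P"
  shows "emeasure M {x \<in> space M. P x} = (\<integral>\<^sup>+x. indicator {x. P x} x \<partial>M)"
proof -
  have "emeasure M {x \<in> space M. P x} = (\<integral>\<^sup>+x. indicator {x \<in> space M. P x} x \<partial>M)"
    by (rule nn_integral_indicator[symmetric]) measurable
  also have "\<dots> = (\<integral>\<^sup>+x. indicator {x. P x} x \<partial>M)"
    by (intro nn_integral_cong) (simp add: indicator_def)
  finally show ?thesis .
qed

lemma emeasure_gauss_rows_fix_row_le:
  assumes j: "j < m" and [measurable]: "Measurable.pred (gauss_rows m N) P"
    and le: "\<And>g. emeasure (gauss N) {y \<in> space (gauss N). P (g(j := y))} \<le> K"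
    and meas: "\<And>g. Measurable.pred (gauss N) (\<lambda>y. P (g(j := y)))"
  shows "emeasure (gauss_rows m N) {g \<in> space (gauss_rows m N). P g} \<le> K"
proof -
  have "emeasure (gauss_rows m N) {g \<in> space (gauss_rows m N). P g} = (\<integral>\<^sup>+g. indicator {g. P g} g \<partial>gauss_rows m N)"
    by (rule emeasure_pred_eq_nn_integral) measurable
  also have "\<dots> \<le> K"
  proof (rule nn_integral_gauss_rows_fix_row_le[OF j])
    fix g
    have [measurable]: "Measurable.pred (gauss N) (\<lambda>y. P (g(j := y)))" by (rule meas)
    have "(\<integral>\<^sup>+y. indicator {g. P g} (g(j := y)) \<partial>gauss N) = emeasure (gauss N) {y \<in> space (gauss N). P (g(j := y))}"
      by (subst emeasure_pred_eq_nn_integral) (auto simp: indicator_def intro!: nn_integral_cong)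
    also have "\<dots> \<le> K" by (rule le)
    finally show "(\<integral>\<^sup>+y. indicator {g. P g} (g(j := y)) \<partial>gauss N) \<le> K" .
  qed simp
  finally show ?thesis .
qed

text \<open>The bound for one row with the identity matrix as \<open>X\<close>, whose operator norm is one.\<close>

lemma emeasure_gs_row_large_le:
  assumes j: "j < m"
  shows "emeasure (gauss_rows m N) {g \<in> space (gauss_rows m N). 4 * t < (\<Sum>i<j. (gs_coeff N g j i)\<^sup>2)}
    \<le> ennreal (exp (- t) * sqrt 2 ^ j)"
proof -
  have [measurable]: "(\<lambda>g. gs_coeff N g j i) \<in> borel_measurable (gauss_rows m N)" if "i \<in> {..<j}" for i
    using that j by (intro measurable_gs_coeff) auto
  have "emeasure (gauss_rows m N) {g \<in> space (gauss_rows m N). 4 * t < (\<Sum>i<j. (gs_coeff N g j i)\<^sup>2)}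
     = emeasure (gauss_rows m N) {g \<in> space (gauss_rows m N). t < 1/4 * (\<Sum>i<j. (gs_coeff N g j i)\<^sup>2)}"
    by (simp add: field_simps)
  also have "\<dots> \<le> ennreal (exp (- t)) * (\<integral>\<^sup>+g. ennreal (exp (1/4 * (\<Sum>i<j. (gs_coeff N g j i)\<^sup>2))) \<partial>gauss_rows m N)"
    by (rule exponential_markov) measurable
  also have "\<dots> \<le> ennreal (exp (- t)) * ennreal (sqrt 2 ^ j)"
  proof (intro mult_left_mono nn_integral_gauss_rows_fix_row_le[OF j])
    fix g
    let ?X = "\<lambda>i c :: nat. if i = c then 1 else (0 :: real)"
    have delta: "(\<Sum>i<j. f i * ?X i c) = (if c < j then f c else 0)" for f c
      by (simp add: if_distrib cong: if_cong)
    have delta': "(\<Sum>c<j. f c * ?X i c) = (if i < j then f i else 0)" for f i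
      using delta[of f i] by (simp add: eq_commute)
    have "(\<integral>\<^sup>+y. ennreal (exp (1/4 * (\<Sum>c<j. (\<Sum>i<j. gs_coeff N (g(j := y)) j i * ?X i c)\<^sup>2))) \<partial>gauss N)
      \<le> ennreal (sqrt 2 ^ j)"
      by (rule nn_integral_gs_row_le[where \<tau> = 1]) (auto simp: delta')
    then show "(\<integral>\<^sup>+y. ennreal (exp (1/4 * (\<Sum>i<j. (gs_coeff N (g(j := y)) j i)\<^sup>2))) \<partial>gauss N) \<le> ennreal (sqrt 2 ^ j)"
      by (simp add: delta)
  qed (auto, measurable)
  finally show ?thesis by (simp add: ennreal_mult)
qed

text \<open>The squared diagonal entry is \<open>|g\<^sub>j|\<^sup>2\<close> minus the squares of the other entries of its row, hence close
  to \<open>N\<close>. The root \<open>L\<close> itself is then close to \<open>sqrt N\<close> since \<open>|L - sqrt N| * sqrt N \<le> |L\<^sup>2 - N|\<close> for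
  \<open>L \<ge> 0\<close>.\<close>

lemma gs_coeff_diag_close:
  assumes \<eta>: "0 < \<eta>" "\<eta> \<le> 1"
    and up: "dot N (g j) (g j) \<le> (1 + \<eta> / 2) * N" and lo: "(1 - \<eta> / 2) * N \<le> dot N (g j) (g j)"
    and off: "(\<Sum>i<j. (gs_coeff N g j i)\<^sup>2) \<le> \<eta> / 2 * N"
  shows "(gs_coeff N g j j - sqrt N)\<^sup>2 \<le> \<eta>\<^sup>2 * N"
proof (cases "N = 0")
  case True
  then show ?thesis by (simp add: gs_coeff_def dot_def)
next
  case False
  let ?L = "gs_coeff N g j j"
  have L0: "0 \<le> ?L" by (simp add: gs_coeff_diag dot_self_nonneg)
  have sq: "?L\<^sup>2 = dot N (g j) (g j) - (\<Sum>i<j. (gs_coeff N g j i)\<^sup>2)" by (rule gs_coeff_diag_square)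
  have "0 \<le> (\<Sum>i<j. (gs_coeff N g j i)\<^sup>2)" by (simp add: sum_nonneg)
  moreover have "0 \<le> \<eta> * real N" using \<eta> by simp
  ultimately have "\<bar>?L\<^sup>2 - N\<bar> \<le> \<eta> * N" using up lo off unfolding sq by (simp add: field_simps abs_le_iff)
  then have "(?L\<^sup>2 - N)\<^sup>2 \<le> (\<eta> * N)\<^sup>2" using \<eta> by (simp add: abs_le_square_iff[symmetric])
  have "(?L - sqrt N)\<^sup>2 * N \<le> (?L - sqrt N)\<^sup>2 * (?L + sqrt N)\<^sup>2"
    using L0 by (intro mult_left_mono) (auto simp: power2_sum)
  also have "\<dots> = (?L\<^sup>2 - N)\<^sup>2"
  proof -
    have "(?L - sqrt N) * (?L + sqrt N) = ?L\<^sup>2 - N" by (simp add: algebra_simps power2_eq_square)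
    then show ?thesis by (simp only: power_mult_distrib[symmetric])
  qed
  also note \<open>\<dots> \<le> (\<eta> * N)\<^sup>2\<close>
  also have "(\<eta> * N)\<^sup>2 = \<eta>\<^sup>2 * N * N" by (simp add: power2_eq_square)
  finally show ?thesis using False by simp
qed

lemma square_sum_le: "(a + b)\<^sup>2 \<le> 2 * a\<^sup>2 + 2 * (b :: real)\<^sup>2"
proof -
  have "0 \<le> (a - b)\<^sup>2" by simp
  then show ?thesis by (simp add: power2_sum power2_diff)
qed

text \<open>The exceptional set is covered by \<open>1 + 3 * m\<close> events: the off-diagonal part of \<open>L X\<close> is large, or
  for some row \<open>j\<close> the vector \<open>g\<^sub>j\<close> is too long, or too short, or its off-diagonal coefficients are
  large. Each of them has an exponential bound, and \<open>sqrt 2 ^ (m * k) * exp (- \<epsilon> * N / 256)\<close> is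
  a common one: the weakest exponent comes from the chi-square tails at relative deviation
  \<open>\<eta> / 2 = sqrt \<epsilon> / 4\<close>.\<close>

lemma gs_close:
  fixes X :: "nat \<Rightarrow> nat \<Rightarrow> real" and m k N :: nat and \<tau> \<epsilon> :: real
  assumes k: "1 \<le> k" and \<epsilon>: "0 < \<epsilon>" "\<epsilon> \<le> 1"
  defines "\<tau> \<equiv> \<Sum>j<m. \<Sum>c<k. (X j c)\<^sup>2"
  shows "emeasure (gauss_rows m N) {g \<in> space (gauss_rows m N).
      \<epsilon> * N * \<tau> < (\<Sum>j<m. \<Sum>c<k. ((\<Sum>i<m. gs_coeff N g j i * X i c) - sqrt N * X j c)\<^sup>2)}
    \<le> ennreal ((1 + 3 * m) * sqrt 2 ^ (m * k) * exp (- \<epsilon> * N / 256))"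
proof (cases "\<tau> = 0")
  case True
  then have "X j c = 0" if "j < m" "c < k" for j c
    using that unfolding \<tau>_def by (auto simp: sum_nonneg_eq_0_iff sum_nonneg)
  then show ?thesis by (simp add: True)
next
  case False
  moreover have "0 \<le> \<tau>" by (simp add: \<tau>_def sum_nonneg)
  ultimately have \<tau>: "0 < \<tau>" by simp
  define \<eta> where "\<eta> = sqrt \<epsilon> / 2"
  have "sqrt \<epsilon> \<le> 1" using \<epsilon> by simp
  then have "\<eta> \<le> 1" unfolding \<eta>_def by linarith
  with \<epsilon> have \<eta>: "0 < \<eta>" "\<eta> \<le> 1" "\<eta>\<^sup>2 = \<epsilon> / 4" by (auto simp: \<eta>_def power_divide)
  have \<epsilon>\<eta>: "\<epsilon> \<le> 2 * \<eta>"
    using \<epsilon> by (simp add: \<eta>_def real_le_rsqrt power2_eq_square mult_left_le)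
  define off where "off = (\<lambda>g. \<Sum>j<m. \<Sum>c<k. (\<Sum>i<j. gs_coeff N g j i * X i c)\<^sup>2)"
  let ?G = "gauss_rows m N" and ?d = "ennreal (sqrt 2 ^ (m * k) * exp (- \<epsilon> * N / 256))"
  have d1: "ennreal (exp (- (\<epsilon> * N / 256))) \<le> ?d"
    by (intro ennreal_leI) (simp add: mult_left_le_one_le)
  define S0 where "S0 = {g \<in> space ?G. \<epsilon> * N / 16 < 1 / (4 * \<tau>) * off g}"
  define S1 where "S1 j = {g \<in> space ?G. (1 + \<eta> / 2) * N < dot N (g j) (g j)}" for j
  define S2 where "S2 j = {g \<in> space ?G. dot N (g j) (g j) < (1 - \<eta> / 2) * N}" for j
  define S3 where "S3 j = {g \<in> space ?G. 4 * (\<eta> * N / 8) < (\<Sum>i<j. (gs_coeff N g j i)\<^sup>2)}" for j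
  have [measurable]: "(\<lambda>g. gs_coeff N g j i) \<in> borel_measurable ?G" if "j \<in> {..<m}" "i \<in> {..<j}" for i j
    using that by (intro measurable_gs_coeff) auto
  have dot_meas [measurable]: "(\<lambda>g. dot N (g j) (g j)) \<in> borel_measurable ?G" if "j < m" for j
    unfolding dot_def using that
    by (intro borel_measurable_sum borel_measurable_times measurable_gauss_rows_entry) auto
  have [measurable]: "(\<lambda>y. dot N y y) \<in> borel_measurable (gauss N)" unfolding dot_def by measurable
  have off_meas [measurable]: "off \<in> borel_measurable ?G" unfolding off_def by measurable
  have meas: "S0 \<in> sets ?G" "j < m \<Longrightarrow> S1 j \<in> sets ?G" "j < m \<Longrightarrow> S2 j \<in> sets ?G" "j < m \<Longrightarrow> S3 j \<in> sets ?G" for j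
    unfolding S0_def S1_def S2_def S3_def by measurable
  have "emeasure ?G S0 \<le> ennreal (exp (- (\<epsilon> * N / 16))) * (\<integral>\<^sup>+g. ennreal (exp (1 / (4 * \<tau>) * off g)) \<partial>?G)"
    unfolding S0_def by (rule exponential_markov) measurable
  also have "\<dots> \<le> ennreal (exp (- (\<epsilon> * N / 16))) * ennreal (sqrt 2 ^ (m * k))"
    unfolding off_def using \<tau>
    by (intro mult_left_mono nn_integral_gs_off_diagonal_le) (auto simp: \<tau>_def)
  also have "\<dots> \<le> ?d"
    using \<epsilon> by (subst ennreal_mult[symmetric]) (auto intro!: ennreal_leI mult_mono)
  finally have e0: "emeasure ?G S0 \<le> ?d" .
  have expd: "exp (- ((\<eta> / 2)\<^sup>2) * N / 16) = exp (- (\<epsilon> * N / 256))" by (simp add: power_divide \<eta>)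
  have e1: "emeasure ?G (S1 j) \<le> ?d" if j: "j < m" for j
    unfolding S1_def
  proof (rule emeasure_gauss_rows_fix_row_le[OF j])
    fix g :: "nat \<Rightarrow> nat \<Rightarrow> real"
    show "emeasure (gauss N) {y \<in> space (gauss N). (1 + \<eta> / 2) * N < dot N ((g(j := y)) j) ((g(j := y)) j)} \<le> ?d"
      using order_trans[OF gauss_norm_upper_tail[of "\<eta> / 2" N, unfolded expd] d1] \<eta> by simp
    show "Measurable.pred (gauss N) (\<lambda>y. (1 + \<eta> / 2) * N < dot N ((g(j := y)) j) ((g(j := y)) j))"
      by simp
  qed (use j in measurable)
  have e2: "emeasure ?G (S2 j) \<le> ?d" if j: "j < m" for j
    unfolding S2_def
  proof (rule emeasure_gauss_rows_fix_row_le[OF j])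
    fix g :: "nat \<Rightarrow> nat \<Rightarrow> real"
    show "emeasure (gauss N) {y \<in> space (gauss N). dot N ((g(j := y)) j) ((g(j := y)) j) < (1 - \<eta> / 2) * N} \<le> ?d"
      using order_trans[OF gauss_norm_lower_tail[of "\<eta> / 2" N, unfolded expd] d1] \<eta> by simp
    show "Measurable.pred (gauss N) (\<lambda>y. dot N ((g(j := y)) j) ((g(j := y)) j) < (1 - \<eta> / 2) * N)"
      by simp
  qed (use j in measurable)
  have e3: "emeasure ?G (S3 j) \<le> ?d" if j: "j < m" for j
  proof -
    have "j \<le> m * k" using j k by (metis less_imp_le_nat mult.right_neutral mult_le_mono2 order.trans)
    moreover have "\<epsilon> * N / 256 \<le> \<eta> * N / 8"
    proof -
      have "\<epsilon> * N \<le> 2 * \<eta> * N" "0 \<le> \<eta> * N" using mult_right_mono[OF \<epsilon>\<eta>, of "real N"] \<eta> by simp_all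
      then show ?thesis by linarith
    qed
    ultimately have "exp (- (\<eta> * N / 8)) * sqrt 2 ^ j \<le> sqrt 2 ^ (m * k) * exp (- \<epsilon> * N / 256)"
      by (subst mult.commute) (intro mult_mono power_increasing, auto)
    with emeasure_gs_row_large_le[OF j, of N "\<eta> * N / 8"] show ?thesis
      unfolding S3_def by (blast intro: order_trans ennreal_leI)
  qed
  have sub: "{g \<in> space ?G. \<epsilon> * N * \<tau> < (\<Sum>j<m. \<Sum>c<k. ((\<Sum>i<m. gs_coeff N g j i * X i c) - sqrt N * X j c)\<^sup>2)}
    \<subseteq> S0 \<union> (\<Union>j<m. S1 j \<union> S2 j \<union> S3 j)"
  proof (rule ccontr)
    assume "\<not> ?thesis"
    then obtain g where g: "g \<in> space ?G" and
      big: "\<epsilon> * N * \<tau> < (\<Sum>j<m. \<Sum>c<k. ((\<Sum>i<m. gs_coeff N g j i * X i c) - sqrt N * X j c)\<^sup>2)"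
      and no: "g \<notin> S0" "\<And>j. j < m \<Longrightarrow> g \<notin> S1 j \<and> g \<notin> S2 j \<and> g \<notin> S3 j" by auto
    have off: "off g \<le> \<epsilon> * N * \<tau> / 4"
      using no(1) g \<tau> by (simp add: S0_def field_simps)
    have diag: "(gs_coeff N g j j - sqrt N)\<^sup>2 \<le> \<eta>\<^sup>2 * N" if "j < m" for j
      using no(2)[OF that] g \<eta> by (intro gs_coeff_diag_close) (auto simp: S1_def S2_def S3_def not_less)
    have "(\<Sum>j<m. \<Sum>c<k. ((\<Sum>i<m. gs_coeff N g j i * X i c) - sqrt N * X j c)\<^sup>2)
      \<le> (\<Sum>j<m. \<Sum>c<k. 2 * (\<Sum>i<j. gs_coeff N g j i * X i c)\<^sup>2 + 2 * (\<eta>\<^sup>2 * N * (X j c)\<^sup>2))"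
    proof (intro sum_mono)
      fix j c assume "j \<in> {..<m}" "c \<in> {..<k}"
      then have j: "j < m" by simp
      have "(\<Sum>i<m. gs_coeff N g j i * X i c) = (\<Sum>i<Suc j. gs_coeff N g j i * X i c)"
        using j by (intro sum.mono_neutral_right) (auto simp: gs_coeff_above_diag)
      then have "((\<Sum>i<m. gs_coeff N g j i * X i c) - sqrt N * X j c)\<^sup>2
        = ((\<Sum>i<j. gs_coeff N g j i * X i c) + (gs_coeff N g j j - sqrt N) * X j c)\<^sup>2"
        by (simp add: algebra_simps)
      also have "\<dots> \<le> 2 * (\<Sum>i<j. gs_coeff N g j i * X i c)\<^sup>2 + 2 * ((gs_coeff N g j j - sqrt N) * X j c)\<^sup>2"
        by (rule square_sum_le)
      also have "((gs_coeff N g j j - sqrt N) * X j c)\<^sup>2 \<le> \<eta>\<^sup>2 * N * (X j c)\<^sup>2"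
        unfolding power_mult_distrib by (intro mult_right_mono diag j) simp
      finally show "((\<Sum>i<m. gs_coeff N g j i * X i c) - sqrt N * X j c)\<^sup>2
        \<le> 2 * (\<Sum>i<j. gs_coeff N g j i * X i c)\<^sup>2 + 2 * (\<eta>\<^sup>2 * N * (X j c)\<^sup>2)" by simp
    qed
    also have "\<dots> = 2 * off g + 2 * (\<eta>\<^sup>2 * N * \<tau>)"
      by (simp add: off_def \<tau>_def sum.distrib sum_distrib_left)
    also have "\<dots> \<le> \<epsilon> * N * \<tau>"
    proof -
      have "\<eta>\<^sup>2 * N * \<tau> = \<epsilon> * N * \<tau> / 4" by (simp add: \<eta>)
      then show ?thesis using off by linarith
    qed
    finally show False using big by simp
  qed
  have "emeasure ?G {g \<in> space ?G. \<epsilon> * N * \<tau> < (\<Sum>j<m. \<Sum>c<k. ((\<Sum>i<m. gs_coeff N g j i * X i c) - sqrt N * X j c)\<^sup>2)}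
    \<le> emeasure ?G (S0 \<union> (\<Union>j<m. S1 j \<union> S2 j \<union> S3 j))"
    using meas by (intro emeasure_mono sub) auto
  also have "\<dots> \<le> emeasure ?G S0 + emeasure ?G (\<Union>j<m. S1 j \<union> S2 j \<union> S3 j)"
    using meas by (intro emeasure_subadditive) auto
  also have "\<dots> \<le> ?d + (\<Sum>j<m. emeasure ?G (S1 j \<union> S2 j \<union> S3 j))"
    using meas by (intro add_mono e0 emeasure_subadditive_finite) auto
  also have "\<dots> \<le> ?d + (\<Sum>j<m. ?d + ?d + ?d)"
  proof (intro add_left_mono sum_mono)
    fix j assume "j \<in> {..<m}"
    then have j: "j < m" by simp
    have "emeasure ?G (S1 j \<union> S2 j \<union> S3 j) \<le> emeasure ?G (S1 j) + emeasure ?G (S2 j) + emeasure ?G (S3 j)"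
      using meas j by (intro order_trans[OF emeasure_subadditive] add_mono emeasure_subadditive) auto
    also have "\<dots> \<le> ?d + ?d + ?d" using j by (intro add_mono e1 e2 e3)
    finally show "emeasure ?G (S1 j \<union> S2 j \<union> S3 j) \<le> ?d + ?d + ?d" .
  qed
  also have "\<dots> = ennreal ((1 + 3 * m) * (sqrt 2 ^ (m * k) * exp (- \<epsilon> * N / 256)))"
  proof -
    have "ennreal D + (\<Sum>j<m. ennreal D + ennreal D + ennreal D) = ennreal ((1 + 3 * m) * D)" if "0 \<le> D" for D :: real
    proof -
      have "ennreal D + ennreal D + ennreal D = ennreal (3 * D)"
        using that by (simp flip: ennreal_plus)
      then have "(\<Sum>j<m. ennreal D + ennreal D + ennreal D) = ennreal (real m * (3 * D))"
        using that by (simp add: ennreal_of_nat_eq_real_of_nat ennreal_mult)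
      then show ?thesis using that by (simp add: distrib_right mult.assoc mult.left_commute flip: ennreal_plus)
    qed
    then show ?thesis by simp
  qed
  finally show ?thesis by (simp only: mult.assoc)
qed

section \<open>Gaussian blocks from blocks of a Haar distributed matrix\<close>

lemma space_orthogonal_borel: "space (orthogonal_borel N) = orthogonal_group N"
  by (simp add: orthogonal_borel_def)

lemma orthogonal_groupD:
  assumes "A \<in> orthogonal_group N"
  shows "dim_row A = N" "dim_col A = N" "A \<in> carrier_mat N N" "A * A\<^sup>T = 1\<^sub>m N" "A\<^sup>T * A = 1\<^sub>m N"
  using assms by (auto simp: orthogonal_group_def)

lemma mult_mat_entry:
  assumes "A \<in> carrier_mat N N" "B \<in> carrier_mat N N" "i < N" "j < N"
  shows "(A * B) $$ (i, j) = (\<Sum>l<N. A $$ (i, l) * B $$ (l, j))"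
  using assms by (auto simp: scalar_prod_def atLeast0LessThan)

lemma orthogonal_array_entries:
  assumes A: "A \<in> orthogonal_group N"
  shows "orthogonal_array N (\<lambda>i j. A $$ (i, j))"
proof -
  note D = orthogonal_groupD[OF A]
  have t: "A\<^sup>T \<in> carrier_mat N N" using D by simp
  have "(\<Sum>l<N. A $$ (i, l) * A $$ (j, l)) = (if i = j then 1 else 0)" if "i < N" "j < N" for i j
  proof -
    have "(A * A\<^sup>T) $$ (i, j) = (\<Sum>l<N. A $$ (i, l) * A $$ (j, l))"
      using mult_mat_entry[OF D(3) t that] that D by simp
    then show ?thesis using that by (simp add: D(4))
  qed
  moreover have "(\<Sum>l<N. A $$ (l, i) * A $$ (l, j)) = (if i = j then 1 else 0)" if "i < N" "j < N" for i j
  proof -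
    have "(A\<^sup>T * A) $$ (i, j) = (\<Sum>l<N. A $$ (l, i) * A $$ (l, j))"
      using mult_mat_entry[OF t D(3) that] that D by simp
    then show ?thesis using that by (simp add: D(5))
  qed
  ultimately show ?thesis by (simp add: orthogonal_array_def)
qed

lemma mat_orthogonal_array:
  assumes "orthogonal_array N q"
  shows "mat N N (\<lambda>(i, j). q i j) \<in> orthogonal_group N"
proof -
  let ?Q = "mat N N (\<lambda>(i, j). q i j)"
  have "?Q * ?Q\<^sup>T = 1\<^sub>m N"
    by (rule eq_matI) (use assms in \<open>auto simp: scalar_prod_def atLeast0LessThan orthogonal_array_def\<close>)
  moreover have "?Q\<^sup>T * ?Q = 1\<^sub>m N"
    by (rule eq_matI) (use assms in \<open>auto simp: scalar_prod_def atLeast0LessThan orthogonal_array_def\<close>)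
  ultimately show ?thesis by (simp add: orthogonal_group_def)
qed

lemma orthogonal_group_mult:
  assumes "Q \<in> orthogonal_group N" "A \<in> orthogonal_group N"
  shows "Q * A \<in> orthogonal_group N"
proof -
  note Q = orthogonal_groupD[OF assms(1)] and A = orthogonal_groupD[OF assms(2)]
  have t: "(Q * A)\<^sup>T = A\<^sup>T * Q\<^sup>T" using Q A by (intro transpose_mult) auto
  have "(Q * A) * (A\<^sup>T * Q\<^sup>T) = Q * (A * A\<^sup>T) * Q\<^sup>T"
    using Q(3) A(3) by (simp add: assoc_mult_mat[of _ N N _ N _ N])
  moreover have "(A\<^sup>T * Q\<^sup>T) * (Q * A) = A\<^sup>T * (Q\<^sup>T * Q) * A"
    using Q(3) A(3) by (simp add: assoc_mult_mat[of _ N N _ N _ N])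
  ultimately show ?thesis
    using Q A by (auto simp: orthogonal_group_def t)
qed

lemma measurable_orthogonal_entry:
  assumes "i < N" "j < N"
  shows "(\<lambda>A. A $$ (i, j)) \<in> borel_measurable (orthogonal_borel N)"
proof -
  have "(\<lambda>A. \<lambda>ij\<in>{..<N} \<times> {..<N}. A $$ ij) \<in> orthogonal_borel N \<rightarrow>\<^sub>M (\<Pi>\<^sub>M ij\<in>{..<N} \<times> {..<N}. borel)"
    unfolding orthogonal_borel_def by (rule measurable_vimage_algebra1) (auto simp: space_PiM)
  from measurable_compose[OF this measurable_component_singleton[of "(i, j)"]] assms
  show ?thesis by simp
qed

lemma measurable_orthogonal_borelI:
  assumes "\<And>x. x \<in> space M \<Longrightarrow> f x \<in> orthogonal_group N"
    and "\<And>i j. i < N \<Longrightarrow> j < N \<Longrightarrow> (\<lambda>x. f x $$ (i, j)) \<in> borel_measurable M"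
  shows "f \<in> M \<rightarrow>\<^sub>M orthogonal_borel N"
  unfolding orthogonal_borel_def
  by (rule measurable_vimage_algebra2) (use assms in \<open>auto intro!: measurable_restrict\<close>)

lemma measurable_orthogonal_mult:
  assumes Q: "Q \<in> orthogonal_group N"
  shows "(\<lambda>A. Q * A) \<in> orthogonal_borel N \<rightarrow>\<^sub>M orthogonal_borel N"
proof (rule measurable_orthogonal_borelI)
  fix i j assume ij: "i < N" "j < N"
  have [measurable]: "(\<lambda>A. A $$ (l, j)) \<in> borel_measurable (orthogonal_borel N)" if "l \<in> {..<N}" for l
    using ij that by (intro measurable_orthogonal_entry) auto
  have "(\<lambda>A. \<Sum>l<N. Q $$ (i, l) * A $$ (l, j)) \<in> borel_measurable (orthogonal_borel N)" by measurable
  then show "(\<lambda>A. (Q * A) $$ (i, j)) \<in> borel_measurable (orthogonal_borel N)"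
    by (rule measurable_cong[THEN iffD1, rotated])
       (use mult_mat_entry[OF orthogonal_groupD(3)[OF Q] orthogonal_groupD(3) ij] in \<open>simp add: space_orthogonal_borel\<close>)
qed (simp add: space_orthogonal_borel orthogonal_group_mult[OF Q])

text \<open>Blocks are extensional functions on the rectangle of their indices, that is, points of the space
  \<open>block_borel m k\<close>.\<close>

definition block_times :: "nat \<Rightarrow> nat \<Rightarrow> nat \<Rightarrow> (nat \<Rightarrow> nat \<Rightarrow> real) \<Rightarrow> (nat \<Rightarrow> nat \<Rightarrow> real) \<Rightarrow> nat \<times> nat \<Rightarrow> real" where
  "block_times N m k H a = (\<lambda>(j, c)\<in>{..<m} \<times> {..<k}. \<Sum>l<N. H j l * a l c)"

abbreviation block_borel :: "nat \<Rightarrow> nat \<Rightarrow> (nat \<times> nat \<Rightarrow> real) measure" where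
  "block_borel m k \<equiv> (\<Pi>\<^sub>M jc\<in>{..<m} \<times> {..<k}. borel)"

lemma measurable_block_times:
  assumes "\<And>j l. j < m \<Longrightarrow> l < n \<Longrightarrow> (\<lambda>x. H x j l) \<in> borel_measurable M"
    and "\<And>l c. l < n \<Longrightarrow> c < k \<Longrightarrow> (\<lambda>x. a x l c) \<in> borel_measurable M"
  shows "(\<lambda>x. block_times n m k (H x) (a x)) \<in> M \<rightarrow>\<^sub>M block_borel m k"
  unfolding block_times_def
proof (rule measurable_restrict)
  fix jc assume "jc \<in> {..<m} \<times> {..<k}"
  then obtain j c where jc: "jc = (j, c)" "j < m" "c < k" by auto
  have [measurable]: "(\<lambda>x. H x j l) \<in> borel_measurable M" "(\<lambda>x. a x l c) \<in> borel_measurable M"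
    if "l \<in> {..<n}" for l using that jc assms by auto
  show "(\<lambda>x. case jc of (j, c) \<Rightarrow> \<Sum>l<n. H x j l * a x l c) \<in> borel_measurable M"
    unfolding jc by simp
qed

text \<open>If \<open>H' = H Q\<close> with \<open>Q\<close> orthogonal, then \<open>H' A = H (Q A)\<close>, and \<open>Q A\<close> has the same law as \<open>A\<close>.\<close>

lemma haar_block_gram:
  assumes haar: "is_haar_orthogonal N P" and k: "k \<le> N"
    and F: "F \<in> borel_measurable (block_borel m k)"
    and gram: "\<And>i j. i < m \<Longrightarrow> j < m \<Longrightarrow> dot N (H i) (H j) = dot N (H' i) (H' j)"
  shows "(\<integral>\<^sup>+A. F (block_times N m k H (\<lambda>i j. A $$ (i, j))) \<partial>P)
    = (\<integral>\<^sup>+A. F (block_times N m k H' (\<lambda>i j. A $$ (i, j))) \<partial>P)"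
proof -
  from haar have sets[measurable_cong]: "sets P = sets (orthogonal_borel N)"
    and inv: "\<And>Q. Q \<in> orthogonal_group N \<Longrightarrow> distr P P (\<lambda>A. Q * A) = P"
    by (auto simp: is_haar_orthogonal_def)
  have space: "space P = orthogonal_group N"
    using sets_eq_imp_space_eq[OF sets] by (simp add: space_orthogonal_borel)
  have "\<exists>q. orthogonal_array N q \<and> (\<forall>i<m. \<forall>c<N. row_times N q (H i) c = H' i c)"
    by (rule equal_gram_imp_orthogonal) (rule gram)
  then obtain q where q: "orthogonal_array N q" and qH: "\<And>i c. i < m \<Longrightarrow> c < N \<Longrightarrow> row_times N q (H i) c = H' i c"
    by auto
  define Q where "Q = mat N N (\<lambda>(i, j). q i j)"
  have Q: "Q \<in> orthogonal_group N" unfolding Q_def by (rule mat_orthogonal_array[OF q])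
  have block: "block_times N m k H' (\<lambda>i j. A $$ (i, j)) = block_times N m k H (\<lambda>i j. (Q * A) $$ (i, j))"
    if A: "A \<in> orthogonal_group N" for A
    unfolding block_times_def
  proof (rule restrict_ext)
    fix jc assume "jc \<in> {..<m} \<times> {..<k}"
    then obtain j c where jc: "jc = (j, c)" "j < m" "c < N" using k by auto
    have "(\<Sum>r<N. H' j r * A $$ (r, c)) = (\<Sum>r<N. (\<Sum>l<N. H j l * q l r) * A $$ (r, c))"
      using qH[OF jc(2)] by (simp add: row_times_def)
    also have "\<dots> = (\<Sum>r<N. \<Sum>l<N. H j l * (q l r * A $$ (r, c)))"
      by (simp add: sum_distrib_right mult.assoc)
    also have "\<dots> = (\<Sum>l<N. \<Sum>r<N. H j l * (q l r * A $$ (r, c)))" by (rule sum.swap)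
    also have "\<dots> = (\<Sum>l<N. H j l * (Q * A) $$ (l, c))"
    proof (rule sum.cong[OF refl])
      fix l assume "l \<in> {..<N}"
      then show "(\<Sum>r<N. H j l * (q l r * A $$ (r, c))) = H j l * (Q * A) $$ (l, c)"
        using mult_mat_entry[OF orthogonal_groupD(3)[OF Q] orthogonal_groupD(3)[OF A], of l c] jc(3)
        by (simp add: Q_def sum_distrib_left)
    qed
    finally show "(case jc of (j, c) \<Rightarrow> \<Sum>l<N. H' j l * A $$ (l, c)) = (case jc of (j, c) \<Rightarrow> \<Sum>l<N. H j l * (Q * A) $$ (l, c))"
      by (simp add: jc)
  qed
  have mB: "(\<lambda>A. block_times N m k H (\<lambda>i j. A $$ (i, j))) \<in> P \<rightarrow>\<^sub>M block_borel m k"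
    unfolding measurable_cong_sets[OF sets refl]
    using k by (intro measurable_block_times measurable_orthogonal_entry) auto
  have "(\<integral>\<^sup>+A. F (block_times N m k H (\<lambda>i j. A $$ (i, j))) \<partial>P)
    = (\<integral>\<^sup>+A. F (block_times N m k H (\<lambda>i j. A $$ (i, j))) \<partial>distr P P (\<lambda>A. Q * A))"
    by (simp add: inv[OF Q])
  also have "\<dots> = (\<integral>\<^sup>+A. F (block_times N m k H (\<lambda>i j. (Q * A) $$ (i, j))) \<partial>P)"
  proof (rule nn_integral_distr)
    show "(\<lambda>A. Q * A) \<in> P \<rightarrow>\<^sub>M P"
      unfolding measurable_cong_sets[OF sets sets] by (rule measurable_orthogonal_mult[OF Q])
  qed (simp add: measurable_compose[OF mB F])
  also have "\<dots> = (\<integral>\<^sup>+A. F (block_times N m k H' (\<lambda>i j. A $$ (i, j))) \<partial>P)"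
    by (intro nn_integral_cong) (simp add: space block)
  finally show ?thesis .
qed

definition block_of :: "nat \<Rightarrow> nat \<Rightarrow> (nat \<Rightarrow> nat \<Rightarrow> real) \<Rightarrow> nat \<times> nat \<Rightarrow> real" where
  "block_of m k Y = (\<lambda>(j, c)\<in>{..<m} \<times> {..<k}. Y j c)"

lemma gauss_rows_block_times:
  assumes a: "orthogonal_array N a" and k: "k \<le> N"
    and F: "F \<in> borel_measurable (block_borel m k)"
  shows "(\<integral>\<^sup>+g. F (block_times N m k g a) \<partial>gauss_rows m N) = (\<integral>\<^sup>+g. F (block_of m k g) \<partial>gauss_rows m N)"
proof -
  let ?G = "gauss_rows m N"
  let ?T = "\<lambda>g. \<lambda>j\<in>{..<m}. row_times N a (g j)"
  have T: "row_times N a \<in> gauss N \<rightarrow>\<^sub>M gauss N" by measurable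
  have "distr ?G ?G (compose {..<m} (row_times N a)) = (\<Pi>\<^sub>M j\<in>{..<m}. distr (gauss N) (gauss N) (row_times N a))"
    unfolding gauss_rows_def
    by (rule distr_PiM_finite_prob_space') (auto simp: prob_space_gauss T)
  also have "\<dots> = ?G" by (simp add: distr_gauss_row_times[OF a] gauss_rows_def)
  finally have inv: "distr ?G ?G (compose {..<m} (row_times N a)) = ?G" .
  have mB: "block_of m k \<in> ?G \<rightarrow>\<^sub>M block_borel m k"
    unfolding block_of_def
    by (rule measurable_restrict) (use k in \<open>auto intro!: measurable_gauss_rows_entry split: prod.split\<close>)
  have mT: "compose {..<m} (row_times N a) \<in> ?G \<rightarrow>\<^sub>M ?G"
    unfolding gauss_rows_def compose_def
    by (intro measurable_restrict measurable_compose[OF _ T] measurable_component_singleton)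
  have "(\<integral>\<^sup>+g. F (block_of m k g) \<partial>?G) = (\<integral>\<^sup>+g. F (block_of m k g) \<partial>distr ?G ?G (compose {..<m} (row_times N a)))"
    by (simp add: inv)
  also have "\<dots> = (\<integral>\<^sup>+g. F (block_of m k (compose {..<m} (row_times N a) g)) \<partial>?G)"
    by (rule nn_integral_distr[OF mT]) (simp add: measurable_compose[OF mB F])
  also have "\<dots> = (\<integral>\<^sup>+g. F (block_times N m k g a) \<partial>?G)"
  proof -
    have "block_of m k (compose {..<m} (row_times N a) g) = block_times N m k g a" for g
      unfolding block_of_def block_times_def
      using k by (intro restrict_ext) (auto simp: compose_def row_times_def)
    then show ?thesis by simp
  qed
  finally show ?thesis ..
qed

text \<open>Both sides are compared with the block of \<open>g A\<close>. For fixed \<open>g\<close>, the matrix \<open>g\<close> may be replaced by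
  its triangular factor, padded with zero columns, since the Gram matrices agree; for fixed \<open>A\<close>, the
  product \<open>g A\<close> is distributed like \<open>g\<close>. Independence allows fixing either of the two first.\<close>

lemma gauss_block_eq_haar_block:
  assumes haar: "is_haar_orthogonal N P" and k: "k \<le> N" and m: "m \<le> N"
    and F: "F \<in> borel_measurable (block_borel m k)"
  shows "(\<integral>\<^sup>+A. \<integral>\<^sup>+g. F (block_times m m k (gs_coeff N g) (\<lambda>i j. A $$ (i, j))) \<partial>gauss_rows m N \<partial>P)
    = (\<integral>\<^sup>+g. F (block_of m k g) \<partial>gauss_rows m N)"
proof -
  let ?G = "gauss_rows m N" and ?e = "\<lambda>A i j. A $$ (i, j)"
  from haar have sets: "sets P = sets (orthogonal_borel N)" and "prob_space P"
    by (auto simp: is_haar_orthogonal_def)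
  interpret P: prob_space P by fact
  interpret G: prob_space ?G by (rule prob_space_gauss_rows)
  interpret GP: pair_sigma_finite ?G P ..
  interpret PG: pair_sigma_finite P ?G ..
  have space: "space P = orthogonal_group N"
    using sets_eq_imp_space_eq[OF sets] by (simp add: space_orthogonal_borel)
  have entry: "(\<lambda>A. A $$ (i, j)) \<in> borel_measurable P" if "i < N" "j < N" for i j
    unfolding measurable_cong_sets[OF sets refl] using that by (rule measurable_orthogonal_entry)
  define L where "L g j l = (if l < m then gs_coeff N g j l else 0)" for g j l
  have blockL: "block_times N m k (L g) a = block_times m m k (gs_coeff N g) a" for g a
    unfolding block_times_def
  proof (rule restrict_ext)
    fix jc assume "jc \<in> {..<m} \<times> {..<k}"
    obtain j c where jc: "jc = (j, c)" by fastforce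
    have "(\<Sum>l<N. L g j l * a l c) = (\<Sum>l<m. L g j l * a l c)"
      using m by (intro sum.mono_neutral_right) (auto simp: L_def)
    then show "(case jc of (j, c) \<Rightarrow> \<Sum>l<N. L g j l * a l c) = (case jc of (j, c) \<Rightarrow> \<Sum>l<m. gs_coeff N g j l * a l c)"
      by (simp add: jc L_def)
  qed
  have gramL: "dot N (g i) (g j) = dot N (L g i) (L g j)" if "j < m" for g i j
  proof -
    have "dot N (L g i) (L g j) = (\<Sum>l<m. L g i l * L g j l)"
      unfolding dot_def using m by (intro sum.mono_neutral_right) (auto simp: L_def)
    then show ?thesis using gs_coeff_gram[OF that, of N g i] by (simp add: L_def)
  qed
  have mg: "(\<lambda>x. F (block_times N m k (fst x) (?e (snd x)))) \<in> borel_measurable (?G \<Otimes>\<^sub>M P)"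
    by (intro measurable_compose[OF _ F] measurable_block_times
          measurable_compose[OF measurable_fst measurable_gauss_rows_entry]
          measurable_compose[OF measurable_snd entry]) (use k in auto)
  have mL: "(\<lambda>x. F (block_times m m k (gs_coeff N (fst x)) (?e (snd x)))) \<in> borel_measurable (?G \<Otimes>\<^sub>M P)"
    by (intro measurable_compose[OF _ F] measurable_block_times
          measurable_compose[OF measurable_fst measurable_gs_coeff]
          measurable_compose[OF measurable_snd entry]) (use k m in auto)
  have "(\<integral>\<^sup>+A. \<integral>\<^sup>+g. F (block_times m m k (gs_coeff N g) (?e A)) \<partial>?G \<partial>P)
      = (\<integral>\<^sup>+g. \<integral>\<^sup>+A. F (block_times m m k (gs_coeff N g) (?e A)) \<partial>P \<partial>?G)"
    using mL by (intro GP.Fubini') (simp add: case_prod_beta')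
  also have "\<dots> = (\<integral>\<^sup>+g. \<integral>\<^sup>+A. F (block_times N m k g (?e A)) \<partial>P \<partial>?G)"
    unfolding blockL[symmetric]
    by (rule nn_integral_cong, rule haar_block_gram[OF haar k F]) (rule gramL[symmetric])
  also have "\<dots> = (\<integral>\<^sup>+A. \<integral>\<^sup>+g. F (block_times N m k g (?e A)) \<partial>?G \<partial>P)"
    using mg by (intro GP.Fubini'[symmetric]) (simp add: case_prod_beta')
  also have "\<dots> = (\<integral>\<^sup>+A. \<integral>\<^sup>+g. F (block_of m k g) \<partial>?G \<partial>P)"
    by (rule nn_integral_cong, rule gauss_rows_block_times[OF _ k F]) (simp add: space orthogonal_array_entries)
  also have "\<dots> = (\<integral>\<^sup>+g. F (block_of m k g) \<partial>?G)" by (simp add: P.emeasure_space_1)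
  finally show ?thesis .
qed

section \<open>Comparison of the two blocks in fixed dimension\<close>

lemma nn_integral_gauss_rows_exp_sum:
  assumes k: "k \<le> N" and [measurable]: "f \<in> borel_measurable borel"
  shows "(\<integral>\<^sup>+g. ennreal (exp (\<Sum>j<m. \<Sum>c<k. f (g j c))) \<partial>gauss_rows m N)
    = (\<integral>\<^sup>+t. ennreal (exp (f t)) \<partial>std_normal_distribution) ^ (m * k)"
proof -
  let ?e = "\<integral>\<^sup>+t. ennreal (exp (f t)) \<partial>std_normal_distribution"
  have split: "(\<Sum>c<k. f (x c)) = (\<Sum>c<N. (if c < k then f else (\<lambda>_. 0)) (x c))" for x :: "nat \<Rightarrow> real"
    using k by (intro sum.mono_neutral_cong_left) auto
  have row: "(\<integral>\<^sup>+x. ennreal (exp (\<Sum>c<k. f (x c))) \<partial>gauss N) = ?e ^ k"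
  proof -
    have "(\<integral>\<^sup>+x. ennreal (exp (\<Sum>c<k. f (x c))) \<partial>gauss N)
      = (\<Prod>c<N. \<integral>\<^sup>+t. ennreal (exp ((if c < k then f else (\<lambda>_. 0)) t)) \<partial>std_normal_distribution)"
      unfolding split by (rule nn_integral_gauss_exp_sum) auto
    also have "\<dots> = (\<Prod>c<N. if c < k then ?e else 1)"
      using std_normal.emeasure_space_1 by (intro prod.cong refl) auto
    also have "\<dots> = (\<Prod>c<k. ?e)"
      using k by (intro prod.mono_neutral_cong_right) auto
    finally show ?thesis by simp
  qed
  have [measurable]: "(\<lambda>x. x c) \<in> borel_measurable (gauss N)" if "c \<in> {..<k}" for c
    using that k by (intro measurable_gauss_entry) auto
  interpret product_sigma_finite "\<lambda>_::nat. gauss N" by (rule product_sigma_finite_gauss)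
  have "(\<integral>\<^sup>+g. ennreal (exp (\<Sum>j<m. \<Sum>c<k. f (g j c))) \<partial>gauss_rows m N)
     = (\<integral>\<^sup>+g. (\<Prod>j<m. ennreal (exp (\<Sum>c<k. f (g j c)))) \<partial>gauss_rows m N)"
    by (subst exp_sum) (simp_all add: prod_ennreal)
  also have "\<dots> = (\<Prod>j<m. \<integral>\<^sup>+x. ennreal (exp (\<Sum>c<k. f (x c))) \<partial>gauss N)"
    unfolding gauss_rows_def by (rule product_nn_integral_prod) auto
  finally show ?thesis by (simp add: row power_mult[symmetric] mult.commute)
qed

definition sq_norm :: "nat \<Rightarrow> nat \<Rightarrow> (nat \<Rightarrow> nat \<Rightarrow> real) \<Rightarrow> real" where
  "sq_norm m k Y = (\<Sum>j<m. \<Sum>c<k. (Y j c)\<^sup>2)"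

definition scaled_entries :: "nat \<Rightarrow> real mat \<Rightarrow> nat \<Rightarrow> nat \<Rightarrow> real" where
  "scaled_entries N A j c = sqrt N * A $$ (j, c)"

definition gs_entries :: "nat \<Rightarrow> nat \<Rightarrow> (nat \<Rightarrow> nat \<Rightarrow> real) \<Rightarrow> real mat \<Rightarrow> nat \<Rightarrow> nat \<Rightarrow> real" where
  "gs_entries N m g A j c = (\<Sum>i<m. gs_coeff N g j i * A $$ (i, c))"

text \<open>The probability bound of \<open>gs_close\<close>.\<close>

definition mismatch_bound :: "nat \<Rightarrow> nat \<Rightarrow> nat \<Rightarrow> real \<Rightarrow> real" where
  "mismatch_bound N m k \<epsilon> = (1 + 3 * m) * sqrt 2 ^ (m * k) * exp (- \<epsilon> * N / 256)"

lemma gs_entries_close: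
  assumes "1 \<le> k" "0 < \<epsilon>" "\<epsilon> \<le> 1"
  shows "emeasure (gauss_rows m N) {g \<in> space (gauss_rows m N).
      \<epsilon> * sq_norm m k (scaled_entries N A) < sq_norm m k (\<lambda>j c. gs_entries N m g A j c - scaled_entries N A j c)}
    \<le> ennreal (mismatch_bound N m k \<epsilon>)"
proof -
  have "\<epsilon> * sq_norm m k (scaled_entries N A) = \<epsilon> * N * (\<Sum>j<m. \<Sum>c<k. (A $$ (j, c))\<^sup>2)"
    by (simp add: sq_norm_def scaled_entries_def power_mult_distrib sum_distrib_left mult.assoc)
  then show ?thesis
    using gs_close[OF assms, of m N "\<lambda>i c. A $$ (i, c)"]
    by (simp only: mismatch_bound_def of_nat_add of_nat_mult of_nat_1 of_nat_numeral) (simp only: sq_norm_def scaled_entries_def gs_entries_def)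
qed

locale haar_block =
  fixes N m k :: nat and P :: "real mat measure"
  assumes haar: "is_haar_orthogonal N P" and k: "1 \<le> k" "k \<le> N" and m: "m \<le> N"
begin

sublocale P: prob_space P using haar by (simp add: is_haar_orthogonal_def)

sublocale G: prob_space "gauss_rows m N" by (rule prob_space_gauss_rows)

lemma sets_P: "sets P = sets (orthogonal_borel N)"
  using haar by (simp add: is_haar_orthogonal_def)

lemma measurable_scaled_entries:
  assumes "j \<in> {..<m}" "c \<in> {..<k}"
  shows "(\<lambda>A. scaled_entries N A j c) \<in> borel_measurable P"
proof -
  have [measurable]: "(\<lambda>A. A $$ (j, c)) \<in> borel_measurable P"
    unfolding measurable_cong_sets[OF sets_P refl] using assms k m by (intro measurable_orthogonal_entry) auto
  show ?thesis unfolding scaled_entries_def by measurable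
qed

lemma measurable_gs_entries:
  assumes "j \<in> {..<m}" "c \<in> {..<k}"
  shows "(\<lambda>x. gs_entries N m (snd x) (fst x) j c) \<in> borel_measurable (P \<Otimes>\<^sub>M gauss_rows m N)"
proof -
  have [measurable]: "(\<lambda>A. A $$ (i, c)) \<in> borel_measurable P" if "i \<in> {..<m}" for i
    unfolding measurable_cong_sets[OF sets_P refl] using that assms k m by (intro measurable_orthogonal_entry) auto
  have [measurable]: "(\<lambda>g. gs_coeff N g j i) \<in> borel_measurable (gauss_rows m N)" if "i \<in> {..<m}" for i
    using that assms by (intro measurable_gs_coeff) auto
  show ?thesis unfolding gs_entries_def by measurable
qed

lemma measurable_gs_entries_g:
  assumes "j \<in> {..<m}" "c \<in> {..<k}"
  shows "(\<lambda>g. gs_entries N m g A j c) \<in> borel_measurable (gauss_rows m N)"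
proof -
  have [measurable]: "(\<lambda>g. gs_coeff N g j i) \<in> borel_measurable (gauss_rows m N)" if "i \<in> {..<m}" for i
    using that assms by (intro measurable_gs_coeff) auto
  show ?thesis unfolding gs_entries_def by measurable
qed

lemmas [measurable] = measurable_scaled_entries measurable_gs_entries measurable_gs_entries_g

lemma measurable_sq_norm [measurable]:
  "(\<lambda>A. sq_norm m k (scaled_entries N A)) \<in> borel_measurable P"
  "(\<lambda>g. sq_norm m k (\<lambda>j c. gs_entries N m g A j c - scaled_entries N A j c)) \<in> borel_measurable (gauss_rows m N)"
  unfolding sq_norm_def by measurable

text \<open>The entries of \<open>L X\<close> are independent standard Gaussian variables.\<close>

lemma nn_integral_gs_entries:
  assumes [measurable]: "f \<in> borel_measurable borel"
  shows "(\<integral>\<^sup>+A. \<integral>\<^sup>+g. ennreal (exp (\<Sum>j<m. \<Sum>c<k. f (gs_entries N m g A j c))) \<partial>gauss_rows m N \<partial>P)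
    = (\<integral>\<^sup>+t. ennreal (exp (f t)) \<partial>std_normal_distribution) ^ (m * k)"
proof -
  define F where "F y = ennreal (exp (\<Sum>j<m. \<Sum>c<k. f (y (j, c))))" for y :: "nat \<times> nat \<Rightarrow> real"
  have F: "F \<in> borel_measurable (block_borel m k)"
  proof -
    have [measurable]: "(\<lambda>y. y (j, c)) \<in> borel_measurable (block_borel m k)" if "j \<in> {..<m}" "c \<in> {..<k}" for j c
      using that by (intro measurable_component_singleton) auto
    show ?thesis unfolding F_def by measurable
  qed
  have 1: "F (block_times m m k (gs_coeff N g) (\<lambda>i j. A $$ (i, j))) = ennreal (exp (\<Sum>j<m. \<Sum>c<k. f (gs_entries N m g A j c)))" for g A
    unfolding F_def block_times_def gs_entries_def by simp
  have 2: "F (block_of m k g) = ennreal (exp (\<Sum>j<m. \<Sum>c<k. f (g j c)))" for g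
    unfolding F_def block_of_def by simp
  show ?thesis
    using gauss_block_eq_haar_block[OF haar k(2) m F] nn_integral_gauss_rows_exp_sum[OF k(2) assms, of m]
    unfolding 1 2 by simp
qed

lemma emeasure_mismatch:
  assumes "0 < \<epsilon>" "\<epsilon> \<le> 1"
  shows "(\<integral>\<^sup>+g. indicator {g. \<epsilon> * sq_norm m k (scaled_entries N A)
        < sq_norm m k (\<lambda>j c. gs_entries N m g A j c - scaled_entries N A j c)} g \<partial>gauss_rows m N)
    \<le> ennreal (mismatch_bound N m k \<epsilon>)"
proof -
  show ?thesis
    using gs_entries_close[OF k(1) assms, of m N A] by (subst emeasure_pred_eq_nn_integral[symmetric]) auto
qed

text \<open>If \<open>|L X - sqrt N X|\<^sup>2 \<le> |sqrt N X|\<^sup>2 / 4\<close>, then \<open>|sqrt N X|\<^sup>2 \<le> 4 * |L X|\<^sup>2\<close>, and the Gaussian matrix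
  \<open>L X\<close> has an explicit exponential moment. The tail of \<open>sqrt N X\<close> follows by exponential Chebyshev.\<close>

lemma scaled_entries_tail:
  fixes C :: real
  shows
  "emeasure P {A \<in> space P. C * (m * k) < sq_norm m k (scaled_entries N A)}
    \<le> ennreal (mismatch_bound N m k (1/4) + exp (- C * (m * k) / 16) * sqrt 2 ^ (m * k))"
proof -
  let ?G = "gauss_rows m N" and ?Y = "scaled_entries N" and ?V = "gs_entries N m"
  let ?D = "\<lambda>A g. sq_norm m k (\<lambda>j c. ?V g A j c - ?Y A j c)"
  have point: "indicator {A. C * (m * k) < sq_norm m k (?Y A)} A
     \<le> indicator {g. 1/4 * sq_norm m k (?Y A) < ?D A g} g
       + ennreal (exp (- C * (m * k) / 16)) * ennreal (exp (\<Sum>j<m. \<Sum>c<k. 1/4 * (?V g A j c)\<^sup>2))" for A g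
  proof (cases "C * (m * k) < sq_norm m k (?Y A) \<and> ?D A g \<le> 1/4 * sq_norm m k (?Y A)")
    case True
    have "sq_norm m k (?Y A) \<le> (\<Sum>j<m. \<Sum>c<k. 2 * (?V g A j c)\<^sup>2 + 2 * (?V g A j c - ?Y A j c)\<^sup>2)"
      unfolding sq_norm_def
    proof (intro sum_mono)
      fix j c
      show "(?Y A j c)\<^sup>2 \<le> 2 * (?V g A j c)\<^sup>2 + 2 * (?V g A j c - ?Y A j c)\<^sup>2"
        using square_sum_le[of "?V g A j c" "- (?V g A j c - ?Y A j c)"] by (simp add: power2_commute)
    qed
    also have "\<dots> = 2 * (\<Sum>j<m. \<Sum>c<k. (?V g A j c)\<^sup>2) + 2 * ?D A g"
      by (simp add: sq_norm_def sum.distrib sum_distrib_left)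
    finally have "C * (m * k) / 16 \<le> 1/4 * (\<Sum>j<m. \<Sum>c<k. (?V g A j c)\<^sup>2)"
      using True by linarith
    then have "1 \<le> exp (- C * (m * k) / 16) * exp (\<Sum>j<m. \<Sum>c<k. 1/4 * (?V g A j c)\<^sup>2)"
      unfolding sum_distrib_left[symmetric] exp_add[symmetric] by simp
    then have "1 \<le> ennreal (exp (- C * (m * k) / 16)) * ennreal (exp (\<Sum>j<m. \<Sum>c<k. 1/4 * (?V g A j c)\<^sup>2))"
      by (simp add: ennreal_mult[symmetric])
    then show ?thesis by (auto simp: indicator_def intro: add_increasing)
  qed (auto simp: indicator_def not_le)
  have "emeasure P {A \<in> space P. C * (m * k) < sq_norm m k (?Y A)}
    = (\<integral>\<^sup>+A. \<integral>\<^sup>+g. indicator {A. C * (m * k) < sq_norm m k (?Y A)} A \<partial>?G \<partial>P)"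
    by (subst emeasure_pred_eq_nn_integral) (simp_all add: G.emeasure_space_1)
  also have "\<dots> \<le> (\<integral>\<^sup>+A. \<integral>\<^sup>+g. indicator {g. 1/4 * sq_norm m k (?Y A) < ?D A g} g
       + ennreal (exp (- C * (m * k) / 16)) * ennreal (exp (\<Sum>j<m. \<Sum>c<k. 1/4 * (?V g A j c)\<^sup>2)) \<partial>?G \<partial>P)"
    by (rule nn_integral_mono, rule nn_integral_mono, rule point)
  also have "\<dots> = (\<integral>\<^sup>+A. (\<integral>\<^sup>+g. indicator {g. 1/4 * sq_norm m k (?Y A) < ?D A g} g \<partial>?G)
       + ennreal (exp (- C * (m * k) / 16)) * (\<integral>\<^sup>+g. ennreal (exp (\<Sum>j<m. \<Sum>c<k. 1/4 * (?V g A j c)\<^sup>2)) \<partial>?G) \<partial>P)"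
    by (rule nn_integral_cong) (simp add: nn_integral_add nn_integral_cmult)
  also have "\<dots> \<le> (\<integral>\<^sup>+A. ennreal (mismatch_bound N m k (1/4))
       + ennreal (exp (- C * (m * k) / 16)) * (\<integral>\<^sup>+g. ennreal (exp (\<Sum>j<m. \<Sum>c<k. 1/4 * (?V g A j c)\<^sup>2)) \<partial>?G) \<partial>P)"
    by (rule nn_integral_mono, rule add_right_mono, rule emeasure_mismatch) auto
  also have "\<dots> = ennreal (mismatch_bound N m k (1/4)) + ennreal (exp (- C * (m * k) / 16)) *
      (\<integral>\<^sup>+A. \<integral>\<^sup>+g. ennreal (exp (\<Sum>j<m. \<Sum>c<k. 1/4 * (?V g A j c)\<^sup>2)) \<partial>?G \<partial>P)"
    by (subst nn_integral_add) (simp_all add: nn_integral_cmult P.emeasure_space_1)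
  also have "(\<integral>\<^sup>+A. \<integral>\<^sup>+g. ennreal (exp (\<Sum>j<m. \<Sum>c<k. 1/4 * (?V g A j c)\<^sup>2)) \<partial>?G \<partial>P) = ennreal (sqrt 2 ^ (m * k))"
    by (subst nn_integral_gs_entries[of "\<lambda>t. 1/4 * t\<^sup>2"])
       (simp_all add: nn_integral_exp_square[of "1/4", simplified] real_sqrt_divide ennreal_power)
  finally show ?thesis
    by (simp add: ennreal_mult[symmetric] mismatch_bound_def flip: ennreal_plus)
qed

text \<open>On the event that \<open>|sqrt N X|\<^sup>2 \<le> C * p\<close> and that \<open>L X\<close> is close to \<open>sqrt N X\<close>, the two sums of values
  of \<open>f\<close> differ by at most \<open>\<kappa>\<close>. On the complement the integrands are at most \<open>exp (K * p)\<close>, which gives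
  the error term \<open>b\<close>. The modulus of continuity is quadratic because closeness is only known in the
  Euclidean norm of the whole block, not for single entries.\<close>

lemma laplace_comparison:
  fixes f :: "real \<Rightarrow> real" and C :: real
  assumes f[measurable]: "f \<in> borel_measurable borel" and K: "\<And>t. \<bar>f t\<bar> \<le> K"
    and cont: "\<And>x y. \<bar>f x - f y\<bar> \<le> \<eta> + a * x\<^sup>2 + B * (x - y)\<^sup>2" "0 \<le> a" "0 \<le> B"
    and \<epsilon>: "0 < \<epsilon>" "\<epsilon> \<le> 1"
  defines "\<kappa> \<equiv> (\<eta> + a * C + B * (\<epsilon> * C)) * (m * k)"
    and "W \<equiv> \<integral>\<^sup>+A. ennreal (exp (\<Sum>j<m. \<Sum>c<k. f (scaled_entries N A j c))) \<partial>P"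
    and "E \<equiv> (\<integral>\<^sup>+t. ennreal (exp (f t)) \<partial>std_normal_distribution) ^ (m * k)"
    and "b \<equiv> ennreal (exp (K * (m * k))) * (emeasure P {A \<in> space P. C * (m * k) < sq_norm m k (scaled_entries N A)}
        + ennreal (mismatch_bound N m k \<epsilon>))"
  shows "W \<le> ennreal (exp \<kappa>) * E + b" "E \<le> ennreal (exp \<kappa>) * W + b"
proof -
  let ?G = "gauss_rows m N" and ?Y = "scaled_entries N" and ?V = "gs_entries N m"
  let ?D = "\<lambda>A g. sq_norm m k (\<lambda>j c. ?V g A j c - ?Y A j c)"
  let ?bad = "\<lambda>A g. indicator {A. C * (m * k) < sq_norm m k (?Y A)} A
     + indicator {g. \<epsilon> * sq_norm m k (?Y A) < ?D A g} g :: ennreal"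
  let ?eY = "\<lambda>A. ennreal (exp (\<Sum>j<m. \<Sum>c<k. f (?Y A j c)))"
  let ?eV = "\<lambda>A g. ennreal (exp (\<Sum>j<m. \<Sum>c<k. f (?V g A j c)))"
  have bound: "(\<Sum>j<m. \<Sum>c<k. f (Z j c)) \<le> K * (m * k)" for Z :: "nat \<Rightarrow> nat \<Rightarrow> real"
  proof -
    have "(\<Sum>j<m. \<Sum>c<k. f (Z j c)) \<le> (\<Sum>j<m. \<Sum>c<k. K)"
      using K by (intro sum_mono) (simp add: abs_le_iff)
    then show ?thesis by (simp add: ac_simps)
  qed
  have good: "\<bar>(\<Sum>j<m. \<Sum>c<k. f (?Y A j c)) - (\<Sum>j<m. \<Sum>c<k. f (?V g A j c))\<bar> \<le> \<kappa>"
    if "sq_norm m k (?Y A) \<le> C * (m * k)" "?D A g \<le> \<epsilon> * sq_norm m k (?Y A)" for A g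
  proof -
    have "\<bar>(\<Sum>j<m. \<Sum>c<k. f (?Y A j c)) - (\<Sum>j<m. \<Sum>c<k. f (?V g A j c))\<bar>
        \<le> (\<Sum>j<m. \<Sum>c<k. \<bar>f (?Y A j c) - f (?V g A j c)\<bar>)"
      unfolding sum_subtractf[symmetric]
      by (intro order_trans[OF sum_abs] sum_mono order_refl)
    also have "\<dots> \<le> (\<Sum>j<m. \<Sum>c<k. \<eta> + a * (?Y A j c)\<^sup>2 + B * (?V g A j c - ?Y A j c)\<^sup>2)"
      by (intro sum_mono order_trans[OF cont(1)]) (simp add: power2_commute)
    also have "\<dots> = \<eta> * (m * k) + a * sq_norm m k (?Y A) + B * ?D A g"
      by (simp add: sq_norm_def sum.distrib sum_distrib_left)
    also have "\<dots> \<le> \<eta> * (m * k) + a * (C * (m * k)) + B * (\<epsilon> * (C * (m * k)))"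
    proof (intro add_mono order_refl mult_left_mono cont that)
      show "?D A g \<le> \<epsilon> * (C * real (m * k))"
        using that \<epsilon> by (meson mult_left_mono order_trans less_imp_le)
    qed
    finally show ?thesis by (simp add: \<kappa>_def algebra_simps)
  qed
  have pointwise: "ennreal (exp s) \<le> ennreal (exp \<kappa>) * ennreal (exp t) + ennreal (exp (K * (m * k))) * ?bad A g"
    if "s \<le> K * (m * k)"
      "sq_norm m k (?Y A) \<le> C * (m * k) \<Longrightarrow> ?D A g \<le> \<epsilon> * sq_norm m k (?Y A) \<Longrightarrow> s \<le> \<kappa> + t" for s t A g
  proof (cases "sq_norm m k (?Y A) \<le> C * (m * k) \<and> ?D A g \<le> \<epsilon> * sq_norm m k (?Y A)")
    case True
    then have "ennreal (exp s) \<le> ennreal (exp \<kappa>) * ennreal (exp t)"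
      using that(2) by (simp add: ennreal_mult[symmetric] exp_add[symmetric])
    then show ?thesis by (rule add_increasing2[rotated]) simp
  next
    case False
    then have "1 \<le> ?bad A g" by (auto simp: indicator_def)
    then have "ennreal (exp (K * (m * k))) * 1 \<le> ennreal (exp (K * (m * k))) * ?bad A g"
      by (rule mult_left_mono) simp
    moreover have "ennreal (exp s) \<le> ennreal (exp (K * (m * k))) * 1" using that(1) by simp
    ultimately have "ennreal (exp s) \<le> ennreal (exp (K * (m * k))) * ?bad A g" by (rule order_trans[rotated])
    then show ?thesis by (rule add_increasing[rotated]) simp
  qed
  define tail where "tail A = ennreal (exp (K * (m * k))) * (indicator {A. C * (m * k) < sq_norm m k (?Y A)} A
        + ennreal (mismatch_bound N m k \<epsilon>))" for A
  have [measurable]: "tail \<in> borel_measurable P" unfolding tail_def by measurable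
  have int_tail: "(\<integral>\<^sup>+A. tail A \<partial>P) = b"
    unfolding tail_def b_def
    by (simp add: nn_integral_cmult nn_integral_add P.emeasure_space_1 emeasure_pred_eq_nn_integral)
  have inner: "(\<integral>\<^sup>+g. h g + ennreal (exp (K * (m * k))) * ?bad A g \<partial>?G) \<le> (\<integral>\<^sup>+g. h g \<partial>?G) + tail A"
    if [measurable]: "h \<in> borel_measurable ?G" for h A
  proof -
    have "(\<integral>\<^sup>+g. h g + ennreal (exp (K * (m * k))) * ?bad A g \<partial>?G)
      = (\<integral>\<^sup>+g. h g \<partial>?G) + ennreal (exp (K * (m * k))) * (indicator {A. C * (m * k) < sq_norm m k (?Y A)} A
        + (\<integral>\<^sup>+g. indicator {g. \<epsilon> * sq_norm m k (?Y A) < ?D A g} g \<partial>?G))"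
      by (simp add: nn_integral_add nn_integral_cmult G.emeasure_space_1)
    also have "\<dots> \<le> (\<integral>\<^sup>+g. h g \<partial>?G) + tail A"
      unfolding tail_def by (intro add_left_mono mult_left_mono emeasure_mismatch \<epsilon>) simp
    finally show ?thesis .
  qed
  have mV[measurable]: "(\<lambda>g. ?eV A g) \<in> borel_measurable ?G" for A by measurable
  have mVI[measurable]: "(\<lambda>A. \<integral>\<^sup>+g. ?eV A g \<partial>?G) \<in> borel_measurable P"
    by measurable
  have E: "E = (\<integral>\<^sup>+A. \<integral>\<^sup>+g. ?eV A g \<partial>?G \<partial>P)"
    unfolding E_def by (rule nn_integral_gs_entries[symmetric]) measurable
  have "W = (\<integral>\<^sup>+A. \<integral>\<^sup>+g. ?eY A \<partial>?G \<partial>P)"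
    by (simp add: W_def G.emeasure_space_1)
  also have "\<dots> \<le> (\<integral>\<^sup>+A. \<integral>\<^sup>+g. ennreal (exp \<kappa>) * ?eV A g + ennreal (exp (K * (m * k))) * ?bad A g \<partial>?G \<partial>P)"
    by (rule nn_integral_mono, rule nn_integral_mono, rule pointwise[OF bound]) (use good in \<open>force simp: abs_le_iff\<close>)
  also have "\<dots> \<le> (\<integral>\<^sup>+A. (\<integral>\<^sup>+g. ennreal (exp \<kappa>) * ?eV A g \<partial>?G) + tail A \<partial>P)"
    by (rule nn_integral_mono, rule inner) measurable
  also have "\<dots> = ennreal (exp \<kappa>) * E + b"
    by (simp add: nn_integral_cmult nn_integral_add E int_tail)
  finally show "W \<le> ennreal (exp \<kappa>) * E + b" .
  have "E \<le> (\<integral>\<^sup>+A. \<integral>\<^sup>+g. ennreal (exp \<kappa>) * ?eY A + ennreal (exp (K * (m * k))) * ?bad A g \<partial>?G \<partial>P)"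
    unfolding E
    by (rule nn_integral_mono, rule nn_integral_mono, rule pointwise[OF bound]) (use good in \<open>force simp: abs_le_iff\<close>)
  also have "\<dots> \<le> (\<integral>\<^sup>+A. (\<integral>\<^sup>+g. ennreal (exp \<kappa>) * ?eY A \<partial>?G) + tail A \<partial>P)"
    by (rule nn_integral_mono, rule inner) measurable
  also have "\<dots> = ennreal (exp \<kappa>) * W + b"
    by (simp add: nn_integral_cmult nn_integral_add W_def int_tail G.emeasure_space_1)
  finally show "E \<le> ennreal (exp \<kappa>) * W + b" .
qed

end

section \<open>The limit of the Laplace functionals\<close>

lemma sqrt_2_power_le_exp: "sqrt 2 ^ n \<le> exp (real n)"
proof -
  have "sqrt 2 \<le> 1 + 1" by (rule real_le_lsqrt) auto
  also have "\<dots> \<le> exp 1" by (rule exp_ge_add_one_self)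
  finally have "sqrt 2 ^ n \<le> exp 1 ^ n" by (intro power_mono) auto
  then show ?thesis by (simp add: exp_of_nat_mult[symmetric])
qed

text \<open>The prefactor is at most exponential in \<open>p = m * k\<close>, so it loses against \<open>exp (- \<epsilon> * N / 256)\<close> as soon
  as \<open>N\<close> is a large multiple of \<open>p\<close>.\<close>

lemma mismatch_bound_le:
  fixes \<Lambda> \<epsilon> :: real
  assumes m: "1 \<le> m" and k: "1 \<le> k" and N: "256 * (\<Lambda> + 10) * real (m * k) \<le> \<epsilon> * N"
  shows "mismatch_bound N m k \<epsilon> \<le> exp (- \<Lambda> * real (m * k)) / 2"
proof -
  define p where "p = real (m * k)"
  have "1 * 1 \<le> m * k" "m * 1 \<le> m * k" using m k by (intro mult_le_mono; simp)+
  then have p: "1 \<le> p" "real m \<le> p"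
    unfolding p_def using of_nat_mono[of 1 "m * k", where ?'a = real] of_nat_mono[of m "m * k", where ?'a = real]
    by (simp_all only: mult_1_right of_nat_1)
  have a: "1 + 3 * real m \<le> 4 * exp p"
    using p exp_ge_add_one_self[of p] by linarith
  have b: "sqrt 2 ^ (m * k) \<le> exp p" unfolding p_def by (rule sqrt_2_power_le_exp)
  have c: "exp (- \<epsilon> * N / 256) \<le> exp (- (\<Lambda> + 10) * p)"
    unfolding exp_le_cancel_iff using N unfolding p_def[symmetric] by (simp add: algebra_simps)
  have "mismatch_bound N m k \<epsilon> \<le> (4 * exp p) * exp p * exp (- (\<Lambda> + 10) * p)"
    unfolding mismatch_bound_def using a b c by (intro mult_mono) auto
  also have "\<dots> = 4 * exp (- 8 * p) * exp (- \<Lambda> * p)"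
    by (simp add: exp_add[symmetric] algebra_simps)
  also have "\<dots> \<le> 1 / 2 * exp (- \<Lambda> * p)"
  proof (rule mult_right_mono)
    have "9 \<le> exp (8 * p)" using p exp_ge_add_one_self[of "8 * p"] by linarith
    then show "4 * exp (- 8 * p) \<le> 1 / 2" by (simp add: exp_minus field_simps)
  qed simp
  finally show ?thesis by (simp add: p_def)
qed

text \<open>The trivial bound \<open>2 * K\<close> is absorbed by the term in \<open>x\<close> if \<open>|x| \<ge> R\<close>, and by the term in \<open>x - y\<close> if
  this difference is not small. In the remaining case \<open>x\<close> and \<open>y\<close> are close in a compact interval, where
  \<open>f\<close> is uniformly continuous.\<close>

lemma bounded_continuous_quadratic_modulus:
  fixes f :: "real \<Rightarrow> real" and K R :: real
  assumes f: "continuous_on UNIV f" and K: "\<And>t. \<bar>f t\<bar> \<le> K" and \<eta>: "0 < \<eta>" and R: "0 < R"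
  shows "\<exists>B\<ge>0. \<forall>x y. \<bar>f x - f y\<bar> \<le> \<eta> + 2 * K / R\<^sup>2 * x\<^sup>2 + B * (x - y)\<^sup>2"
proof -
  have K0: "0 \<le> K" using K[of 0] by simp
  have "uniformly_continuous_on {- R - 1..R + 1} f"
    by (intro compact_uniformly_continuous continuous_on_subset[OF f]) auto
  then obtain d where d: "0 < d" and fd: "\<And>x y. x \<in> {- R - 1..R + 1} \<Longrightarrow> y \<in> {- R - 1..R + 1} \<Longrightarrow> \<bar>y - x\<bar> < d \<Longrightarrow> \<bar>f y - f x\<bar> < \<eta>"
    using \<eta> unfolding uniformly_continuous_on_def dist_real_def by metis
  define e where "e = min d 1"
  have e: "0 < e" "e \<le> d" "e \<le> 1" using d by (auto simp: e_def)
  define B where "B = 2 * K / e\<^sup>2"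
  have B: "0 \<le> B" using K0 by (simp add: B_def)
  have diff: "\<bar>f x - f y\<bar> \<le> 2 * K" for x y using K[of x] K[of y] by linarith
  have "\<bar>f x - f y\<bar> \<le> \<eta> + 2 * K / R\<^sup>2 * x\<^sup>2 + B * (x - y)\<^sup>2" for x y
  proof -
    have nn: "0 \<le> 2 * K / R\<^sup>2 * x\<^sup>2" "0 \<le> B * (x - y)\<^sup>2" using K0 B by simp_all
    consider "R \<le> \<bar>x\<bar>" | "e \<le> \<bar>x - y\<bar>" | "\<bar>x\<bar> < R" "\<bar>x - y\<bar> < e" by linarith
    then show ?thesis
    proof cases
      case 1
      then have "R\<^sup>2 \<le> x\<^sup>2" using R by (metis abs_le_square_iff abs_of_pos)
      then have "2 * K / R\<^sup>2 * R\<^sup>2 \<le> 2 * K / R\<^sup>2 * x\<^sup>2" using K0 by (intro mult_left_mono) auto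
      moreover have "2 * K / R\<^sup>2 * R\<^sup>2 = 2 * K" using R by simp
      ultimately show ?thesis using diff[of x y] nn \<eta> by linarith
    next
      case 2
      then have "e\<^sup>2 \<le> (x - y)\<^sup>2" using e by (metis abs_le_square_iff abs_of_pos)
      then have "B * e\<^sup>2 \<le> B * (x - y)\<^sup>2" using B by (intro mult_left_mono) auto
      moreover have "B * e\<^sup>2 = 2 * K" using e by (simp add: B_def)
      ultimately show ?thesis using diff[of x y] nn \<eta> by linarith
    next
      case 3
      then have "\<bar>f x - f y\<bar> < \<eta>" using e by (intro fd) (auto simp: abs_less_iff)
      then show ?thesis using nn by simp
    qed
  qed
  with B show ?thesis by blast
qed

context
  fixes P :: "nat \<Rightarrow> real mat measure" and m k :: "nat \<Rightarrow> nat"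
  assumes haar: "\<And>N. is_haar_orthogonal N (P N)"
    and p_infinity: "filterlim (\<lambda>N. m N * k N) at_top sequentially"
    and p_small: "(\<lambda>N. real (m N * k N)) \<in> o(\<lambda>N. real N)"
begin

lemma eventually_p_le:
  fixes c :: real
  assumes "0 < c"
  shows "\<forall>\<^sub>F N in sequentially. real (m N * k N) \<le> c * N"
  using landau_o.smallD[OF p_small assms] by simp

lemma eventually_mk_pos: "\<forall>\<^sub>F N in sequentially. 1 \<le> m N \<and> 1 \<le> k N"
proof -
  have "\<forall>\<^sub>F N in sequentially. 1 \<le> m N * k N"
    using p_infinity unfolding filterlim_at_top by blast
  then show ?thesis
  proof eventually_elim
    case (elim N)
    then show ?case by (cases "m N"; cases "k N") auto
  qed
qed

lemma eventually_haar_block: "\<forall>\<^sub>F N in sequentially. haar_block N (m N) (k N) (P N)"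
proof -
  have "\<forall>\<^sub>F N in sequentially. real (m N * k N) \<le> 1 * real N" by (rule eventually_p_le) simp
  with eventually_mk_pos show ?thesis
  proof eventually_elim
    case (elim N)
    then have mkN: "m N * k N \<le> N" by (simp only: mult_1 of_nat_le_iff)
    have "m N * 1 \<le> m N * k N" "1 * k N \<le> m N * k N" using elim by (intro mult_le_mono; simp)+
    then have "m N \<le> N" "k N \<le> N" using mkN by linarith+
    then show ?case using elim by (intro haar_block.intro haar) auto
  qed
qed

lemma eventually_mismatch_bound_le:
  fixes \<epsilon> \<Lambda> :: real
  assumes "0 < \<epsilon>" "0 \<le> \<Lambda>"
  shows "\<forall>\<^sub>F N in sequentially. mismatch_bound N (m N) (k N) \<epsilon> \<le> exp (- \<Lambda> * (m N * k N)) / 2"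
proof -
  have "0 < \<epsilon> / (256 * (\<Lambda> + 10))" using assms by simp
  from eventually_p_le[OF this] eventually_mk_pos show ?thesis
  proof eventually_elim
    case (elim N)
    then show ?case using assms by (intro mismatch_bound_le) (auto simp: field_simps)
  qed
qed

lemma sq_norm_exponentially_tight:
  fixes \<Lambda> :: real
  assumes "0 \<le> \<Lambda>"
  shows "\<exists>C::real. C > 0 \<and> (\<forall>\<^sub>F N in sequentially.
    emeasure (P N) {A \<in> space (P N). C * (m N * k N) < sq_norm (m N) (k N) (scaled_entries N A)}
      \<le> ennreal (exp (- \<Lambda> * (m N * k N))))"
proof (intro exI conjI)
  let ?C = "16 * (\<Lambda> + 2)"
  show "0 < ?C" using assms by simp
  have "\<forall>\<^sub>F N in sequentially. mismatch_bound N (m N) (k N) (1/4) \<le> exp (- \<Lambda> * (m N * k N)) / 2"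
    using assms by (intro eventually_mismatch_bound_le) auto
  with eventually_haar_block eventually_mk_pos
  show "\<forall>\<^sub>F N in sequentially.
    emeasure (P N) {A \<in> space (P N). ?C * (m N * k N) < sq_norm (m N) (k N) (scaled_entries N A)}
      \<le> ennreal (exp (- \<Lambda> * (m N * k N)))"
  proof eventually_elim
    case (elim N)
    interpret haar_block N "m N" "k N" "P N" by fact
    define p where "p = real (m N * k N)"
    have "1 * 1 \<le> m N * k N" using elim by (intro mult_le_mono) auto
    then have p: "1 \<le> p"
      unfolding p_def using of_nat_mono[of 1 "m N * k N", where ?'a = real] by (simp only: mult_1_right of_nat_1)
    have "sqrt 2 ^ (m N * k N) \<le> exp p" unfolding p_def by (rule sqrt_2_power_le_exp)
    then have "exp (- ?C * p / 16) * sqrt 2 ^ (m N * k N) \<le> exp (- ?C * p / 16) * exp p"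
      by (intro mult_left_mono) auto
    also have "\<dots> = exp (- p) * exp (- \<Lambda> * p)" by (simp add: exp_add[symmetric] field_simps)
    also have "\<dots> \<le> 1 / 2 * exp (- \<Lambda> * p)"
    proof (rule mult_right_mono)
      have "2 \<le> exp p" using p exp_ge_add_one_self[of p] by linarith
      then show "exp (- p) \<le> 1 / 2" by (simp add: exp_minus field_simps)
    qed simp
    finally have "mismatch_bound N (m N) (k N) (1/4) + exp (- ?C * p / 16) * sqrt 2 ^ (m N * k N) \<le> exp (- \<Lambda> * p)"
      using elim(3) by (simp add: p_def)
    from order_trans[OF scaled_entries_tail[of ?C] ennreal_leI, of "exp (- \<Lambda> * p)"] this
    show ?case by (simp add: p_def)
  qed
qed

text \<open>The sum of values of \<open>f\<close> is at most \<open>K * p\<close> in absolute value. Exceptional events of probability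
  \<open>exp (- (2 * K + 1) * p)\<close> are therefore negligible in both expectations, and the comparison leaves an
  error of \<open>(\<eta> + a * C + B * \<epsilon> * C) * p\<close> in the exponent.\<close>

lemma laplace_functional_limit:
  fixes f :: "real \<Rightarrow> real"
  assumes f: "continuous_on UNIV f" and K: "\<And>t. \<bar>f t\<bar> \<le> K"
  shows "(\<lambda>N. ln (\<integral>A. exp (\<Sum>j<m N. \<Sum>c<k N. f (scaled_entries N A j c)) \<partial>P N) / (m N * k N))
    \<longlonglongrightarrow> ln (\<integral>t. exp (f t) \<partial>std_normal_distribution)"
proof -
  have K0: "0 \<le> K" using K[of 0] by simp
  have [measurable]: "f \<in> borel_measurable borel" using f by (rule borel_measurable_continuous_onI)
  define r where "r = (\<integral>t. exp (f t) \<partial>std_normal_distribution)"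
  have expf: "- K \<le> f t" "f t \<le> K" for t using K[of t] by (auto simp: abs_le_iff)
  have int: "integrable std_normal_distribution (\<lambda>t. exp (f t))"
    by (rule std_normal.integrable_const_bound[of _ "exp K"]) (auto simp: expf)
  have er: "(\<integral>\<^sup>+t. ennreal (exp (f t)) \<partial>std_normal_distribution) = ennreal r"
    unfolding r_def by (rule nn_integral_eq_integral[OF int]) simp
  have rK: "exp (- K) \<le> r" unfolding r_def by (rule std_normal.integral_ge_const[OF int]) (simp add: expf)
  then have r0: "0 < r" by (rule less_le_trans[rotated]) simp
  define W where "W N = (\<integral>A. exp (\<Sum>j<m N. \<Sum>c<k N. f (scaled_entries N A j c)) \<partial>P N)" for N
  obtain C :: real where C: "0 < C" and tail: "\<forall>\<^sub>F N in sequentially.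
    emeasure (P N) {A \<in> space (P N). C * (m N * k N) < sq_norm (m N) (k N) (scaled_entries N A)}
      \<le> ennreal (exp (- (2 * K + 1) * (m N * k N)))"
    using sq_norm_exponentially_tight[of "2 * K + 1"] K0 by auto
  show ?thesis
    unfolding r_def[symmetric] W_def[symmetric]
  proof (rule tendstoI)
    fix \<eta>\<^sub>0 :: real assume \<eta>0: "0 < \<eta>\<^sub>0"
    define \<eta> where "\<eta> = \<eta>\<^sub>0 / 8"
    have \<eta>: "0 < \<eta>" using \<eta>0 by (simp add: \<eta>_def)
    \<comment> \<open>The parameters are chosen in the order \<open>C\<close>, \<open>R\<close>, \<open>B\<close>, \<open>\<epsilon>\<close>: \<open>R\<close> makes the contribution
      \<open>a * C\<close> of large entries at most \<open>\<eta>\<close>, then \<open>\<epsilon>\<close> does the same for \<open>B * \<epsilon> * C\<close>.\<close>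
    define R where "R = sqrt (2 * K * C / \<eta> + 1)"
    have R: "0 < R" "R\<^sup>2 = 2 * K * C / \<eta> + 1" using K0 C \<eta> by (auto simp: R_def add_nonneg_pos)
    define a where "a = 2 * K / R\<^sup>2"
    have a: "0 \<le> a" "a * C \<le> \<eta>"
    proof -
      show "0 \<le> a" using K0 by (simp add: a_def)
      have "2 * K * C \<le> \<eta> * R\<^sup>2" using \<eta> by (simp add: R field_simps)
      then show "a * C \<le> \<eta>" using R(1) by (simp add: a_def field_simps)
    qed
    obtain B where B: "0 \<le> B" "\<And>x y. \<bar>f x - f y\<bar> \<le> \<eta> + a * x\<^sup>2 + B * (x - y)\<^sup>2"
      using bounded_continuous_quadratic_modulus[OF f K \<eta> R(1)] unfolding a_def by blast
    define \<epsilon> where "\<epsilon> = min 1 (\<eta> / (B * C + 1))"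
    have BC: "0 \<le> B * C" using B C by simp
    have \<epsilon>: "0 < \<epsilon>" "\<epsilon> \<le> 1" "B * (\<epsilon> * C) \<le> \<eta>"
    proof -
      show "0 < \<epsilon>" "\<epsilon> \<le> 1" using \<eta> BC by (auto simp: \<epsilon>_def)
      have "B * (\<epsilon> * C) = \<epsilon> * (B * C)" by simp
      also have "\<dots> \<le> (\<eta> / (B * C + 1)) * (B * C)" using BC by (intro mult_right_mono) (auto simp: \<epsilon>_def)
      also have "\<dots> \<le> \<eta>" using BC \<eta> by (simp add: field_simps)
      finally show "B * (\<epsilon> * C) \<le> \<eta>" .
    qed
    have mis: "\<forall>\<^sub>F N in sequentially. mismatch_bound N (m N) (k N) \<epsilon> \<le> exp (- (2 * K + 1) * (m N * k N)) / 2"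
      using \<epsilon> K0 by (intro eventually_mismatch_bound_le) auto
    have big: "\<forall>\<^sub>F N in sequentially. real (m N * k N) > 1 + ln 2 / \<eta>"
      using p_infinity filterlim_compose[OF filterlim_real_sequentially p_infinity]
      by (simp add: filterlim_at_top_dense)
    from eventually_haar_block eventually_mk_pos tail mis big
    show "\<forall>\<^sub>F N in sequentially. dist (ln (W N) / real (m N * k N)) (ln r) < \<eta>\<^sub>0"
    proof eventually_elim
      case (elim N)
      interpret haar_block N "m N" "k N" "P N" by fact
      define p where "p = real (m N * k N)"
      have p: "1 \<le> p" "ln 2 \<le> \<eta> * p"
      proof -
        have "0 \<le> ln 2 / \<eta>" using \<eta> by simp
        then show "1 \<le> p" using elim(5) unfolding p_def by linarith
        have "ln 2 / \<eta> \<le> p" using elim(5) unfolding p_def by linarith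
        then show "ln 2 \<le> \<eta> * p" using \<eta> by (simp add: field_simps)
      qed
      let ?S = "\<lambda>A. \<Sum>j<m N. \<Sum>c<k N. f (scaled_entries N A j c)"
      have S: "\<bar>?S A\<bar> \<le> K * p" for A
      proof -
        have "\<bar>?S A\<bar> \<le> (\<Sum>j<m N. \<Sum>c<k N. K)"
          by (intro order_trans[OF sum_abs] sum_mono K)
        then show ?thesis by (simp add: p_def ac_simps)
      qed
      have expS: "- (K * p) \<le> ?S A" "?S A \<le> K * p" for A
        using S[of A] by (auto simp: abs_le_iff)
      have intS: "integrable (P N) (\<lambda>A. exp (?S A))"
        by (rule P.integrable_const_bound[of _ "exp (K * p)"]) (auto simp: expS)
      have eW: "(\<integral>\<^sup>+A. ennreal (exp (?S A)) \<partial>P N) = ennreal (W N)"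
        unfolding W_def by (rule nn_integral_eq_integral[OF intS]) simp
      have WK: "exp (- (K * p)) \<le> W N" unfolding W_def by (rule P.integral_ge_const[OF intS]) (simp add: expS)
      then have W0: "0 < W N" by (rule less_le_trans[rotated]) simp
      have rp: "r ^ (m N * k N) = exp (p * ln r)" using r0 by (simp add: p_def exp_of_nat_mult del: of_nat_mult)
      have rK': "exp (- (K * p)) \<le> r ^ (m N * k N)"
      proof -
        have "- K \<le> ln r" using rK r0 by (simp add: ln_ge_iff)
        then have "p * - K \<le> p * ln r" using p by (intro mult_left_mono) auto
        then show ?thesis unfolding rp by (simp add: mult.commute)
      qed
      define \<kappa> where "\<kappa> = (\<eta> + a * C + B * (\<epsilon> * C)) * p"
      have \<kappa>: "0 \<le> \<kappa>" "\<kappa> \<le> 3 * \<eta> * p"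
      proof -
        show "0 \<le> \<kappa>" using \<eta> a B \<epsilon> C p by (simp add: \<kappa>_def)
        show "\<kappa> \<le> 3 * \<eta> * p" unfolding \<kappa>_def using a(2) \<epsilon>(3) p by (intro mult_right_mono) auto
      qed
      define b where "b = ennreal (exp (K * p)) * (emeasure (P N) {A \<in> space (P N). C * p < sq_norm (m N) (k N) (scaled_entries N A)}
          + ennreal (mismatch_bound N (m N) (k N) \<epsilon>))"
      have b: "b \<le> ennreal (exp (- (K * p)))"
      proof -
        have "b \<le> ennreal (exp (K * p)) * (ennreal (exp (- (2 * K + 1) * p)) + ennreal (exp (- (2 * K + 1) * p)))"
          unfolding b_def using elim(3,4) unfolding p_def
          by (intro mult_left_mono add_mono ennreal_leI) (auto intro: order_trans[of _ "exp _ / 2"])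
        also have "\<dots> = ennreal (exp (K * p) * (2 * exp (- (2 * K + 1) * p)))"
          by (simp add: ennreal_mult flip: ennreal_plus)
        also have "exp (K * p) * (2 * exp (- (2 * K + 1) * p)) = (2 * exp (- p)) * exp (- (K * p))"
          by (simp add: exp_add[symmetric] algebra_simps)
        also have "ennreal \<dots> \<le> ennreal (1 * exp (- (K * p)))"
        proof (intro ennreal_leI mult_right_mono)
          have "2 \<le> exp p" using p exp_ge_add_one_self[of p] by linarith
          then show "2 * exp (- p) \<le> 1" by (simp add: exp_minus field_simps)
        qed simp
        finally show ?thesis by simp
      qed
      \<comment> \<open>The error term \<open>b\<close> is at most \<open>exp (- K * p)\<close>, which is a lower bound of both expectations.\<close>
      have step: "ln u \<le> ln v + ln 2 + \<kappa>" if "ennreal u \<le> ennreal (exp \<kappa>) * ennreal v + b" "exp (- (K * p)) \<le> v" "0 < u" for u v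
      proof -
        have v: "0 < v" using that(2) by (rule less_le_trans[rotated]) simp
        have "ennreal u \<le> ennreal (exp \<kappa>) * ennreal v + ennreal v"
          using that(1) b ennreal_leI[OF that(2)] by (meson add_left_mono order_trans)
        then have "ennreal u \<le> ennreal (exp \<kappa> * v + v)" using v by (simp add: ennreal_mult)
        then have "u \<le> exp \<kappa> * v + v" using v by (subst (asm) ennreal_le_iff) auto
        also have "\<dots> \<le> exp \<kappa> * v + exp \<kappa> * v" using \<kappa>(1) v by (intro add_left_mono) simp
        finally have "u \<le> v * 2 * exp \<kappa>" by simp
        then have "ln u \<le> ln (v * 2 * exp \<kappa>)" using that(3) v by (subst ln_le_cancel_iff) auto
        also have "\<dots> = ln v + ln 2 + \<kappa>" using v by (simp add: ln_mult)
        finally show ?thesis .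
      qed
      note comp = laplace_comparison[OF _ K B(2) a(1) B(1) \<epsilon>(1,2), of C, unfolded er eW p_def[symmetric] \<kappa>_def[symmetric] b_def[symmetric]]
      have "ln (W N) \<le> ln (r ^ (m N * k N)) + ln 2 + \<kappa>"
        using comp(1) r0 W0 by (intro step rK') (simp_all add: ennreal_power)
      moreover have "ln (r ^ (m N * k N)) \<le> ln (W N) + ln 2 + \<kappa>"
        using comp(2) r0 W0 by (intro step WK) (simp_all add: ennreal_power)
      ultimately have "\<bar>ln (W N) - p * ln r\<bar> \<le> ln 2 + \<kappa>" unfolding rp by simp
      also have "\<dots> \<le> 4 * \<eta> * p" using p \<kappa> by simp
      finally have "\<bar>ln (W N) - p * ln r\<bar> / p \<le> 4 * \<eta>" using p by (simp add: field_simps)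
      moreover have "\<bar>ln (W N) - p * ln r\<bar> / p = \<bar>ln (W N) / p - ln r\<bar>"
        using p by (simp add: abs_divide[symmetric] diff_divide_distrib[symmetric] field_simps)
      ultimately show "dist (ln (W N) / real (m N * k N)) (ln r) < \<eta>\<^sub>0"
        using \<eta> unfolding dist_real_def p_def[symmetric] \<eta>_def by linarith
    qed
  qed
qed

end

section \<open>Neighbourhoods and compact sets in the weak topology\<close>

definition bcont :: "(real \<Rightarrow> real) set" where
  "bcont = {f. continuous_on UNIV f \<and> bounded (range f)}"

lemma bcontI: "continuous_on UNIV f \<Longrightarrow> (\<And>x. \<bar>f x\<bar> \<le> K) \<Longrightarrow> f \<in> bcont"
  unfolding bcont_def bounded_iff by auto

lemma bcontE:
  assumes "f \<in> bcont"
  obtains K where "0 < K" "\<And>x. \<bar>f x\<bar> \<le> K"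
  using assms unfolding bcont_def bounded_pos by auto

lemma bcont_continuous: "f \<in> bcont \<Longrightarrow> continuous_on UNIV f"
  by (simp add: bcont_def)

lemma bcont_measurable: "f \<in> bcont \<Longrightarrow> f \<in> borel_measurable borel"
  by (rule borel_measurable_continuous_onI[OF bcont_continuous])

lemma bcont_const: "(\<lambda>_. c) \<in> bcont"
  by (rule bcontI[of _ "\<bar>c\<bar>"]) auto

lemma bcont_linear:
  assumes "f \<in> bcont" "g \<in> bcont"
  shows "(\<lambda>x. a * f x + b * g x) \<in> bcont"
proof -
  obtain K L where KL: "\<And>x. \<bar>f x\<bar> \<le> K" "\<And>x. \<bar>g x\<bar> \<le> L" using assms by (metis bcontE)
  show ?thesis
  proof (rule bcontI)
    show "continuous_on UNIV (\<lambda>x. a * f x + b * g x)"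
      using assms by (intro continuous_intros bcont_continuous)
    show "\<bar>a * f x + b * g x\<bar> \<le> \<bar>a\<bar> * K + \<bar>b\<bar> * L" for x
      using KL[of x] by (intro order_trans[OF abs_triangle_ineq] add_mono) (auto simp: abs_mult intro: mult_left_mono)
  qed
qed

lemma prob_measuresD:
  assumes "\<mu> \<in> prob_measures"
  shows "prob_space \<mu>" "sets \<mu> = sets borel" "real_distribution \<mu>" "space \<mu> = UNIV"
  using assms sets_eq_imp_space_eq[of \<mu> borel]
  by (auto simp: prob_measures_def real_distribution_def real_distribution_axioms_def)

lemma prob_measures_real_distribution: "real_distribution \<mu> \<Longrightarrow> \<mu> \<in> prob_measures"
  by (auto simp: prob_measures_def real_distribution_def real_distribution_axioms_def)

lemma integrable_bounded_prob:
  assumes "\<mu> \<in> prob_measures" "f \<in> borel_measurable borel" "\<And>x. \<bar>f x\<bar> \<le> K"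
  shows "integrable \<mu> (f :: real \<Rightarrow> real)"
proof -
  interpret prob_space \<mu> using assms by (simp add: prob_measuresD)
  show ?thesis using assms
    by (intro integrable_const_bound[of _ K]) (auto simp: measurable_cong_sets[OF prob_measuresD(2) refl])
qed

lemma integrable_bcont:
  assumes "\<mu> \<in> prob_measures" "f \<in> bcont"
  shows "integrable \<mu> f"
  using assms by (metis bcontE bcont_measurable integrable_bounded_prob)

lemma openin_weak_integral:
  assumes "f \<in> bcont" "open V"
  shows "openin weak_topology {\<mu> \<in> prob_measures. (\<integral>x. f x \<partial>\<mu>) \<in> V}"
  unfolding weak_topology_def using assms
  by (intro topology_generated_by_Basis) (auto simp: bcont_def)

lemma closedin_weak_integral_le:
  assumes "f \<in> bcont"
  shows "closedin weak_topology {\<mu> \<in> prob_measures. (\<integral>x. f x \<partial>\<mu>) \<le> a}"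
proof -
  have "{\<mu> \<in> prob_measures. (\<integral>x. f x \<partial>\<mu>) \<le> a}
      = topspace weak_topology - {\<mu> \<in> prob_measures. (\<integral>x. f x \<partial>\<mu>) \<in> {a<..}}" by auto
  then show ?thesis
    using closedin_diff[OF closedin_topspace openin_weak_integral[OF assms, of "{a<..}"]] by simp
qed

text \<open>Finite intersections of subbasic sets form a base of the topology.\<close>

lemma weak_neighbourhood:
  assumes "openin weak_topology U" "\<mu> \<in> U"
  shows "\<exists>F \<delta>. finite F \<and> F \<subseteq> bcont \<and> 0 < \<delta> \<and>
    (\<forall>\<nu>\<in>prob_measures. (\<forall>g\<in>F. \<bar>(\<integral>x. g x \<partial>\<nu>) - (\<integral>x. g x \<partial>\<mu>)\<bar> < \<delta>) \<longrightarrow> \<nu> \<in> U)"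
proof -
  let ?S = "{{\<mu> \<in> prob_measures. (\<integral>x. f x \<partial>\<mu>) \<in> U} | (f :: real \<Rightarrow> real) (U :: real set).
        continuous_on UNIV f \<and> bounded (range f) \<and> open U}"
  have "generate_topology_on ?S U"
    using assms(1) unfolding weak_topology_def by (rule openin_topology_generated_by)
  then show ?thesis using assms(2)
  proof (induction rule: generate_topology_on.induct)
    case Empty
    then show ?case by simp
  next
    case (Int a b)
    then obtain F \<delta> G \<epsilon> where *: "finite F" "F \<subseteq> bcont" "0 < \<delta>"
      "\<forall>\<nu>\<in>prob_measures. (\<forall>g\<in>F. \<bar>(\<integral>x. g x \<partial>\<nu>) - (\<integral>x. g x \<partial>\<mu>)\<bar> < \<delta>) \<longrightarrow> \<nu> \<in> a"
      "finite G" "G \<subseteq> bcont" "0 < \<epsilon>"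
      "\<forall>\<nu>\<in>prob_measures. (\<forall>g\<in>G. \<bar>(\<integral>x. g x \<partial>\<nu>) - (\<integral>x. g x \<partial>\<mu>)\<bar> < \<epsilon>) \<longrightarrow> \<nu> \<in> b"
      by auto
    show ?case
      by (rule exI[of _ "F \<union> G"], rule exI[of _ "min \<delta> \<epsilon>"]) (use * in auto)
  next
    case (UN K)
    then obtain a where "a \<in> K" "\<mu> \<in> a" by auto
    with UN.IH[OF this] show ?case by blast
  next
    case (Basis s)
    then obtain f V where s: "s = {\<mu> \<in> prob_measures. (\<integral>x. f x \<partial>\<mu>) \<in> V}"
      and f: "f \<in> bcont" and V: "open V" by (auto simp: bcont_def)
    obtain e where e: "0 < e" "\<And>y. dist y (\<integral>x. f x \<partial>\<mu>) < e \<Longrightarrow> y \<in> V"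
      using V Basis.prems unfolding s open_dist by blast
    show ?case
      by (rule exI[of _ "{f}"], rule exI[of _ e]) (use e f s in \<open>auto simp: dist_real_def\<close>)
  qed
qed

lemma weak_open_sequentially:
  assumes "openin weak_topology U" "\<mu> \<in> U" "\<And>n. \<nu> n \<in> prob_measures"
    and "\<And>g. g \<in> bcont \<Longrightarrow> (\<lambda>n. \<integral>x. g x \<partial>\<nu> n) \<longlonglongrightarrow> (\<integral>x. g x \<partial>\<mu>)"
  shows "\<forall>\<^sub>F n in sequentially. \<nu> n \<in> U"
proof -
  obtain F \<delta> where F: "finite F" "F \<subseteq> bcont" "0 < \<delta>"
    "\<And>\<nu>. \<nu> \<in> prob_measures \<Longrightarrow> (\<forall>g\<in>F. \<bar>(\<integral>x. g x \<partial>\<nu>) - (\<integral>x. g x \<partial>\<mu>)\<bar> < \<delta>) \<Longrightarrow> \<nu> \<in> U"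
    using weak_neighbourhood[OF assms(1,2)] by auto
  have "\<forall>\<^sub>F n in sequentially. \<forall>g\<in>F. \<bar>(\<integral>x. g x \<partial>\<nu> n) - (\<integral>x. g x \<partial>\<mu>)\<bar> < \<delta>"
  proof (rule eventually_ball_finite[OF F(1)], rule ballI)
    fix g assume "g \<in> F"
    then show "\<forall>\<^sub>F n in sequentially. \<bar>(\<integral>x. g x \<partial>\<nu> n) - (\<integral>x. g x \<partial>\<mu>)\<bar> < \<delta>"
      using tendstoD[OF assms(4)[of g] F(3)] F(2) by (auto simp: dist_real_def)
  qed
  then show ?thesis by eventually_elim (rule F(4)[OF assms(3)])
qed

text \<open>The measures with second moment at most \<open>C\<close>. Truncation keeps the integrands bounded and
  continuous, so that the set is visibly closed, and the Bochner integral of a function that is not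
  integrable never enters.\<close>

definition moment_set :: "real \<Rightarrow> real measure set" where
  "moment_set C = {\<mu> \<in> prob_measures. \<forall>n::nat. (\<integral>x. min (x\<^sup>2) (real n) \<partial>\<mu>) \<le> C}"

lemma bcont_truncated_square: "(\<lambda>x. min (x\<^sup>2) (real n)) \<in> bcont"
  by (rule bcontI[of _ "real n"]) (auto intro!: continuous_intros)

lemma moment_set_tail:
  assumes \<mu>: "\<mu> \<in> moment_set C" and R: "0 < R"
  shows "1 - C / R\<^sup>2 \<le> measure \<mu> {- R<..R}"
proof -
  have pm: "\<mu> \<in> prob_measures" using \<mu> by (simp add: moment_set_def)
  interpret real_distribution \<mu> using pm by (rule prob_measuresD)
  obtain n :: nat where n: "R\<^sup>2 \<le> real n" using real_arch_simple by blast
  have "R\<^sup>2 * (1 - measure \<mu> {- R<..R}) = R\<^sup>2 * measure \<mu> (UNIV - {- R<..R})"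
    using prob_compl[of "{- R<..R}"] by (simp add: Compl_eq_Diff_UNIV)
  also have "\<dots> = (\<integral>x. R\<^sup>2 * indicator (UNIV - {- R<..R}) x \<partial>\<mu>)" by simp
  also have "\<dots> \<le> (\<integral>x. min (x\<^sup>2) (real n) \<partial>\<mu>)"
  proof (rule integral_mono)
    show "integrable \<mu> (\<lambda>x. min (x\<^sup>2) (real n))" by (rule integrable_bcont[OF pm bcont_truncated_square])
    show "R\<^sup>2 * indicator (UNIV - {- R<..R}) x \<le> min (x\<^sup>2) (real n)" for x
    proof (cases "x \<in> {- R<..R}")
      case False
      then have "\<bar>R\<bar> \<le> \<bar>x\<bar>" using R by auto
      then show ?thesis using n by (simp add: abs_le_square_iff indicator_def)
    qed simp
  qed (auto intro!: integrable_real_indicator integrable_mult_right simp: emeasure_eq_measure)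
  also have "\<dots> \<le> C" using \<mu> by (simp add: moment_set_def)
  finally show ?thesis using R by (simp add: field_simps)
qed

text \<open>Bounded second moments imply tightness, and the limit has the same bound because every truncated
  square is an admissible test function.\<close>

lemma moment_set_convergent_subsequence:
  fixes \<nu> :: "nat \<Rightarrow> real measure"
  assumes \<nu>: "\<And>n. \<nu> n \<in> moment_set C"
  shows "\<exists>r \<mu>. strict_mono (r :: nat \<Rightarrow> nat) \<and> \<mu> \<in> moment_set C \<and>
    (\<forall>g\<in>bcont. (\<lambda>n. \<integral>x. g x \<partial>\<nu> (r n)) \<longlonglongrightarrow> (\<integral>x. g x \<partial>\<mu>))"
proof -
  have pm: "\<nu> n \<in> prob_measures" for n using \<nu>[of n] by (simp add: moment_set_def)
  have "tight \<nu>"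
    unfolding tight_def
  proof (intro conjI allI impI)
    show "real_distribution (\<nu> n)" for n by (rule prob_measuresD(3)[OF pm])
    fix \<epsilon> :: real assume \<epsilon>: "0 < \<epsilon>"
    define R where "R = sqrt (max C 0 / \<epsilon> + 1)"
    have R: "0 < R" "R\<^sup>2 = max C 0 / \<epsilon> + 1"
      using \<epsilon> by (auto simp: R_def add_nonneg_pos)
    have "C / R\<^sup>2 < \<epsilon>"
    proof -
      have "\<epsilon> * R\<^sup>2 = max C 0 + \<epsilon>" using \<epsilon> by (simp add: R distrib_left)
      then have "C < \<epsilon> * R\<^sup>2" using \<epsilon> by linarith
      then show ?thesis using R(1) by (simp add: field_simps)
    qed
    then have "measure (\<nu> n) {- R<..R} > 1 - \<epsilon>" for n
      using moment_set_tail[OF \<nu> R(1), of n] by linarith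
    then show "\<exists>a b. a < b \<and> (\<forall>n. 1 - \<epsilon> < measure (\<nu> n) {a<..b})"
      using R by (intro exI[of _ "- R"] exI[of _ R]) auto
  qed
  from tight_imp_convergent_subsubsequence[OF this strict_mono_id]
  obtain r \<mu> where r: "strict_mono r" and \<mu>: "real_distribution \<mu>" and conv: "weak_conv_m (\<nu> \<circ> id \<circ> r) \<mu>" by auto
  have lim: "(\<lambda>n. \<integral>x. g x \<partial>\<nu> (r n)) \<longlonglongrightarrow> (\<integral>x. g x \<partial>\<mu>)" if g: "g \<in> bcont" for g
  proof -
    obtain K where K: "\<And>x. \<bar>g x\<bar> \<le> K" using bcontE[OF g] by metis
    show ?thesis
    proof (rule weak_conv_imp_integral_bdd_continuous_conv[where B = K])
      show "weak_conv_m (\<lambda>n. \<nu> (r n)) \<mu>" using conv by (simp add: comp_def)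
      show "isCont g x" for x
        using bcont_continuous[OF g] by (simp add: continuous_on_eq_continuous_at)
    qed (use \<mu> K prob_measuresD(3)[OF pm] in auto)
  qed
  have "\<mu> \<in> moment_set C"
    unfolding moment_set_def
  proof (intro CollectI conjI allI)
    show "\<mu> \<in> prob_measures" by (rule prob_measures_real_distribution[OF \<mu>])
    show "(\<integral>x. min (x\<^sup>2) (real n) \<partial>\<mu>) \<le> C" for n
      by (rule LIMSEQ_le_const2[OF lim[OF bcont_truncated_square]])
         (use \<nu> in \<open>auto simp: moment_set_def\<close>)
  qed
  with r lim show ?thesis by blast
qed

text \<open>Countably many integrals of continuous functions that determine a measure. They map the measures
  into the metrisable space of real functions on a countable set.\<close>

definition step_integrals :: "real measure \<Rightarrow> rat \<times> rat \<Rightarrow> real" where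
  "step_integrals \<mu> ab = (if fst ab < snd ab then \<integral>x. cts_step (of_rat (fst ab)) (of_rat (snd ab)) x \<partial>\<mu> else 0)"

lemma bcont_cts_step: "a < b \<Longrightarrow> cts_step a b \<in> bcont"
  by (rule bcontI[OF uniformly_continuous_imp_continuous[OF cts_step_uniformly_continuous], of _ _ 1])
     (auto simp: cts_step_def)

lemma inj_on_step_integrals: "inj_on step_integrals prob_measures"
proof (rule inj_onI)
  fix \<mu> \<nu> assume \<mu>: "\<mu> \<in> prob_measures" and \<nu>: "\<nu> \<in> prob_measures" and eq: "step_integrals \<mu> = step_integrals \<nu>"
  have le: "cdf \<mu> x \<le> cdf \<nu> x"
    if \<mu>: "real_distribution \<mu>" and \<nu>: "real_distribution \<nu>" and eq: "step_integrals \<mu> = step_integrals \<nu>" for \<mu> \<nu> x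
  proof (rule tendsto_lowerbound)
    interpret \<mu>: real_distribution \<mu> by fact
    interpret \<nu>: real_distribution \<nu> by fact
    show "(cdf \<nu> \<longlongrightarrow> cdf \<nu> x) (at_right x)"
      using \<nu>.cdf_is_right_cont by (simp add: continuous_within)
    have "cdf \<mu> x \<le> cdf \<nu> y" if xy: "x < y" for y
    proof -
      obtain a where a: "x < real_of_rat a" "real_of_rat a < y" using of_rat_dense[OF xy] by blast
      obtain b where b: "real_of_rat a < real_of_rat b" "real_of_rat b < y" using of_rat_dense[OF a(2)] by blast
      have "cdf \<mu> x \<le> cdf \<mu> (of_rat a)" by (rule \<mu>.cdf_nondecreasing) (use a in simp)
      also have "\<dots> \<le> (\<integral>x. cts_step (of_rat a) (of_rat b) x \<partial>\<mu>)" by (rule \<mu>.cdf_cts_step(1)[OF b(1)])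
      also have "\<dots> = (\<integral>x. cts_step (of_rat a) (of_rat b) x \<partial>\<nu>)"
        using fun_cong[OF eq, of "(a, b)"] b(1) by (simp add: step_integrals_def of_rat_less)
      also have "\<dots> \<le> cdf \<nu> (of_rat b)" by (rule \<nu>.cdf_cts_step(2)[OF b(1)])
      also have "\<dots> \<le> cdf \<nu> y" by (rule \<nu>.cdf_nondecreasing) (use b in simp)
      finally show ?thesis .
    qed
    then show "\<forall>\<^sub>F y in at_right x. cdf \<mu> x \<le> cdf \<nu> y"
      by (auto simp: eventually_at_filter)
  qed simp
  have "cdf \<mu> = cdf \<nu>"
    using le[of \<mu> \<nu>] le[of \<nu> \<mu>] eq \<mu> \<nu> by (auto simp: prob_measuresD intro: antisym)
  then show "\<mu> = \<nu>" using \<mu> \<nu> by (intro cdf_unique prob_measuresD)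
qed

lemma tendsto_fun_iff:
  fixes f :: "nat \<Rightarrow> 'i \<Rightarrow> real"
  shows "(f \<longlonglongrightarrow> l) \<longleftrightarrow> (\<forall>i. (\<lambda>n. f n i) \<longlonglongrightarrow> l i)"
proof -
  have "(f \<longlonglongrightarrow> l) \<longleftrightarrow> limitin (product_topology (\<lambda>_. euclidean) UNIV) f l sequentially"
    unfolding euclidean_product_topology by simp
  also have "\<dots> \<longleftrightarrow> (\<forall>i. (\<lambda>n. f n i) \<longlonglongrightarrow> l i)"
    by (simp add: limitin_componentwise limitin_canonical_iff)
  finally show ?thesis .
qed

lemma tendsto_subsequenceI:
  fixes x :: "nat \<Rightarrow> real"
  assumes "\<And>s. strict_mono (s :: nat \<Rightarrow> nat) \<Longrightarrow> \<exists>r. strict_mono (r :: nat \<Rightarrow> nat) \<and> (\<lambda>n. x (s (r n))) \<longlonglongrightarrow> l"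
  shows "x \<longlonglongrightarrow> l"
proof (rule ccontr)
  assume "\<not> x \<longlonglongrightarrow> l"
  then obtain e where e: "0 < e" "\<not> (\<forall>\<^sub>F n in sequentially. dist (x n) l < e)"
    by (auto simp: tendsto_iff)
  then have "\<forall>N. \<exists>n>N. e \<le> dist (x n) l"
    by (auto simp: eventually_at_top_dense not_less)
  then obtain s where s: "strict_mono s" "\<And>n :: nat. e \<le> dist (x (s n)) l"
    using infinite_enumerate[of "{n. e \<le> dist (x n) l}"] by (auto simp: infinite_nat_iff_unbounded)
  obtain r :: "nat \<Rightarrow> nat" where "(\<lambda>n. x (s (r n))) \<longlonglongrightarrow> l" using assms[OF s(1)] by blast
  then have "\<forall>\<^sub>F n in sequentially. dist (x (s (r n))) l < e" using e(1) by (rule tendstoD)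
  then show False using s(2) by (auto simp: eventually_sequentially not_le[symmetric])
qed

text \<open>Convergent subsequences give compactness only together with a link to a metric space. The map \<open>step_integrals\<close> is injective and sequentially continuous, so its image of the moment set is
  a sequentially compact, hence compact, subset of a metric space. The inverse map is continuous on
  this image: it is enough to check sequences, and every subsequence of the preimages has a convergent
  further subsequence, whose limit is determined by injectivity. The moment set is thus a
  continuous image of a compact space.\<close>

lemma compactin_moment_set: "compactin weak_topology (moment_set C)"
proof -
  let ?K = "moment_set C" and ?\<Phi> = step_integrals
  define \<Psi> where "\<Psi> = the_inv_into ?K ?\<Phi>"
  have K: "?K \<subseteq> prob_measures" by (auto simp: moment_set_def)
  have inj: "inj_on ?\<Phi> ?K" using inj_on_step_integrals K by (rule inj_on_subset)
  have \<Psi>: "\<Psi> (?\<Phi> \<mu>) = \<mu>" if "\<mu> \<in> ?K" for \<mu>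
    using that inj by (simp add: \<Psi>_def the_inv_into_f_f)
  have \<Phi>_lim: "(\<lambda>n. ?\<Phi> (\<nu> n)) \<longlonglongrightarrow> ?\<Phi> \<mu>"
    if "\<And>g. g \<in> bcont \<Longrightarrow> (\<lambda>n. \<integral>x. g x \<partial>\<nu> n) \<longlonglongrightarrow> (\<integral>x. g x \<partial>\<mu>)" for \<nu> :: "nat \<Rightarrow> real measure" and \<mu>
    unfolding tendsto_fun_iff
  proof
    fix ab :: "rat \<times> rat"
    show "(\<lambda>n. ?\<Phi> (\<nu> n) ab) \<longlonglongrightarrow> ?\<Phi> \<mu> ab"
      using that[OF bcont_cts_step[of "of_rat (fst ab)" "of_rat (snd ab)"]]
      by (cases "fst ab < snd ab") (auto simp: step_integrals_def of_rat_less)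
  qed
  have compact: "compact (?\<Phi> ` ?K)"
    unfolding compact_eq_seq_compact_metric seq_compact_def
  proof (intro allI impI)
    fix z :: "nat \<Rightarrow> rat \<times> rat \<Rightarrow> real" assume "\<forall>n. z n \<in> ?\<Phi> ` ?K"
    then have "\<forall>n. \<exists>\<nu>. \<nu> \<in> ?K \<and> z n = ?\<Phi> \<nu>" by auto
    then obtain \<nu> :: "nat \<Rightarrow> real measure" where \<nu>: "\<And>n. \<nu> n \<in> ?K" "\<And>n. z n = ?\<Phi> (\<nu> n)" by metis
    from moment_set_convergent_subsequence[of \<nu> C, OF \<nu>(1)]
    obtain r \<mu> where r: "strict_mono (r :: nat \<Rightarrow> nat)" "\<mu> \<in> ?K"
      and lim: "\<And>g. g \<in> bcont \<Longrightarrow> (\<lambda>n. \<integral>x. g x \<partial>\<nu> (r n)) \<longlonglongrightarrow> (\<integral>x. g x \<partial>\<mu>)" by auto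
    have "(z \<circ> r) \<longlonglongrightarrow> ?\<Phi> \<mu>" using \<Phi>_lim[OF lim] by (simp add: \<nu>(2) comp_def)
    with r show "\<exists>l\<in>?\<Phi> ` ?K. \<exists>r. strict_mono r \<and> (z \<circ> r) \<longlonglongrightarrow> l" by blast
  qed
  have cont: "continuous_on (?\<Phi> ` ?K) (\<lambda>z. \<integral>x. g x \<partial>\<Psi> z)" if g: "g \<in> bcont" for g
    unfolding continuous_on_sequentially comp_def
  proof (intro allI ballI impI)
    fix z l assume l: "l \<in> ?\<Phi> ` ?K" and z: "(\<forall>n. z n \<in> ?\<Phi> ` ?K) \<and> z \<longlonglongrightarrow> l"
    show "(\<lambda>n. \<integral>x. g x \<partial>\<Psi> (z n)) \<longlonglongrightarrow> (\<integral>x. g x \<partial>\<Psi> l)"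
    proof (rule tendsto_subsequenceI)
      fix s :: "nat \<Rightarrow> nat" assume s: "strict_mono s"
      have in_K: "\<Psi> (z (s n)) \<in> ?K" "?\<Phi> (\<Psi> (z (s n))) = z (s n)" for n
        using z \<Psi> by (metis imageE)+
      from moment_set_convergent_subsequence[of "\<lambda>n. \<Psi> (z (s n))" C, OF in_K(1)]
      obtain r \<mu> where r: "strict_mono (r :: nat \<Rightarrow> nat)" "\<mu> \<in> ?K"
        and lim: "\<And>g. g \<in> bcont \<Longrightarrow> (\<lambda>n. \<integral>x. g x \<partial>\<Psi> (z (s (r n)))) \<longlonglongrightarrow> (\<integral>x. g x \<partial>\<mu>)" by auto
      have "(\<lambda>n. z (s (r n))) \<longlonglongrightarrow> ?\<Phi> \<mu>"
        using \<Phi>_lim[OF lim] by (simp add: in_K(2))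
      moreover have "(\<lambda>n. z (s (r n))) \<longlonglongrightarrow> l"
        using LIMSEQ_subseq_LIMSEQ[OF LIMSEQ_subseq_LIMSEQ[OF conjunct2[OF z] s] r(1)] by (simp add: comp_def)
      ultimately have "l = ?\<Phi> \<mu>" by (metis LIMSEQ_unique)
      then have "\<Psi> l = \<mu>" using \<Psi> r by simp
      then show "\<exists>r. strict_mono (r :: nat \<Rightarrow> nat) \<and> (\<lambda>n. \<integral>x. g x \<partial>\<Psi> (z (s (r n)))) \<longlonglongrightarrow> (\<integral>x. g x \<partial>\<Psi> l)"
        using r(1) lim[OF g] by auto
    qed
  qed
  have "continuous_map (top_of_set (?\<Phi> ` ?K)) weak_topology \<Psi>"
    unfolding weak_topology_def
  proof (rule continuous_on_generated_topo)
    fix U assume "U \<in> {{\<mu> \<in> prob_measures. (\<integral>x. f x \<partial>\<mu>) \<in> U} | (f :: real \<Rightarrow> real) (U :: real set).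
        continuous_on UNIV f \<and> bounded (range f) \<and> open U}"
    then obtain f V where U: "U = {\<mu> \<in> prob_measures. (\<integral>x. f x \<partial>\<mu>) \<in> V}" and f: "f \<in> bcont" and V: "open V"
      by (auto simp: bcont_def)
    have "\<Psi> -` U \<inter> topspace (top_of_set (?\<Phi> ` ?K)) = ?\<Phi> ` ?K \<inter> (\<lambda>z. \<integral>x. f x \<partial>\<Psi> z) -` V"
      using K \<Psi> by (auto simp: U)
    then show "openin (top_of_set (?\<Phi> ` ?K)) (\<Psi> -` U \<inter> topspace (top_of_set (?\<Phi> ` ?K)))"
      using continuous_openin_preimage_gen[OF cont[OF f] V] by simp
  next
    show "\<Psi> ` topspace (top_of_set (?\<Phi> ` ?K)) \<subseteq> \<Union> {{\<mu> \<in> prob_measures. (\<integral>x. f x \<partial>\<mu>) \<in> U} | (f :: real \<Rightarrow> real) (U :: real set).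
        continuous_on UNIV f \<and> bounded (range f) \<and> open U}"
      using K \<Psi> topspace_weak_topology
      unfolding weak_topology_def topology_generated_by_topspace by auto
  qed
  from image_compactin[OF _ this, of "?\<Phi> ` ?K"] compact
  have "compactin weak_topology (\<Psi> ` ?\<Phi> ` ?K)" by (simp add: compactin_subtopology)
  also have "\<Psi> ` ?\<Phi> ` ?K = ?K" using \<Psi> by (auto simp: image_image)
  finally show ?thesis .
qed

section \<open>Variational formula for the relative entropy\<close>

abbreviation std_gauss :: "real measure" where
  "std_gauss \<equiv> std_normal_distribution"

lemma std_gauss_prob_measures: "std_gauss \<in> prob_measures"
  using prob_space_std_normal by (simp add: prob_measures_def)

definition log_laplace :: "(real \<Rightarrow> real) \<Rightarrow> real" where
  "log_laplace f = ln (\<integral>x. exp (f x) \<partial>std_gauss)"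

lemma integrable_exp_bounded:
  assumes [measurable]: "f \<in> borel_measurable borel" and K: "\<And>x. \<bar>f x\<bar> \<le> (K :: real)"
  shows "integrable std_gauss (\<lambda>x. exp (f x))"
proof (rule integrable_bounded_prob[OF std_gauss_prob_measures])
  show "\<bar>exp (f x)\<bar> \<le> exp K" for x using abs_le_D1[OF K[of x]] by simp
qed measurable

lemma exp_log_laplace:
  assumes [measurable]: "f \<in> borel_measurable borel" and K: "\<And>x. \<bar>f x\<bar> \<le> (K :: real)"
  shows "exp (log_laplace f) = (\<integral>x. exp (f x) \<partial>std_gauss)"
proof -
  have "exp (- K) \<le> (\<integral>x. exp (f x) \<partial>std_gauss)"
    by (rule std_normal.integral_ge_const[OF integrable_exp_bounded[OF assms]])
       (use abs_le_D2[OF K] in \<open>auto simp: minus_le_iff\<close>)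
  then have "0 < (\<integral>x. exp (f x) \<partial>std_gauss)" by (rule less_le_trans[rotated]) simp
  then show ?thesis by (simp add: log_laplace_def)
qed

text \<open>The logarithm of the density is \<open>f\<close> minus a normalising constant, so the relative entropy of this
  measure is \<open>\<integral> f d(tilted f) - log_laplace f\<close>, the value that appears in the lower bounds below.\<close>

definition tilted :: "(real \<Rightarrow> real) \<Rightarrow> real measure" where
  "tilted f = density std_gauss (\<lambda>x. ennreal (exp (f x - log_laplace f)))"

lemma
  assumes [measurable]: "f \<in> borel_measurable borel" and K: "\<And>x. \<bar>f x\<bar> \<le> (K :: real)"
  shows tilted_prob_measures: "tilted f \<in> prob_measures"
    and integral_tilted: "\<phi> \<in> borel_measurable borel \<Longrightarrow>
      (\<integral>x. \<phi> x \<partial>tilted f) = (\<integral>x. \<phi> x * exp (f x) \<partial>std_gauss) / exp (log_laplace f)"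
proof -
  have eq: "exp (f x - log_laplace f) = exp (f x) / exp (log_laplace f)" for x by (simp add: exp_diff)
  have "emeasure (tilted f) UNIV = (\<integral>\<^sup>+x. ennreal (exp (f x - log_laplace f)) \<partial>std_gauss)"
    unfolding tilted_def by (subst emeasure_density) auto
  also have "\<dots> = ennreal (\<integral>x. exp (f x - log_laplace f) \<partial>std_gauss)"
    unfolding eq by (intro nn_integral_eq_integral) (auto intro: integrable_exp_bounded[OF assms])
  also have "(\<integral>x. exp (f x - log_laplace f) \<partial>std_gauss) = 1"
    unfolding eq by (simp add: exp_log_laplace[OF assms, symmetric])
  finally show "tilted f \<in> prob_measures"
    by (auto simp: prob_measures_def tilted_def intro!: prob_spaceI)
  assume [measurable]: "\<phi> \<in> borel_measurable borel"
  have "(\<integral>x. \<phi> x \<partial>tilted f) = (\<integral>x. exp (f x - log_laplace f) * \<phi> x \<partial>std_gauss)"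
    unfolding tilted_def by (subst integral_density) auto
  also have "\<dots> = (\<integral>x. (\<phi> x * exp (f x)) / exp (log_laplace f) \<partial>std_gauss)"
    by (intro Bochner_Integration.integral_cong) (simp_all add: eq)
  finally show "(\<integral>x. \<phi> x \<partial>tilted f) = (\<integral>x. \<phi> x * exp (f x) \<partial>std_gauss) / exp (log_laplace f)"
    by simp
qed

text \<open>The negative part of the integral is harmless: with respect to the Gaussian measure its integrand is
  \<open>- D * ln D \<le> 1 - D \<le> 1\<close> where \<open>D < 1\<close>. Therefore the difference in the definition of the entropy is
  never of the form \<open>\<infinity> - \<infinity>\<close>.\<close>

lemma relative_entropy_ac:
  assumes \<mu>: "\<mu> \<in> prob_measures" and ac: "absolutely_continuous std_gauss \<mu>"
  obtains D :: "real \<Rightarrow> real" where "D \<in> borel_measurable borel" "\<And>x. 0 \<le> D x"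
    "\<mu> = density std_gauss (\<lambda>x. ennreal (D x))" "AE x in \<mu>. 0 < D x"
    "(\<integral>\<^sup>+x. ennreal (- ln (D x)) \<partial>\<mu>) \<le> 1"
    "relative_entropy \<mu> std_gauss
      = enn2ereal (\<integral>\<^sup>+x. ennreal (ln (D x)) \<partial>\<mu>) - enn2ereal (\<integral>\<^sup>+x. ennreal (- ln (D x)) \<partial>\<mu>)"
proof -
  interpret \<mu>: prob_space \<mu> using \<mu> by (rule prob_measuresD)
  note sets = prob_measuresD(2)[OF \<mu>]
  obtain D where D[measurable]: "D \<in> borel_measurable std_gauss" and RN: "AE x in std_gauss. RN_deriv std_gauss \<mu> x = ennreal (D x)"
    and pos: "AE x in \<mu>. 0 < D x" and nn: "\<And>x. 0 \<le> D x"
    using std_normal.real_RN_deriv[OF _ ac, of thesis] sets \<mu>.finite_measure_axioms by auto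
  have "\<mu> = density std_gauss (RN_deriv std_gauss \<mu>)"
    using std_normal.density_RN_deriv[OF ac] sets by simp
  also have "\<dots> = density std_gauss (\<lambda>x. ennreal (D x))"
    by (rule density_cong) (use RN in auto)
  finally have dens: "\<mu> = density std_gauss (\<lambda>x. ennreal (D x))" .
  have RN\<mu>: "AE x in \<mu>. RN_deriv std_gauss \<mu> x = ennreal (D x)"
    using absolutely_continuous_AE[OF _ ac RN] sets by simp
  have neg: "(\<integral>\<^sup>+x. ennreal (- ln (D x)) \<partial>\<mu>) \<le> 1"
  proof -
    have "(\<integral>\<^sup>+x. ennreal (- ln (D x)) \<partial>\<mu>) = (\<integral>\<^sup>+x. ennreal (D x) * ennreal (- ln (D x)) \<partial>std_gauss)"
      by (subst dens) (rule nn_integral_density, auto)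
    also have "\<dots> \<le> (\<integral>\<^sup>+x. 1 \<partial>std_gauss)"
    proof (rule nn_integral_mono)
      fix x
      have "D x * - ln (D x) \<le> 1"
      proof (cases "D x = 0")
        case False
        then have "0 < D x" using nn[of x] by simp
        then have "D x * - ln (D x) = D x * ln (1 / D x)" by (simp add: ln_div)
        also have "\<dots> \<le> D x * (1 / D x - 1)"
          using \<open>0 < D x\<close> by (intro mult_left_mono ln_le_minus_one) auto
        also have "\<dots> \<le> 1" using \<open>0 < D x\<close> by (simp add: right_diff_distrib)
        finally show ?thesis .
      qed simp
      then have "ennreal (D x * - ln (D x)) \<le> 1" by (simp add: ennreal_le_1)
      then show "ennreal (D x) * ennreal (- ln (D x)) \<le> 1"
        by (simp only: ennreal_mult'[OF nn])
    qed
    also have "\<dots> = 1" using std_normal.emeasure_space_1 by simp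
    finally show ?thesis .
  qed
  have "relative_entropy \<mu> std_gauss
      = enn2ereal (\<integral>\<^sup>+x. ennreal (ln (D x)) \<partial>\<mu>) - enn2ereal (\<integral>\<^sup>+x. ennreal (- ln (D x)) \<partial>\<mu>)"
  proof -
    have "(\<integral>\<^sup>+x. ennreal (ln (enn2real (RN_deriv std_gauss \<mu> x))) \<partial>\<mu>) = (\<integral>\<^sup>+x. ennreal (ln (D x)) \<partial>\<mu>)"
      "(\<integral>\<^sup>+x. ennreal (- ln (enn2real (RN_deriv std_gauss \<mu> x))) \<partial>\<mu>) = (\<integral>\<^sup>+x. ennreal (- ln (D x)) \<partial>\<mu>)"
      using RN\<mu> nn by (auto intro!: nn_integral_cong_AE)
    then show ?thesis using ac by (simp add: relative_entropy_def)
  qed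
  with that[of D] D nn dens pos neg show thesis by simp
qed

lemma enn2ereal_eq_ereal: "a \<noteq> \<infinity> \<Longrightarrow> enn2ereal a = ereal (enn2real a)"
  by (cases a) auto

lemma relative_entropy_finite:
  assumes \<mu>: "\<mu> \<in> prob_measures" and fin: "relative_entropy \<mu> std_gauss < \<infinity>"
  obtains D :: "real \<Rightarrow> real" where "D \<in> borel_measurable borel" "\<And>x. 0 \<le> D x"
    "\<mu> = density std_gauss (\<lambda>x. ennreal (D x))" "AE x in \<mu>. 0 < D x"
    "integrable \<mu> (\<lambda>x. ln (D x))" "relative_entropy \<mu> std_gauss = ereal (\<integral>x. ln (D x) \<partial>\<mu>)"
proof -
  have ac: "absolutely_continuous std_gauss \<mu>"
    using fin by (auto simp: relative_entropy_def split: if_splits)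
  obtain D where D: "D \<in> borel_measurable borel" "\<And>x. 0 \<le> D x"
    "\<mu> = density std_gauss (\<lambda>x. ennreal (D x))" "AE x in \<mu>. 0 < D x"
    "(\<integral>\<^sup>+x. ennreal (- ln (D x)) \<partial>\<mu>) \<le> 1"
    "relative_entropy \<mu> std_gauss
      = enn2ereal (\<integral>\<^sup>+x. ennreal (ln (D x)) \<partial>\<mu>) - enn2ereal (\<integral>\<^sup>+x. ennreal (- ln (D x)) \<partial>\<mu>)"
    by (rule relative_entropy_ac[OF \<mu> ac]) (rule that; assumption)
  have neg: "(\<integral>\<^sup>+x. ennreal (- ln (D x)) \<partial>\<mu>) \<noteq> \<infinity>" using D(5) by (auto simp: top_unique)
  have pos: "(\<integral>\<^sup>+x. ennreal (ln (D x)) \<partial>\<mu>) \<noteq> \<infinity>"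
    using fin neg unfolding D(6) by (auto simp: enn2ereal_eq_ereal)
  have int: "integrable \<mu> (\<lambda>x. ln (D x))"
    using D(1) pos neg by (auto simp: real_integrable_def measurable_cong_sets[OF prob_measuresD(2)[OF \<mu>] refl])
  show thesis
    using that[OF D(1-4) int] D(6) real_lebesgue_integral_def[OF int] pos neg
    by (simp add: enn2ereal_eq_ereal)
qed

text \<open>Jensen's inequality for \<open>ln q\<close>, where \<open>q\<close> is the quotient of the density of \<open>tilted f\<close> by that of \<open>\<mu>\<close>,
  in the elementary form \<open>ln q \<le> q - 1\<close>: the integral of \<open>q\<close> with respect to \<open>\<mu>\<close> is at most one.\<close>

lemma donsker_varadhan_le:
  assumes \<mu>: "\<mu> \<in> prob_measures" and f: "f \<in> bcont"
  shows "ereal ((\<integral>x. f x \<partial>\<mu>) - log_laplace f) \<le> relative_entropy \<mu> std_gauss"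
proof (cases "relative_entropy \<mu> std_gauss < \<infinity>")
  case True
  interpret \<mu>: prob_space \<mu> using \<mu> by (rule prob_measuresD)
  note sets[measurable_cong] = prob_measuresD(2)[OF \<mu>]
  have f_meas[measurable]: "f \<in> borel_measurable borel" using f by (rule bcont_measurable)
  obtain K where K: "\<And>x. \<bar>f x\<bar> \<le> K" using bcontE[OF f] by metis
  obtain D where D[measurable]: "D \<in> borel_measurable borel" and nn: "\<And>x. 0 \<le> D x"
    and dens: "\<mu> = density std_gauss (\<lambda>x. ennreal (D x))" and pos: "AE x in \<mu>. 0 < D x"
    and int: "integrable \<mu> (\<lambda>x. ln (D x))" and ent: "relative_entropy \<mu> std_gauss = ereal (\<integral>x. ln (D x) \<partial>\<mu>)"
    by (rule relative_entropy_finite[OF \<mu> True]) (rule that; assumption)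
  let ?q = "\<lambda>x. exp (f x - log_laplace f) / D x"
  have q_le: "(\<integral>\<^sup>+x. ennreal (?q x) \<partial>\<mu>) \<le> 1"
  proof -
    have "(\<integral>\<^sup>+x. ennreal (?q x) \<partial>\<mu>) = (\<integral>\<^sup>+x. ennreal (D x) * ennreal (?q x) \<partial>std_gauss)"
      by (subst dens) (rule nn_integral_density, auto)
    also have "\<dots> \<le> (\<integral>\<^sup>+x. ennreal (exp (f x - log_laplace f)) \<partial>std_gauss)"
      by (intro nn_integral_mono) (auto simp: ennreal_mult[symmetric] nn intro!: ennreal_leI)
    also have "\<dots> = emeasure (tilted f) UNIV"
      unfolding tilted_def by (subst emeasure_density) auto
    also have "\<dots> = 1"
      using prob_space.emeasure_space_1[OF prob_measuresD(1)[OF tilted_prob_measures[OF f_meas K]]]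
        prob_measuresD(4)[OF tilted_prob_measures[OF f_meas K]] by simp
    finally show ?thesis .
  qed
  have q_int: "integrable \<mu> ?q"
    using q_le nn by (intro integrableI_bounded) (auto simp: less_top[symmetric] top_unique)
  have "(\<integral>x. ?q x \<partial>\<mu>) \<le> 1"
    using q_le nn by (subst (asm) nn_integral_eq_integral[OF q_int]) (auto simp: ennreal_le_1)
  have "(\<integral>x. f x \<partial>\<mu>) - log_laplace f - (\<integral>x. ln (D x) \<partial>\<mu>) = (\<integral>x. f x - log_laplace f - ln (D x) \<partial>\<mu>)"
    using int integrable_bcont[OF \<mu> f] by (simp add: \<mu>.prob_space)
  also have "\<dots> \<le> (\<integral>x. ?q x - 1 \<partial>\<mu>)"
  proof (rule integral_mono_AE)
    show "AE x in \<mu>. f x - log_laplace f - ln (D x) \<le> ?q x - 1"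
      using pos
    proof eventually_elim
      case (elim x)
      then have "f x - log_laplace f - ln (D x) = ln (?q x)" by (simp add: ln_div)
      also have "\<dots> \<le> ?q x - 1" using elim by (intro ln_le_minus_one) auto
      finally show ?case .
    qed
  qed (use int integrable_bcont[OF \<mu> f] q_int in auto)
  also have "\<dots> = (\<integral>x. ?q x \<partial>\<mu>) - 1" using q_int by (simp add: \<mu>.prob_space)
  also have "\<dots> \<le> 0" using \<open>(\<integral>x. ?q x \<partial>\<mu>) \<le> 1\<close> by simp
  finally show ?thesis by (simp add: ent)
qed auto

lemma relative_entropy_nonneg: "\<mu> \<in> prob_measures \<Longrightarrow> 0 \<le> relative_entropy \<mu> std_gauss"
  using donsker_varadhan_le[of \<mu> "\<lambda>_. 0"] std_normal.prob_space
  by (simp add: bcont_const log_laplace_def zero_ereal_def)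

text \<open>Measurable functions are limits of continuous functions almost everywhere, and clipping at the
  bound of \<open>F\<close> does not disturb the limit.\<close>

lemma bounded_measurable_approximation:
  assumes F: "F \<in> borel_measurable borel" and n: "\<And>x. \<bar>F x\<bar> \<le> (n :: real)"
  obtains g :: "nat \<Rightarrow> real \<Rightarrow> real" where "\<And>j. g j \<in> bcont" "\<And>j x. \<bar>g j x\<bar> \<le> n"
    "AE x in std_gauss. (\<lambda>j. g j x) \<longlonglongrightarrow> F x"
proof -
  have n0: "0 \<le> n" using n[of 0] by simp
  have "F \<in> borel_measurable lebesgue" using F by (simp add: measurable_completion)
  then have "F measurable_on UNIV" by (intro lebesgue_measurable_imp_measurable_on_real) auto
  then obtain S h where S: "negligible S" and h: "\<And>j. continuous_on UNIV (h j)"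
    and lim: "\<And>x. x \<notin> S \<Longrightarrow> (\<lambda>j. h j x) \<longlonglongrightarrow> F x"
    unfolding measurable_on_def by auto
  define g where "g j x = max (- n) (min n (h (j :: nat) x))" for j x
  show thesis
  proof
    show bound: "\<bar>g j x\<bar> \<le> n" for j x using n0 by (auto simp: g_def)
    show "g j \<in> bcont" for j
      by (rule bcontI[OF _ bound]) (auto simp: g_def[abs_def] intro!: continuous_intros h)
    have "AE x in lebesgue. (\<lambda>j. g j x) \<longlonglongrightarrow> F x"
    proof (rule AE_I')
      show "S \<in> null_sets lebesgue" using S by (simp add: negligible_iff_null_sets)
      have "(\<lambda>j. g j x) \<longlonglongrightarrow> F x" if "x \<notin> S" for x
      proof -
        have "(\<lambda>j. g j x) \<longlonglongrightarrow> max (- n) (min n (F x))"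
          unfolding g_def by (intro tendsto_intros lim that)
        moreover have "max (- n) (min n (F x)) = F x" using n[of x] by auto
        ultimately show ?thesis by simp
      qed
      then show "{x \<in> space lebesgue. \<not> (\<lambda>j. g j x) \<longlonglongrightarrow> F x} \<subseteq> S" by auto
    qed
    then have "AE x in lborel. (\<lambda>j. g j x) \<longlonglongrightarrow> F x" by (simp add: AE_completion_iff)
    then show "AE x in std_gauss. (\<lambda>j. g j x) \<longlonglongrightarrow> F x"
      by (subst AE_density) auto
  qed
qed

lemma tendsto_integral_bounded:
  assumes \<mu>: "\<mu> \<in> prob_measures" and "\<And>j. g j \<in> borel_measurable borel" "F \<in> borel_measurable borel"
    and "\<And>j x. \<bar>g j x\<bar> \<le> (K :: real)" "AE x in \<mu>. (\<lambda>j. g j x) \<longlonglongrightarrow> F x"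
  shows "(\<lambda>j. \<integral>x. g j x \<partial>\<mu>) \<longlonglongrightarrow> (\<integral>x. F x \<partial>\<mu>)"
proof (rule integral_dominated_convergence[where w = "\<lambda>_. K"])
  interpret prob_space \<mu> using \<mu> by (rule prob_measuresD)
  show "integrable \<mu> (\<lambda>_. K)" by simp
qed (use assms in \<open>auto simp: measurable_cong_sets[OF prob_measuresD(2)[OF \<mu>] refl]\<close>)

lemma tendsto_log_laplace:
  assumes g[measurable]: "\<And>j. g j \<in> borel_measurable borel" and F[measurable]: "F \<in> borel_measurable borel"
    and K: "\<And>j x. \<bar>g j x\<bar> \<le> (K :: real)" "\<And>x. \<bar>F x\<bar> \<le> K" and lim: "AE x in std_gauss. (\<lambda>j. g j x) \<longlonglongrightarrow> F x"
  shows "(\<lambda>j. log_laplace (g j)) \<longlonglongrightarrow> log_laplace F"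
proof -
  have "(\<lambda>j. \<integral>x. exp (g j x) \<partial>std_gauss) \<longlonglongrightarrow> (\<integral>x. exp (F x) \<partial>std_gauss)"
  proof (rule tendsto_integral_bounded[OF std_gauss_prob_measures])
    show "AE x in std_gauss. (\<lambda>j. exp (g j x)) \<longlonglongrightarrow> exp (F x)"
      using lim by eventually_elim (rule tendsto_exp)
    show "\<bar>exp (g j x)\<bar> \<le> exp K" for j x using abs_le_D1[OF K(1)[of j x]] by simp
  qed measurable
  moreover have "(\<integral>x. exp (F x) \<partial>std_gauss) \<noteq> 0"
    using exp_log_laplace[OF F K(2)] by (metis exp_not_eq_zero)
  ultimately show ?thesis unfolding log_laplace_def by (rule tendsto_ln)
qed

lemma tendsto_integral_tilted:
  assumes g[measurable]: "\<And>j. g j \<in> borel_measurable borel" and F[measurable]: "F \<in> borel_measurable borel"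
    and K: "\<And>j x. \<bar>g j x\<bar> \<le> (K :: real)" "\<And>x. \<bar>F x\<bar> \<le> K" and lim: "AE x in std_gauss. (\<lambda>j. g j x) \<longlonglongrightarrow> F x"
    and \<phi>[measurable]: "\<And>j. \<phi> j \<in> borel_measurable borel" and \<psi>[measurable]: "\<psi> \<in> borel_measurable borel"
    and L: "\<And>j x. \<bar>\<phi> j x\<bar> \<le> (L :: real)" and lim': "AE x in std_gauss. (\<lambda>j. \<phi> j x) \<longlonglongrightarrow> \<psi> x"
  shows "(\<lambda>j. \<integral>x. \<phi> j x \<partial>tilted (g j)) \<longlonglongrightarrow> (\<integral>x. \<psi> x \<partial>tilted F)"
proof -
  have "(\<lambda>j. \<integral>x. \<phi> j x * exp (g j x) \<partial>std_gauss) \<longlonglongrightarrow> (\<integral>x. \<psi> x * exp (F x) \<partial>std_gauss)"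
  proof (rule tendsto_integral_bounded[OF std_gauss_prob_measures])
    show "AE x in std_gauss. (\<lambda>j. \<phi> j x * exp (g j x)) \<longlonglongrightarrow> \<psi> x * exp (F x)"
      using lim lim' by eventually_elim (intro tendsto_intros)
    show "\<bar>\<phi> j x * exp (g j x)\<bar> \<le> L * exp K" for j x
      using abs_le_D1[OF K(1)[of j x]] L[of j x] by (simp add: abs_mult mult_mono')
  qed measurable
  then have "(\<lambda>j. (\<integral>x. \<phi> j x * exp (g j x) \<partial>std_gauss) / exp (log_laplace (g j)))
      \<longlonglongrightarrow> (\<integral>x. \<psi> x * exp (F x) \<partial>std_gauss) / exp (log_laplace F)"
    by (intro tendsto_intros tendsto_log_laplace[OF g F K lim]) auto
  then show ?thesis by (simp add: integral_tilted[OF g K(1) \<phi>] integral_tilted[OF F K(2) \<psi>])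
qed

text \<open>Clipped densities have bounded logarithms, so these are almost admissible in the variational formula;
  only continuity is missing.\<close>

definition clip :: "nat \<Rightarrow> real \<Rightarrow> real" where
  "clip n d = max (exp (- real n)) (min (exp (real n)) d)"

lemma clip_pos: "0 < clip n d"
  by (simp add: clip_def less_max_iff_disj)

lemma abs_ln_clip_le: "\<bar>ln (clip n d)\<bar> \<le> n"
proof -
  have "exp (- real n) \<le> clip n d" "clip n d \<le> exp (real n)" by (auto simp: clip_def)
  then have "ln (exp (- real n)) \<le> ln (clip n d)" "ln (clip n d) \<le> ln (exp (real n))"
    by (subst ln_le_cancel_iff; simp add: clip_pos)+
  then show ?thesis by (simp add: abs_le_iff)
qed

lemma clip_le: "0 \<le> d \<Longrightarrow> clip n d \<le> d + 1"
proof -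
  assume "0 \<le> d"
  moreover have "exp (- real n) \<le> 1" by simp
  ultimately show ?thesis unfolding clip_def by linarith
qed

lemma clip_eventually:
  assumes "0 < d"
  shows "\<forall>\<^sub>F n in sequentially. clip n d = d"
proof -
  obtain m :: nat where m: "\<bar>ln d\<bar> \<le> m" using real_arch_simple by blast
  have "clip n d = d" if "m \<le> n" for n
  proof -
    have "\<bar>ln d\<bar> \<le> n" using m that by linarith
    then have "exp (- real n) \<le> exp (ln d)" "exp (ln d) \<le> exp (real n)"
      unfolding exp_le_cancel_iff by linarith+
    then show ?thesis using assms by (simp add: clip_def)
  qed
  then show ?thesis unfolding eventually_sequentially by blast
qed

lemma tendsto_clip:
  assumes "0 \<le> d"
  shows "(\<lambda>n. clip n d) \<longlonglongrightarrow> d" "(\<lambda>n. clip n d * ln (clip n d)) \<longlonglongrightarrow> d * ln d"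
proof -
  have "(\<lambda>n. clip n d) \<longlonglongrightarrow> d \<and> (\<lambda>n. clip n d * ln (clip n d)) \<longlonglongrightarrow> d * ln d"
  proof (cases "d = 0")
    case True
    have c: "clip n 0 = exp (- real n)" for n by (simp add: clip_def max_def min_def)
    have "(\<lambda>n. exp (- real n)) \<longlonglongrightarrow> 0" "(\<lambda>n. exp (- real n) * (- real n)) \<longlonglongrightarrow> 0" by real_asymp+
    then show ?thesis by (simp add: True c)
  next
    case False
    then have "\<forall>\<^sub>F n in sequentially. clip n d = d" using assms by (intro clip_eventually) simp
    then show ?thesis
      by (auto intro!: tendsto_eventually elim!: eventually_mono)
  qed
  then show "(\<lambda>n. clip n d) \<longlonglongrightarrow> d" "(\<lambda>n. clip n d * ln (clip n d)) \<longlonglongrightarrow> d * ln d" by auto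
qed

text \<open>The domination under which the entropy of the clipped densities converges. Clipping from above
  decreases the value, and clipping from below produces at most \<open>n * exp (- n)\<close>.\<close>

lemma abs_clip_ln_clip_le:
  assumes "0 \<le> d"
  shows "\<bar>clip n d * ln (clip n d)\<bar> \<le> \<bar>d * ln d\<bar> + 1"
proof -
  have e: "exp (- real n) \<le> exp (real n)" by simp
  consider "d < exp (- real n)" | "exp (real n) < d" | "exp (- real n) \<le> d" "d \<le> exp (real n)" by linarith
  then show ?thesis
  proof cases
    case 1
    then have "clip n d = exp (- real n)" using e by (simp add: clip_def)
    then have "\<bar>clip n d * ln (clip n d)\<bar> = n * exp (- real n)" by (simp add: abs_mult mult.commute)
    also have "\<dots> \<le> 1"
    proof -
      have "real n \<le> exp (real n)" using exp_ge_add_one_self[of "real n"] by linarith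
      then show ?thesis by (simp add: exp_minus field_simps)
    qed
    finally show ?thesis by (simp add: add_increasing)
  next
    case 2
    then have c: "clip n d = exp (real n)" using e by (simp add: clip_def)
    have "ln (exp (real n)) \<le> ln d" using 2 by (subst ln_le_cancel_iff) (auto intro: less_trans[OF exp_gt_zero])
    then have "n \<le> ln d" by simp
    then have "exp (real n) * n \<le> d * ln d" using 2 assms by (intro mult_mono) auto
    then show ?thesis by (simp add: c)
  next
    case 3
    then show ?thesis by (simp add: clip_def)
  qed
qed

lemma ennreal_clip_tendsto:
  assumes "0 < d"
  shows "(\<lambda>n. ennreal (ln (clip n d))) \<longlonglongrightarrow> ennreal (ln d)"
  by (rule tendsto_eventually) (use clip_eventually[OF assms] in \<open>auto elim: eventually_mono\<close>)

lemma neg_ln_clip_le: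
  assumes "0 < d"
  shows "ennreal (- ln (clip n d)) \<le> ennreal (- ln d)"
proof (cases "d \<le> exp (real n)")
  case True
  then have "ln d \<le> ln (clip n d)" using assms by (subst ln_le_cancel_iff) (auto simp: clip_def clip_pos less_max_iff_disj)
  then show ?thesis by (intro ennreal_leI) simp
next
  case False
  moreover have "exp (- real n) \<le> exp (real n)" by simp
  ultimately have "clip n d = exp (real n)" by (simp add: clip_def)
  then show ?thesis by (simp add: ennreal_neg)
qed

text \<open>Both terms are continuous along bounded sequences that converge almost everywhere. For \<open>\<mu>\<close> this
  uses absolute continuity, because the approximation is only valid up to Gaussian null sets.\<close>

lemma donsker_varadhan_approximation:
  assumes \<mu>: "\<mu> \<in> prob_measures" and ac: "absolutely_continuous std_gauss \<mu>"
    and F: "F \<in> borel_measurable borel" "\<And>x. \<bar>F x\<bar> \<le> (n :: real)"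
    and a: "a < (\<integral>x. F x \<partial>\<mu>) - log_laplace F"
  shows "\<exists>f\<in>bcont. a < (\<integral>x. f x \<partial>\<mu>) - log_laplace f"
proof -
  obtain g where g: "\<And>j. g j \<in> bcont" "\<And>j x. \<bar>g j x\<bar> \<le> n" "AE x in std_gauss. (\<lambda>j. g j x) \<longlonglongrightarrow> F x"
    by (rule bounded_measurable_approximation[OF F]) (rule that; assumption)
  note gm = bcont_measurable[OF g(1)]
  have "AE x in \<mu>. (\<lambda>j. g j x) \<longlonglongrightarrow> F x"
    using absolutely_continuous_AE[OF _ ac g(3)] prob_measuresD(2)[OF \<mu>] by simp
  then have "(\<lambda>j. (\<integral>x. g j x \<partial>\<mu>) - log_laplace (g j)) \<longlonglongrightarrow> (\<integral>x. F x \<partial>\<mu>) - log_laplace F"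
    by (intro tendsto_diff tendsto_integral_bounded[OF \<mu> gm F(1) g(2)] tendsto_log_laplace[OF gm F(1) g(2) F(2) g(3)])
  then have "\<forall>\<^sub>F j in sequentially. a < (\<integral>x. g j x \<partial>\<mu>) - log_laplace (g j)"
    using a by (rule order_tendstoD)
  then show ?thesis using g(1) by (auto dest!: eventually_happens'[OF sequentially_bot])
qed

text \<open>A Gaussian null set of positive \<open>\<mu>\<close>-measure contains a compact set \<open>K\<close> of positive measure. The
  indicator of \<open>K\<close> is the limit of continuous functions, its multiples have arbitrarily large integral
  with respect to \<open>\<mu>\<close>, and they do not contribute to the Gaussian exponential integral.\<close>

lemma donsker_varadhan_singular:
  assumes \<mu>: "\<mu> \<in> prob_measures" and nac: "\<not> absolutely_continuous std_gauss \<mu>"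
  shows "\<exists>f\<in>bcont. a < (\<integral>x. f x \<partial>\<mu>) - log_laplace f"
proof -
  interpret \<mu>: prob_space \<mu> using \<mu> by (rule prob_measuresD)
  note sets = prob_measuresD(2)[OF \<mu>] and space = prob_measuresD(4)[OF \<mu>]
  obtain B where B: "B \<in> null_sets std_gauss" "B \<notin> null_sets \<mu>"
    using nac by (auto simp: absolutely_continuous_def)
  then have B_sets: "B \<in> sets borel" by (auto dest: null_setsD2)
  with B sets have "0 < emeasure \<mu> B" by (auto simp: null_sets_def zero_less_iff_neq_zero)
  also have "emeasure \<mu> B = (SUP K\<in>{K. K \<subseteq> B \<and> compact K}. emeasure \<mu> K)"
    by (rule inner_regular[OF sets _ B_sets]) simp
  finally obtain K where K: "K \<subseteq> B" "compact K" "0 < emeasure \<mu> K" by (auto simp: less_SUP_iff)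
  have K_sets: "K \<in> sets borel" using K(2) by (simp add: compact_imp_closed)
  have K_null: "K \<in> null_sets std_gauss" by (rule null_sets_subset[OF B(1) _ K(1)]) (simp add: K_sets)
  have K_ne: "K \<noteq> {}" using K(3) by auto
  have mK: "0 < measure \<mu> K" using K(3) by (simp add: \<mu>.emeasure_eq_measure)
  define t where "t = (\<bar>a\<bar> + 1) / measure \<mu> K"
  have t: "0 < t" "a < t * measure \<mu> K" using mK by (auto simp: t_def)
  define g where "g n x = t * max 0 (1 - real n * infdist x K)" for n x
  have g_bound: "\<bar>g n x\<bar> \<le> t" for n x
  proof -
    have "max 0 (1 - real n * infdist x K) \<le> 1" by (simp add: infdist_nonneg)
    then show ?thesis using t by (simp add: g_def abs_mult mult_left_le)
  qed
  have g: "g n \<in> bcont" for n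
    by (rule bcontI[OF _ g_bound]) (auto simp: g_def[abs_def] intro!: continuous_intros)
  let ?F = "\<lambda>x. t * indicator K x :: real"
  have F[measurable]: "?F \<in> borel_measurable borel" using K_sets by measurable
  have F_bound: "\<bar>?F x\<bar> \<le> t" for x using t by (simp add: indicator_def)
  have lim: "(\<lambda>n. g n x) \<longlonglongrightarrow> ?F x" for x
  proof (cases "x \<in> K")
    case False
    then have d: "0 < infdist x K"
      using K_ne K(2) in_closed_iff_infdist_zero[of K x] infdist_nonneg[of x K] by (simp add: compact_imp_closed less_le)
    have "\<forall>\<^sub>F n in sequentially. 1 / infdist x K < real n"
      using filterlim_real_sequentially by (simp add: filterlim_at_top_dense)
    then have "\<forall>\<^sub>F n in sequentially. g n x = 0"
      by eventually_elim (use d in \<open>simp add: g_def field_simps\<close>)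
    then show ?thesis using False by (simp add: tendsto_eventually)
  qed (simp add: g_def)
  have "(\<lambda>n. (\<integral>x. g n x \<partial>\<mu>) - log_laplace (g n)) \<longlonglongrightarrow> (\<integral>x. ?F x \<partial>\<mu>) - log_laplace ?F"
    using lim by (intro tendsto_diff tendsto_integral_bounded[OF \<mu> bcont_measurable[OF g] F g_bound]
        tendsto_log_laplace[OF bcont_measurable[OF g] F g_bound F_bound]) auto
  moreover have "log_laplace ?F = 0"
  proof -
    have "(\<integral>x. exp (?F x) \<partial>std_gauss) = (\<integral>x. 1 \<partial>std_gauss)"
    proof (rule integral_cong_AE)
      show "AE x in std_gauss. exp (?F x) = 1" using AE_not_in[OF K_null] by eventually_elim simp
    qed auto
    then show ?thesis using std_normal.prob_space by (simp add: log_laplace_def)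
  qed
  moreover have "(\<integral>x. ?F x \<partial>\<mu>) = t * measure \<mu> K" using space by simp
  ultimately have "\<forall>\<^sub>F n in sequentially. a < (\<integral>x. g n x \<partial>\<mu>) - log_laplace (g n)"
    using t by (intro order_tendstoD(1)[of _ "t * measure \<mu> K"]) auto
  then show ?thesis using g by (auto dest!: eventually_happens'[OF sequentially_bot])
qed

lemma
  assumes [measurable]: "D \<in> borel_measurable borel" and nn: "\<And>x. 0 \<le> D x"
    and dens: "\<mu> = density std_gauss (\<lambda>x. ennreal (D x))" and \<mu>: "\<mu> \<in> prob_measures"
  shows tendsto_integral_clip: "(\<lambda>n. \<integral>x. clip n (D x) \<partial>std_gauss) \<longlonglongrightarrow> 1"
    and tendsto_integral_clip_mult: "\<phi> \<in> borel_measurable borel \<Longrightarrow> (\<And>x. \<bar>\<phi> x\<bar> \<le> (L :: real)) \<Longrightarrow>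
      (\<lambda>n. \<integral>x. \<phi> x * clip n (D x) \<partial>std_gauss) \<longlonglongrightarrow> (\<integral>x. \<phi> x \<partial>\<mu>)"
proof -
  interpret \<mu>: prob_space \<mu> using \<mu> by (rule prob_measuresD)
  have clip[measurable]: "clip n \<in> borel_measurable borel" for n unfolding clip_def[abs_def] by measurable
  have "(\<integral>\<^sup>+x. ennreal (D x) \<partial>std_gauss) = emeasure \<mu> UNIV"
    unfolding dens by (subst emeasure_density) auto
  also have "\<dots> = 1" using \<mu>.emeasure_space_1 prob_measuresD(4)[OF \<mu>] by simp
  finally have D1: "(\<integral>\<^sup>+x. ennreal (D x) \<partial>std_gauss) = 1" .
  have int: "integrable std_gauss D"
    using nn D1 by (intro integrableI_bounded) auto
  have one: "(\<integral>x. D x \<partial>std_gauss) = 1"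
    using D1 nn by (subst (asm) nn_integral_eq_integral[OF int]) auto
  have mult: "(\<lambda>n. \<integral>x. \<phi> x * clip n (D x) \<partial>std_gauss) \<longlonglongrightarrow> (\<integral>x. \<phi> x * D x \<partial>std_gauss)"
    if [measurable]: "\<phi> \<in> borel_measurable borel" and L: "\<And>x. \<bar>\<phi> x\<bar> \<le> L" for \<phi> and L :: real
  proof (rule integral_dominated_convergence[where w = "\<lambda>x. L * (D x + 1)"])
    show "AE x in std_gauss. (\<lambda>n. \<phi> x * clip n (D x)) \<longlonglongrightarrow> \<phi> x * D x"
      by (intro always_eventually allI tendsto_intros tendsto_clip nn)
    show "AE x in std_gauss. norm (\<phi> x * clip n (D x)) \<le> L * (D x + 1)" for n
    proof (intro always_eventually allI)
      fix x
      show "norm (\<phi> x * clip n (D x)) \<le> L * (D x + 1)"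
        using clip_le[OF nn, of n x] clip_pos[of n "D x"] L[of x] nn[of x]
        by (simp add: abs_mult mult_mono')
    qed
  qed (use int in auto)
  show "(\<lambda>n. \<integral>x. clip n (D x) \<partial>std_gauss) \<longlonglongrightarrow> 1"
    using mult[of "\<lambda>_. 1" 1] by (simp add: one)
  show "(\<lambda>n. \<integral>x. \<phi> x * clip n (D x) \<partial>std_gauss) \<longlonglongrightarrow> (\<integral>x. \<phi> x \<partial>\<mu>)"
    if \<phi>: "\<phi> \<in> borel_measurable borel" and L: "\<And>x. \<bar>\<phi> x\<bar> \<le> L" for \<phi> and L :: real
  proof -
    have "(\<integral>x. \<phi> x \<partial>\<mu>) = (\<integral>x. \<phi> x * D x \<partial>std_gauss)"
      unfolding dens using \<phi> nn by (subst integral_density) (auto simp: mult.commute)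
    with mult[OF \<phi> L] show ?thesis by simp
  qed
qed

text \<open>The optimal function would be the logarithm of the density \<open>D\<close>. Its clipped versions approximate it:
  their positive parts are controlled from below by Fatou's lemma, which covers infinite entropy, their
  negative parts only shrink, and their exponential integral tends to \<open>\<integral> D d\<gamma> = 1\<close>.\<close>

lemma donsker_varadhan_ge:
  assumes \<mu>: "\<mu> \<in> prob_measures" and a: "ereal a < relative_entropy \<mu> std_gauss"
  shows "\<exists>f\<in>bcont. a < (\<integral>x. f x \<partial>\<mu>) - log_laplace f"
proof (cases "absolutely_continuous std_gauss \<mu>")
  case False
  with \<mu> show ?thesis by (rule donsker_varadhan_singular)
next
  case ac: True
  interpret \<mu>: prob_space \<mu> using \<mu> by (rule prob_measuresD)
  note sets[measurable_cong] = prob_measuresD(2)[OF \<mu>]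
  obtain D where D[measurable]: "D \<in> borel_measurable borel" and nn: "\<And>x. 0 \<le> D x"
    and dens: "\<mu> = density std_gauss (\<lambda>x. ennreal (D x))" and pos: "AE x in \<mu>. 0 < D x"
    and neg: "(\<integral>\<^sup>+x. ennreal (- ln (D x)) \<partial>\<mu>) \<le> 1"
    and ent: "relative_entropy \<mu> std_gauss
      = enn2ereal (\<integral>\<^sup>+x. ennreal (ln (D x)) \<partial>\<mu>) - enn2ereal (\<integral>\<^sup>+x. ennreal (- ln (D x)) \<partial>\<mu>)"
    by (rule relative_entropy_ac[OF \<mu> ac]) (rule that; assumption)
  have clip[measurable]: "clip n \<in> borel_measurable borel" for n unfolding clip_def[abs_def] by measurable
  let ?F = "\<lambda>n x. ln (clip n (D x))"
  let ?pos = "\<integral>\<^sup>+x. ennreal (ln (D x)) \<partial>\<mu>" and ?neg = "\<integral>\<^sup>+x. ennreal (- ln (D x)) \<partial>\<mu>"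
  define c where "c = enn2real ?neg"
  have neg_c: "?neg = ennreal c" "0 \<le> c" using neg by (auto simp: c_def top_unique ennreal_enn2real_if)
  obtain b where b: "a < b" "ereal b < relative_entropy \<mu> std_gauss"
    using ereal_dense2[OF a] by auto
  have "ereal (b + c) < enn2ereal ?pos"
    using b(2) neg_c(2) unfolding ent neg_c(1) by (cases "?pos") (auto simp: enn2ereal_ennreal)
  then have pos_gt: "ennreal (b + c) < ?pos" if "0 \<le> b + c"
    using that by (cases "?pos") (auto simp: enn2ereal_ennreal ennreal_less_iff less_top)
  have "?pos \<le> (\<integral>\<^sup>+x. liminf (\<lambda>n. ennreal (?F n x)) \<partial>\<mu>)"
  proof (rule nn_integral_mono_AE)
    show "AE x in \<mu>. ennreal (ln (D x)) \<le> liminf (\<lambda>n. ennreal (?F n x))"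
      using pos
    proof eventually_elim
      case (elim x)
      then show ?case using lim_imp_Liminf[OF sequentially_bot ennreal_clip_tendsto[OF elim]] by simp
    qed
  qed
  also have "\<dots> \<le> liminf (\<lambda>n. \<integral>\<^sup>+x. ennreal (?F n x) \<partial>\<mu>)"
    by (rule nn_integral_liminf) measurable
  finally have liminf: "?pos \<le> liminf (\<lambda>n. \<integral>\<^sup>+x. ennreal (?F n x) \<partial>\<mu>)" .
  have ev1: "\<forall>\<^sub>F n in sequentially. 0 \<le> b + c \<longrightarrow> ennreal (b + c) < (\<integral>\<^sup>+x. ennreal (?F n x) \<partial>\<mu>)"
    using pos_gt liminf unfolding le_Liminf_iff by (cases "0 \<le> b + c") auto
  have F_int: "integrable \<mu> (?F n)" for n
    by (rule integrable_bounded_prob[OF \<mu> _ abs_ln_clip_le]) measurable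
  have ev2: "\<forall>\<^sub>F n in sequentially. b < (\<integral>x. ?F n x \<partial>\<mu>)"
    using ev1
  proof eventually_elim
    case (elim n)
    have fin: "(\<integral>\<^sup>+x. ennreal (?F n x) \<partial>\<mu>) \<noteq> \<infinity>" "(\<integral>\<^sup>+x. ennreal (- ?F n x) \<partial>\<mu>) \<noteq> \<infinity>"
      using F_int[of n] by (auto simp: real_integrable_def)
    have "(\<integral>\<^sup>+x. ennreal (- ?F n x) \<partial>\<mu>) \<le> ?neg"
      by (rule nn_integral_mono_AE) (use pos in eventually_elim, simp add: neg_ln_clip_le)
    then have "enn2real (\<integral>\<^sup>+x. ennreal (- ?F n x) \<partial>\<mu>) \<le> c"
      using neg_c by (simp add: enn2real_leI)
    moreover have "b + c < enn2real (\<integral>\<^sup>+x. ennreal (?F n x) \<partial>\<mu>) \<or> b + c < 0"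
      using elim fin by (cases "\<integral>\<^sup>+x. ennreal (?F n x) \<partial>\<mu>") (auto simp: ennreal_less_iff)
    moreover have "0 \<le> enn2real (\<integral>\<^sup>+x. ennreal (?F n x) \<partial>\<mu>)" by simp
    ultimately show ?case unfolding real_lebesgue_integral_def[OF F_int[of n]] by linarith
  qed
  have "(\<lambda>n. ln (\<integral>x. clip n (D x) \<partial>std_gauss)) \<longlonglongrightarrow> ln 1"
    by (rule tendsto_ln[OF tendsto_integral_clip[OF D nn dens \<mu>]]) simp
  then have "(\<lambda>n. log_laplace (?F n)) \<longlonglongrightarrow> 0"
    by (simp add: log_laplace_def exp_ln[OF clip_pos])
  then have "\<forall>\<^sub>F n in sequentially. log_laplace (?F n) < b - a"
    using b(1) by (intro order_tendstoD(2)) auto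
  with ev2 have "\<forall>\<^sub>F n in sequentially. a < (\<integral>x. ?F n x \<partial>\<mu>) - log_laplace (?F n)"
    by eventually_elim linarith
  then obtain n where n: "a < (\<integral>x. ?F n x \<partial>\<mu>) - log_laplace (?F n)"
    by (auto dest!: eventually_happens'[OF sequentially_bot])
  show ?thesis
    by (rule donsker_varadhan_approximation[OF \<mu> ac _ abs_ln_clip_le n]) measurable
qed

text \<open>The measures with clipped and renormalised density converge weakly to \<open>\<mu>\<close>, and so do their entropies
  by dominated convergence. They are of the form \<open>tilted f\<close> with bounded measurable \<open>f\<close>, which is then
  replaced by a continuous function.\<close>

lemma tilted_approximation:
  assumes \<mu>: "\<mu> \<in> prob_measures" and h: "relative_entropy \<mu> std_gauss = ereal h"
    and U: "openin weak_topology U" "\<mu> \<in> U" and \<epsilon>: "0 < \<epsilon>"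
  shows "\<exists>f\<in>bcont. tilted f \<in> U \<and> (\<integral>x. f x \<partial>tilted f) - log_laplace f < h + \<epsilon>"
proof -
  have fin: "relative_entropy \<mu> std_gauss < \<infinity>" by (simp add: h)
  obtain D where D[measurable]: "D \<in> borel_measurable borel" and nn: "\<And>x. 0 \<le> D x"
    and dens: "\<mu> = density std_gauss (\<lambda>x. ennreal (D x))" and pos: "AE x in \<mu>. 0 < D x"
    and int: "integrable \<mu> (\<lambda>x. ln (D x))" and ent: "relative_entropy \<mu> std_gauss = ereal (\<integral>x. ln (D x) \<partial>\<mu>)"
    by (rule relative_entropy_finite[OF \<mu> fin]) (rule that; assumption)
  have clip[measurable]: "clip n \<in> borel_measurable borel" for n unfolding clip_def[abs_def] by measurable
  let ?F = "\<lambda>n x. ln (clip n (D x))"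
  let ?Z = "\<lambda>n. \<integral>x. clip n (D x) \<partial>std_gauss"
  have Fm: "?F n \<in> borel_measurable borel" for n by measurable
  note Z = tendsto_integral_clip[OF D nn dens \<mu>]
  have expF: "exp (log_laplace (?F n)) = ?Z n" for n
    using exp_log_laplace[OF Fm abs_ln_clip_le, of n] by (simp add: exp_ln[OF clip_pos])
  have "(\<lambda>n. ln (?Z n)) \<longlonglongrightarrow> ln 1" by (rule tendsto_ln[OF Z]) simp
  then have L: "(\<lambda>n. log_laplace (?F n)) \<longlonglongrightarrow> 0"
    by (simp add: log_laplace_def exp_ln[OF clip_pos])
  have "\<forall>\<^sub>F n in sequentially. tilted (?F n) \<in> U"
  proof (rule weak_open_sequentially[OF U])
    show "tilted (?F n) \<in> prob_measures" for n by (rule tilted_prob_measures[OF Fm abs_ln_clip_le])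
    fix \<phi> assume \<phi>: "\<phi> \<in> bcont"
    obtain K where K: "\<And>x. \<bar>\<phi> x\<bar> \<le> K" using bcontE[OF \<phi>] by metis
    have "(\<lambda>n. (\<integral>x. \<phi> x * clip n (D x) \<partial>std_gauss) / ?Z n) \<longlonglongrightarrow> (\<integral>x. \<phi> x \<partial>\<mu>) / 1"
      by (intro tendsto_divide Z tendsto_integral_clip_mult[OF D nn dens \<mu> bcont_measurable[OF \<phi>] K]) simp
    then show "(\<lambda>n. \<integral>x. \<phi> x \<partial>tilted (?F n)) \<longlonglongrightarrow> (\<integral>x. \<phi> x \<partial>\<mu>)"
      by (simp add: integral_tilted[OF Fm abs_ln_clip_le bcont_measurable[OF \<phi>]] expF exp_ln[OF clip_pos])
  qed
  moreover have "(\<lambda>n. (\<integral>x. ?F n x \<partial>tilted (?F n)) - log_laplace (?F n)) \<longlonglongrightarrow> h"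
  proof -
    have h_eq: "h = (\<integral>x. D x * ln (D x) \<partial>std_gauss)"
      using ent h nn unfolding dens by (simp add: integral_density)
    have DlnD: "integrable std_gauss (\<lambda>x. D x * ln (D x))"
      using int nn unfolding dens by (simp add: integrable_density)
    have "(\<lambda>n. \<integral>x. clip n (D x) * ?F n x \<partial>std_gauss) \<longlonglongrightarrow> h"
      unfolding h_eq
    proof (rule integral_dominated_convergence[where w = "\<lambda>x. \<bar>D x * ln (D x)\<bar> + 1"])
      show "AE x in std_gauss. (\<lambda>n. clip n (D x) * ?F n x) \<longlonglongrightarrow> D x * ln (D x)"
        by (intro always_eventually allI tendsto_clip nn)
      show "AE x in std_gauss. norm (clip n (D x) * ?F n x) \<le> \<bar>D x * ln (D x)\<bar> + 1" for n
        using abs_clip_ln_clip_le[OF nn] by simp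
    qed (use DlnD in auto)
    then have "(\<lambda>n. (\<integral>x. clip n (D x) * ?F n x \<partial>std_gauss) / ?Z n - log_laplace (?F n)) \<longlonglongrightarrow> h / 1 - 0"
      by (intro tendsto_intros Z L) simp_all
    then show ?thesis
      by (simp add: integral_tilted[OF Fm abs_ln_clip_le Fm] expF exp_ln[OF clip_pos] mult.commute)
  qed
  then have "\<forall>\<^sub>F n in sequentially. (\<integral>x. ?F n x \<partial>tilted (?F n)) - log_laplace (?F n) < h + \<epsilon>"
    using \<epsilon> by (intro order_tendstoD(2)) auto
  ultimately have "\<forall>\<^sub>F n in sequentially. tilted (?F n) \<in> U \<and> (\<integral>x. ?F n x \<partial>tilted (?F n)) - log_laplace (?F n) < h + \<epsilon>"
    by eventually_elim simp
  then obtain n where n: "tilted (?F n) \<in> U" "(\<integral>x. ?F n x \<partial>tilted (?F n)) - log_laplace (?F n) < h + \<epsilon>"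
    by (auto dest!: eventually_happens'[OF sequentially_bot])
  let ?f = "?F n"
  obtain g where g: "\<And>j. g j \<in> bcont" "\<And>j x. \<bar>g j x\<bar> \<le> real n" "AE x in std_gauss. (\<lambda>j. g j x) \<longlonglongrightarrow> ?f x"
    by (rule bounded_measurable_approximation[OF Fm abs_ln_clip_le]) (rule that; assumption)
  note gm = bcont_measurable[OF g(1)]
  note lim = tendsto_integral_tilted[OF gm Fm g(2) abs_ln_clip_le g(3)]
  have "\<forall>\<^sub>F j in sequentially. tilted (g j) \<in> U"
  proof (rule weak_open_sequentially[OF U(1) n(1)])
    show "tilted (g j) \<in> prob_measures" for j by (rule tilted_prob_measures[OF gm g(2)])
    fix \<phi> assume \<phi>: "\<phi> \<in> bcont"
    obtain K where K: "\<And>x. \<bar>\<phi> x\<bar> \<le> K" using bcontE[OF \<phi>] by metis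
    show "(\<lambda>j. \<integral>x. \<phi> x \<partial>tilted (g j)) \<longlonglongrightarrow> (\<integral>x. \<phi> x \<partial>tilted ?f)"
      by (rule lim[OF bcont_measurable[OF \<phi>] bcont_measurable[OF \<phi>] K]) simp
  qed
  moreover have "(\<lambda>j. (\<integral>x. g j x \<partial>tilted (g j)) - log_laplace (g j)) \<longlonglongrightarrow> (\<integral>x. ?f x \<partial>tilted ?f) - log_laplace ?f"
    by (intro tendsto_diff lim[OF gm Fm g(2,3)] tendsto_log_laplace[OF gm Fm g(2) abs_ln_clip_le g(3)])
  then have "\<forall>\<^sub>F j in sequentially. (\<integral>x. g j x \<partial>tilted (g j)) - log_laplace (g j) < h + \<epsilon>"
    using n(2) by (rule order_tendstoD)
  ultimately have "\<forall>\<^sub>F j in sequentially. tilted (g j) \<in> U \<and> (\<integral>x. g j x \<partial>tilted (g j)) - log_laplace (g j) < h + \<epsilon>"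
    by eventually_elim simp
  then show ?thesis using g(1) by (auto dest!: eventually_happens'[OF sequentially_bot])
qed

section \<open>The relative entropy as a good convex rate function\<close>

lemma sublevel_relative_entropy:
  "{\<mu> \<in> prob_measures. relative_entropy \<mu> std_gauss \<le> ereal y}
    = (\<Inter>f\<in>bcont. {\<mu> \<in> prob_measures. (\<integral>x. f x \<partial>\<mu>) \<le> y + log_laplace f})"
proof (intro equalityI subsetI)
  fix \<mu> assume "\<mu> \<in> {\<mu> \<in> prob_measures. relative_entropy \<mu> std_gauss \<le> ereal y}"
  then have \<mu>: "\<mu> \<in> prob_measures" and le: "relative_entropy \<mu> std_gauss \<le> ereal y" by auto
  have "(\<integral>x. f x \<partial>\<mu>) \<le> y + log_laplace f" if "f \<in> bcont" for f
    using order_trans[OF donsker_varadhan_le[OF \<mu> that] le] by simp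
  with \<mu> show "\<mu> \<in> (\<Inter>f\<in>bcont. {\<mu> \<in> prob_measures. (\<integral>x. f x \<partial>\<mu>) \<le> y + log_laplace f})" by auto
next
  fix \<mu> assume *: "\<mu> \<in> (\<Inter>f\<in>bcont. {\<mu> \<in> prob_measures. (\<integral>x. f x \<partial>\<mu>) \<le> y + log_laplace f})"
  then have \<mu>: "\<mu> \<in> prob_measures" using bcont_const by blast
  have "\<not> ereal y < relative_entropy \<mu> std_gauss"
  proof
    assume "ereal y < relative_entropy \<mu> std_gauss"
    then obtain f where "f \<in> bcont" "y < (\<integral>x. f x \<partial>\<mu>) - log_laplace f"
      using donsker_varadhan_ge[OF \<mu>] by blast
    with * show False by force
  qed
  with \<mu> show "\<mu> \<in> {\<mu> \<in> prob_measures. relative_entropy \<mu> std_gauss \<le> ereal y}" by auto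
qed

lemma rate_function_relative_entropy: "rate_function weak_topology (\<lambda>\<mu>. relative_entropy \<mu> std_gauss)"
  unfolding rate_function_def topspace_weak_topology sublevel_relative_entropy
  using bcont_const by (auto intro!: relative_entropy_nonneg closedin_INT closedin_weak_integral_le)

text \<open>The variational formula with test functions increasing to \<open>x\<^sup>2 / 4\<close>, for which the Gaussian
  exponential integral is at most \<open>sqrt 2 \<le> exp 1\<close>.\<close>

lemma sublevel_subset_moment_set:
  "{\<mu> \<in> prob_measures. relative_entropy \<mu> std_gauss \<le> ereal y} \<subseteq> moment_set (4 * (y + 1))"
proof
  fix \<mu> assume "\<mu> \<in> {\<mu> \<in> prob_measures. relative_entropy \<mu> std_gauss \<le> ereal y}"
  then have \<mu>: "\<mu> \<in> prob_measures" and le: "relative_entropy \<mu> std_gauss \<le> ereal y" by auto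
  have "(\<integral>x. min (x\<^sup>2) (real n) \<partial>\<mu>) \<le> 4 * (y + 1)" for n
  proof -
    define f where "f x = 1/4 * min (x\<^sup>2) (real n) + 0 * min (x\<^sup>2) (real n)" for x :: real
    have f: "f \<in> bcont" unfolding f_def[abs_def] by (rule bcont_linear[OF bcont_truncated_square bcont_truncated_square])
    have fx: "f x = min (x\<^sup>2) (real n) / 4" for x by (simp add: f_def)
    obtain K where K: "\<And>x. \<bar>f x\<bar> \<le> K" using bcontE[OF f] by metis
    have "ennreal (\<integral>x. exp (f x) \<partial>std_gauss) = (\<integral>\<^sup>+x. ennreal (exp (f x)) \<partial>std_gauss)"
      by (rule nn_integral_eq_integral[symmetric, OF integrable_exp_bounded[OF bcont_measurable[OF f] K]]) simp
    also have "\<dots> \<le> (\<integral>\<^sup>+x. ennreal (exp (1/4 * x\<^sup>2)) \<partial>std_gauss)"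
      by (intro nn_integral_mono ennreal_leI) (simp add: fx)
    also have "\<dots> = ennreal (sqrt 2)"
      using nn_integral_exp_square[of "1/4"] by (simp add: real_sqrt_divide)
    also have "\<dots> \<le> ennreal (exp 1)"
      using order_trans[OF _ exp_ge_add_one_self[of 1], of "sqrt 2"] by (intro ennreal_leI) (simp add: real_le_lsqrt)
    finally have "exp (log_laplace f) \<le> exp 1"
      by (simp add: exp_log_laplace[OF bcont_measurable[OF f] K])
    then have "log_laplace f \<le> 1" by simp
    moreover have "(\<integral>x. f x \<partial>\<mu>) - log_laplace f \<le> y"
      using order_trans[OF donsker_varadhan_le[OF \<mu> f] le] by simp
    ultimately have "(\<integral>x. f x \<partial>\<mu>) \<le> y + 1" by linarith
    moreover have "(\<integral>x. f x \<partial>\<mu>) = (\<integral>x. min (x\<^sup>2) (real n) \<partial>\<mu>) / 4" by (simp add: fx)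
    ultimately show ?thesis by simp
  qed
  with \<mu> show "\<mu> \<in> moment_set (4 * (y + 1))" by (simp add: moment_set_def)
qed

lemma good_rate_function_relative_entropy:
  "good_rate_function weak_topology (\<lambda>\<mu>. relative_entropy \<mu> std_gauss)"
  unfolding good_rate_function_def
proof (intro conjI allI impI rate_function_relative_entropy)
  fix y :: real assume "0 \<le> y"
  then have "closedin weak_topology {\<mu> \<in> prob_measures. relative_entropy \<mu> std_gauss \<le> ereal y}"
    using rate_function_relative_entropy by (simp add: rate_function_def)
  then show "compactin weak_topology {\<mu> \<in> topspace weak_topology. relative_entropy \<mu> std_gauss \<le> ereal y}"
    using closed_compactin[OF compactin_moment_set sublevel_subset_moment_set] by simp
qed

lemma
  assumes \<mu>: "\<mu> \<in> prob_measures" and \<nu>: "\<nu> \<in> prob_measures" and t: "0 \<le> t" "t \<le> 1"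
  shows mixture_prob_measures: "mixture t \<mu> \<nu> \<in> prob_measures"
    and integral_mixture: "f \<in> bcont \<Longrightarrow>
      (\<integral>x. f x \<partial>mixture t \<mu> \<nu>) = t * (\<integral>x. f x \<partial>\<mu>) + (1 - t) * (\<integral>x. f x \<partial>\<nu>)"
proof -
  interpret \<mu>: prob_space \<mu> using \<mu> by (rule prob_measuresD)
  interpret \<nu>: prob_space \<nu> using \<nu> by (rule prob_measuresD)
  note s\<mu>[measurable_cong] = prob_measuresD(2)[OF \<mu>] and s\<nu>[measurable_cong] = prob_measuresD(2)[OF \<nu>]
  let ?m = "mixture t \<mu> \<nu>"
  have "sets ?m = sets \<mu>" by (simp add: mixture_def)
  then have sm[measurable_cong]: "sets ?m = sets borel" by (simp only: s\<mu>)
  have spm: "space ?m = UNIV" using sets_eq_imp_space_eq[OF sm] by simp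
  have em: "emeasure ?m B = ennreal t * emeasure \<mu> B + ennreal (1 - t) * emeasure \<nu> B" if "B \<in> sets borel" for B
    using that by (intro emeasure_mixture) (simp_all add: s\<mu> s\<nu>)
  have "emeasure ?m UNIV = ennreal t + ennreal (1 - t)"
    using em[of UNIV] \<mu>.emeasure_space_1 \<nu>.emeasure_space_1 prob_measuresD(4)[OF \<mu>] prob_measuresD(4)[OF \<nu>] by simp
  also have "\<dots> = 1" using t by (simp flip: ennreal_plus)
  finally show pm: "?m \<in> prob_measures"
    by (auto simp: prob_measures_def sm spm intro!: prob_spaceI)
  have nn: "(\<integral>\<^sup>+x. u x \<partial>?m) = ennreal t * (\<integral>\<^sup>+x. u x \<partial>\<mu>) + ennreal (1 - t) * (\<integral>\<^sup>+x. u x \<partial>\<nu>)"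
    if "u \<in> borel_measurable borel" for u
    using that
  proof (induction rule: borel_measurable_induct)
    case (cong f g)
    then have "f = g" by auto
    with cong show ?case by simp
  next
    case (set A)
    then show ?case by (simp add: em s\<mu> s\<nu> sm)
  next
    case (mult u c)
    then show ?case by (simp add: nn_integral_cmult distrib_left mult.left_commute)
  next
    case (add u v)
    then show ?case by (simp add: nn_integral_add distrib_left ac_simps)
  next
    case (seq U)
    have "(\<integral>\<^sup>+x. (SUP i. U i) x \<partial>L) = (SUP i. \<integral>\<^sup>+x. U i x \<partial>L)" if L: "sets L = sets borel" for L
      unfolding SUP_apply using seq(1,3)
      by (intro nn_integral_monotone_convergence_SUP) (auto simp: measurable_cong_sets[OF L refl])
    note sup = this[OF sm] this[OF s\<mu>] this[OF s\<nu>]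
    have inc: "incseq (\<lambda>i. \<integral>\<^sup>+x. U i x \<partial>L)" for L
      using seq(3) by (auto simp: incseq_def le_fun_def intro!: nn_integral_mono)
    show ?case unfolding sup seq.IH
      by (subst ennreal_SUP_add) (auto simp: SUP_mult_left_ennreal intro!: incseq_SucI mult_left_mono incseq_SucD[OF inc])
  qed
  show "(\<integral>x. f x \<partial>?m) = t * (\<integral>x. f x \<partial>\<mu>) + (1 - t) * (\<integral>x. f x \<partial>\<nu>)" if f: "f \<in> bcont" for f
  proof -
    obtain K where K: "\<And>x. \<bar>f x\<bar> \<le> K" using bcontE[OF f] by metis
    have pos: "0 \<le> f x + K" for x using abs_le_D2[OF K[of x]] by simp
    have eq: "(\<integral>\<^sup>+x. ennreal (f x + K) \<partial>L) = ennreal ((\<integral>x. f x \<partial>L) + K)" "0 \<le> (\<integral>x. f x \<partial>L) + K"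
      if L: "L \<in> prob_measures" for L
    proof -
      interpret L: prob_space L using L by (rule prob_measuresD)
      have int: "integrable L f" by (rule integrable_bcont[OF L f])
      have I: "(\<integral>x. f x + K \<partial>L) = (\<integral>x. f x \<partial>L) + K" using int by (simp add: L.prob_space)
      have "0 \<le> (\<integral>x. f x + K \<partial>L)" using pos by (intro Bochner_Integration.integral_nonneg) auto
      then show "0 \<le> (\<integral>x. f x \<partial>L) + K" unfolding I .
      show "(\<integral>\<^sup>+x. ennreal (f x + K) \<partial>L) = ennreal ((\<integral>x. f x \<partial>L) + K)"
        unfolding I[symmetric] using int pos by (intro nn_integral_eq_integral) auto
    qed
    have "ennreal ((\<integral>x. f x \<partial>?m) + K)
        = ennreal t * ennreal ((\<integral>x. f x \<partial>\<mu>) + K) + ennreal (1 - t) * ennreal ((\<integral>x. f x \<partial>\<nu>) + K)"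
      unfolding eq(1)[OF pm, symmetric] eq(1)[OF \<mu>, symmetric] eq(1)[OF \<nu>, symmetric]
      using bcont_measurable[OF f] by (intro nn) auto
    also have "\<dots> = ennreal (t * ((\<integral>x. f x \<partial>\<mu>) + K) + (1 - t) * ((\<integral>x. f x \<partial>\<nu>) + K))"
      using t eq(2)[OF \<mu>] eq(2)[OF \<nu>] by (simp add: ennreal_mult)
    finally have "(\<integral>x. f x \<partial>?m) + K = t * ((\<integral>x. f x \<partial>\<mu>) + K) + (1 - t) * ((\<integral>x. f x \<partial>\<nu>) + K)"
      using t eq(2)[OF \<mu>] eq(2)[OF \<nu>] eq(2)[OF pm] by (subst (asm) ennreal_inj) auto
    then show ?thesis by (simp add: algebra_simps)
  qed
qed

text \<open>A supremum of functions that are affine in \<open>\<mu>\<close> is convex.\<close>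

lemma convex_rate_relative_entropy: "convex_rate (\<lambda>\<mu>. relative_entropy \<mu> std_gauss)"
  unfolding convex_rate_def
proof (intro ballI)
  fix \<mu> \<nu> t assume \<mu>: "\<mu> \<in> prob_measures" and \<nu>: "\<nu> \<in> prob_measures" and "t \<in> {0..1::real}"
  then have t: "0 \<le> t" "t \<le> 1" by auto
  let ?I = "\<lambda>\<mu>. relative_entropy \<mu> std_gauss"
  show "?I (mixture t \<mu> \<nu>) \<le> ereal t * ?I \<mu> + ereal (1 - t) * ?I \<nu>"
  proof (rule ccontr)
    assume "\<not> ?thesis"
    then obtain a where a: "ereal t * ?I \<mu> + ereal (1 - t) * ?I \<nu> < ereal a" "ereal a < ?I (mixture t \<mu> \<nu>)"
      using ereal_dense2 by (auto simp: not_le)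
    obtain f where f: "f \<in> bcont" "a < (\<integral>x. f x \<partial>mixture t \<mu> \<nu>) - log_laplace f"
      using donsker_varadhan_ge[OF mixture_prob_measures[OF \<mu> \<nu> t] a(2)] by blast
    have "a < t * ((\<integral>x. f x \<partial>\<mu>) - log_laplace f) + (1 - t) * ((\<integral>x. f x \<partial>\<nu>) - log_laplace f)"
      using f(2) unfolding integral_mixture[OF \<mu> \<nu> t f(1)] by (simp add: algebra_simps)
    then have "ereal a < ereal t * ereal ((\<integral>x. f x \<partial>\<mu>) - log_laplace f) + ereal (1 - t) * ereal ((\<integral>x. f x \<partial>\<nu>) - log_laplace f)"
      by simp
    also have "\<dots> \<le> ereal t * ?I \<mu> + ereal (1 - t) * ?I \<nu>"
      using t by (intro add_mono ereal_mult_left_mono donsker_varadhan_le \<mu> \<nu> f(1)) auto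
    finally show False using a(1) by simp
  qed
qed

section \<open>From Laplace functionals to large deviations\<close>

lemma exp_le_quadratic:
  fixes x :: real
  assumes "\<bar>x\<bar> \<le> 1"
  shows "exp x \<le> 1 + x + x\<^sup>2"
proof (cases "0 \<le> x")
  case True
  then show ?thesis using assms by (intro exp_bound) auto
next
  case False
  define y where "y = - x"
  have y: "0 \<le> y" using False by (simp add: y_def)
  have "1 \<le> 1 + y ^ 3" using y by simp
  also have "1 + y ^ 3 = (1 - y + y\<^sup>2) * (1 + y)" by (simp add: power2_eq_square power3_eq_cube algebra_simps)
  also have "\<dots> \<le> (1 - y + y\<^sup>2) * exp y"
  proof (rule mult_left_mono)
    have "0 \<le> (y - 1 / 2)\<^sup>2 + 3 / 4" by simp
    then show "0 \<le> 1 - y + y\<^sup>2" by (simp add: power2_diff power2_eq_square algebra_simps)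
  qed (rule exp_ge_add_one_self)
  finally show ?thesis by (simp add: y_def exp_minus field_simps)
qed

text \<open>The derivative of \<open>log_laplace\<close> at \<open>f\<close> in direction \<open>g\<close> is the integral of \<open>g\<close> with respect to
  \<open>tilted f\<close>. This is a bound for the remainder of second order.\<close>

lemma log_laplace_perturbation:
  assumes f: "f \<in> bcont" and g: "g \<in> bcont" and K: "\<And>x. \<bar>g x\<bar> \<le> K" and t: "0 \<le> t" "t * K \<le> 1"
  shows "log_laplace (\<lambda>x. f x + t * g x) \<le> log_laplace f + t * (\<integral>x. g x \<partial>tilted f) + t\<^sup>2 * K\<^sup>2"
proof -
  obtain L where L: "\<And>x. \<bar>f x\<bar> \<le> L" using bcontE[OF f] by metis
  note fm = bcont_measurable[OF f] and gm = bcont_measurable[OF g]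
  note [measurable] = fm gm
  have pm: "tilted f \<in> prob_measures" by (rule tilted_prob_measures[OF fm L])
  interpret T: prob_space "tilted f" by (rule prob_measuresD[OF pm])
  have fg: "(\<lambda>x. f x + t * g x) \<in> bcont" using bcont_linear[OF f g, of 1 t] by simp
  obtain M where M: "\<And>x. \<bar>f x + t * g x\<bar> \<le> M" using bcontE[OF fg] by metis
  have tg: "\<bar>t * g x\<bar> \<le> 1" for x
  proof -
    have "\<bar>t * g x\<bar> \<le> t * K" using t K[of x] by (simp add: abs_mult mult_left_mono)
    then show ?thesis using t by linarith
  qed
  have int_g: "integrable (tilted f) g" by (rule integrable_bcont[OF pm g])
  have int_exp: "integrable (tilted f) (\<lambda>x. exp (t * g x))"
  proof (rule integrable_bounded_prob[OF pm])
    show "\<bar>exp (t * g x)\<bar> \<le> exp 1" for x using abs_le_D1[OF tg[of x]] by simp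
  qed measurable
  have "exp (log_laplace (\<lambda>x. f x + t * g x)) = (\<integral>x. exp (t * g x) * exp (f x) \<partial>std_gauss)"
    by (subst exp_log_laplace[OF bcont_measurable[OF fg] M]) (simp add: exp_add mult.commute)
  also have "\<dots> = exp (log_laplace f) * (\<integral>x. exp (t * g x) \<partial>tilted f)"
    by (subst integral_tilted[OF fm L]) auto
  also have "(\<integral>x. exp (t * g x) \<partial>tilted f) \<le> (\<integral>x. 1 + t * g x + t\<^sup>2 * K\<^sup>2 \<partial>tilted f)"
  proof (rule integral_mono)
    fix x
    have "(t * g x)\<^sup>2 \<le> t\<^sup>2 * K\<^sup>2"
      unfolding power_mult_distrib using K[of x] by (intro mult_left_mono) (auto simp: abs_le_square_iff[symmetric])
    then show "exp (t * g x) \<le> 1 + t * g x + t\<^sup>2 * K\<^sup>2" using exp_le_quadratic[OF tg[of x]] by linarith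
  qed (use int_g int_exp in auto)
  also have "\<dots> = 1 + (t * (\<integral>x. g x \<partial>tilted f) + t\<^sup>2 * K\<^sup>2)" using int_g by (simp add: T.prob_space)
  also have "\<dots> \<le> exp (t * (\<integral>x. g x \<partial>tilted f) + t\<^sup>2 * K\<^sup>2)" by (rule exp_ge_add_one_self)
  finally have "exp (log_laplace (\<lambda>x. f x + t * g x)) \<le> exp (log_laplace f) * exp (t * (\<integral>x. g x \<partial>tilted f) + t\<^sup>2 * K\<^sup>2)"
    by simp
  then show ?thesis by (simp add: exp_add[symmetric])
qed

lemma log_ereal_le:
  assumes s: "0 < s" and p: "p \<le> exp (- s * a)"
  shows "ereal (1 / s) * log_ereal p \<le> ereal (- a)"
proof (cases "p \<le> 0")
  case True
  then show ?thesis using s by (simp add: log_ereal_def)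
next
  case False
  then have "ln p \<le> ln (exp (- s * a))" using p by (subst ln_le_cancel_iff) auto
  then have "1 / s * ln p \<le> - a" using s by (simp add: field_simps)
  then show ?thesis using False by (simp add: log_ereal_def)
qed

lemma log_ereal_ge:
  assumes s: "0 < s" and p: "exp (- s * a) \<le> p"
  shows "ereal (- a) \<le> ereal (1 / s) * log_ereal p"
proof -
  have p0: "0 < p" using p by (rule less_le_trans[rotated]) simp
  then have "ln (exp (- s * a)) \<le> ln p" using p by (subst ln_le_cancel_iff) auto
  then have "- a \<le> 1 / s * ln p" using s by (simp add: field_simps)
  then show ?thesis using p0 by (simp add: log_ereal_def)
qed

text \<open>Random measures with the Laplace functionals of independent Gaussian samples and with exponentially
  tight second moments. Nothing else about the block matters for the large deviations.\<close>

locale laplace_ldp =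
  fixes M :: "nat \<Rightarrow> 'w measure" and Y :: "nat \<Rightarrow> 'w \<Rightarrow> real measure" and s :: "nat \<Rightarrow> real"
  assumes prob: "\<And>N. prob_space (M N)"
    and meas: "\<forall>\<^sub>F N in sequentially. Y N \<in> M N \<rightarrow>\<^sub>M sigma (topspace weak_topology) {U. openin weak_topology U}"
    and speed: "filterlim s at_top sequentially"
    and laplace: "\<And>f. f \<in> bcont \<Longrightarrow>
      (\<lambda>N. ln (\<integral>\<omega>. exp (s N * (\<integral>x. f x \<partial>Y N \<omega>)) \<partial>M N) / s N) \<longlonglongrightarrow> log_laplace f"
    and tight: "\<And>\<Lambda>. 0 \<le> \<Lambda> \<Longrightarrow> \<exists>C. \<forall>\<^sub>F N in sequentially.
      measure (M N) {\<omega> \<in> space (M N). Y N \<omega> \<notin> moment_set C} \<le> exp (- \<Lambda> * s N)"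
begin

text \<open>Measurability and a positive speed are only available for all large \<open>N\<close>.\<close>

definition good :: "nat \<Rightarrow> bool" where
  "good N \<longleftrightarrow> 0 < s N \<and> Y N \<in> M N \<rightarrow>\<^sub>M sigma (topspace weak_topology) {U. openin weak_topology U}"

abbreviation pr :: "nat \<Rightarrow> real measure set \<Rightarrow> real" where
  "pr N V \<equiv> measure (M N) {\<omega> \<in> space (M N). Y N \<omega> \<in> V}"

abbreviation moment :: "nat \<Rightarrow> (real \<Rightarrow> real) \<Rightarrow> real" where
  "moment N f \<equiv> \<integral>\<omega>. exp (s N * (\<integral>x. f x \<partial>Y N \<omega>)) \<partial>M N"

lemma eventually_good: "\<forall>\<^sub>F N in sequentially. good N"
proof -
  have "\<forall>\<^sub>F N in sequentially. 0 < s N"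
    using speed unfolding filterlim_at_top_dense by blast
  with meas show ?thesis by eventually_elim (simp add: good_def)
qed

lemma eventually_speed_ge: "0 < c \<Longrightarrow> \<forall>\<^sub>F N in sequentially. B \<le> c * s N"
proof -
  assume c: "0 < c"
  have "\<forall>\<^sub>F N in sequentially. B / c \<le> s N" using speed unfolding filterlim_at_top by blast
  then show ?thesis by eventually_elim (use c in \<open>simp add: field_simps\<close>)
qed

lemma good_prob_measures:
  assumes "good N" "\<omega> \<in> space (M N)"
  shows "Y N \<omega> \<in> prob_measures"
proof -
  have "Y N \<in> M N \<rightarrow>\<^sub>M sigma (topspace weak_topology) {U. openin weak_topology U}"
    using assms(1) by (simp only: good_def)
  from measurable_space[OF this assms(2)] show ?thesis
    by (simp only: space_measure_of_conv topspace_weak_topology)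
qed

lemma good_open:
  assumes "good N" "openin weak_topology V"
  shows "{\<omega> \<in> space (M N). Y N \<omega> \<in> V} \<in> sets (M N)"
proof -
  have "V \<in> sets (sigma (topspace weak_topology) {U. openin weak_topology U})"
  proof (subst sets_measure_of)
    show "{U. openin weak_topology U} \<subseteq> Pow (topspace weak_topology)"
      using openin_subset by blast
    show "V \<in> sigma_sets (topspace weak_topology) {U. openin weak_topology U}"
      using assms(2) by (intro sigma_sets.Basic) simp
  qed
  moreover have "Y N \<in> M N \<rightarrow>\<^sub>M sigma (topspace weak_topology) {U. openin weak_topology U}"
    using assms(1) by (simp only: good_def)
  ultimately have "Y N -` V \<inter> space (M N) \<in> sets (M N)" by (rule measurable_sets[rotated])
  also have "Y N -` V \<inter> space (M N) = {\<omega> \<in> space (M N). Y N \<omega> \<in> V}" by auto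
  finally show ?thesis .
qed

lemma good_closed:
  assumes "good N" "closedin weak_topology V"
  shows "{\<omega> \<in> space (M N). Y N \<omega> \<in> V} \<in> sets (M N)"
proof -
  have "{\<omega> \<in> space (M N). Y N \<omega> \<in> V}
      = space (M N) - {\<omega> \<in> space (M N). Y N \<omega> \<in> topspace weak_topology - V}"
    using good_prob_measures[OF assms(1)] by auto
  moreover have "openin weak_topology (topspace weak_topology - V)"
    using assms(2) by (simp only: closedin_def)
  ultimately show ?thesis by (simp only: sets.compl_sets[OF good_open[OF assms(1)]])
qed

lemma good_integral:
  assumes "good N" "f \<in> bcont"
  shows "(\<lambda>\<omega>. \<integral>x. f x \<partial>Y N \<omega>) \<in> borel_measurable (M N)"
proof (rule borel_measurableI)
  fix V :: "real set" assume "open V"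
  then have "{\<omega> \<in> space (M N). Y N \<omega> \<in> {\<mu> \<in> prob_measures. (\<integral>x. f x \<partial>\<mu>) \<in> V}} \<in> sets (M N)"
    by (rule good_open[OF assms(1) openin_weak_integral[OF assms(2)]])
  also have "{\<omega> \<in> space (M N). Y N \<omega> \<in> {\<mu> \<in> prob_measures. (\<integral>x. f x \<partial>\<mu>) \<in> V}}
      = (\<lambda>\<omega>. \<integral>x. f x \<partial>Y N \<omega>) -` V \<inter> space (M N)"
    using good_prob_measures[OF assms(1)] by auto
  finally show "(\<lambda>\<omega>. \<integral>x. f x \<partial>Y N \<omega>) -` V \<inter> space (M N) \<in> sets (M N)" .
qed

lemma abs_integral_le:
  assumes "\<mu> \<in> prob_measures" "f \<in> bcont" "\<And>x. \<bar>f x\<bar> \<le> K"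
  shows "\<bar>\<integral>x. f x \<partial>\<mu>\<bar> \<le> K"
proof -
  interpret prob_space \<mu> using assms by (simp add: prob_measuresD)
  have int: "integrable \<mu> f" by (rule integrable_bcont[OF assms(1,2)])
  have "\<And>x. f x \<le> K" "\<And>x. - K \<le> f x" using assms(3) by (auto simp: abs_le_iff minus_le_iff)
  then show ?thesis
    using integral_le_const[OF int, of K] integral_ge_const[OF int, of "- K"] by (simp add: abs_le_iff)
qed

lemma good_integrable_exp:
  assumes "good N" "f \<in> bcont"
  shows "integrable (M N) (\<lambda>\<omega>. exp (s N * (\<integral>x. f x \<partial>Y N \<omega>)))"
proof -
  interpret prob_space "M N" by (rule prob)
  obtain K where K: "\<And>x. \<bar>f x\<bar> \<le> K" using bcontE[OF assms(2)] by metis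
  have [measurable]: "(\<lambda>\<omega>. \<integral>x. f x \<partial>Y N \<omega>) \<in> borel_measurable (M N)" by (rule good_integral[OF assms])
  show ?thesis
  proof (rule integrable_const_bound[of _ "exp (s N * K)"])
    have "(\<integral>x. f x \<partial>Y N \<omega>) \<le> K" if "\<omega> \<in> space (M N)" for \<omega>
      using abs_integral_le[OF good_prob_measures[OF assms(1) that] assms(2) K] by (simp add: abs_le_iff)
    then show "AE \<omega> in M N. norm (exp (s N * (\<integral>x. f x \<partial>Y N \<omega>))) \<le> exp (s N * K)"
      using assms(1) by (auto simp: good_def)
  qed measurable
qed

lemma moment_pos:
  assumes "good N" "f \<in> bcont"
  shows "0 < moment N f"
proof -
  interpret prob_space "M N" by (rule prob)
  have "0 \<le> moment N f" by (intro Bochner_Integration.integral_nonneg) simp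
  moreover have "moment N f \<noteq> 0"
    using integral_nonneg_eq_0_iff_AE[OF good_integrable_exp[OF assms]] by simp
  ultimately show ?thesis by (auto simp: less_le)
qed

lemma eventually_moment_le:
  assumes f: "f \<in> bcont" and b: "log_laplace f < b"
  shows "\<forall>\<^sub>F N in sequentially. moment N f \<le> exp (s N * b)"
proof -
  have "\<forall>\<^sub>F N in sequentially. ln (moment N f) / s N < b"
    using laplace[OF f] b by (rule order_tendstoD)
  with eventually_good show ?thesis
  proof eventually_elim
    case (elim N)
    then have "ln (moment N f) < s N * b" by (simp add: good_def field_simps)
    then have "exp (ln (moment N f)) \<le> exp (s N * b)" by simp
    then show ?case using moment_pos[OF elim(1) f] by simp
  qed
qed

lemma eventually_moment_ge:
  assumes f: "f \<in> bcont" and b: "b < log_laplace f"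
  shows "\<forall>\<^sub>F N in sequentially. exp (s N * b) \<le> moment N f"
proof -
  have "\<forall>\<^sub>F N in sequentially. b < ln (moment N f) / s N"
    using laplace[OF f] b by (rule order_tendstoD)
  with eventually_good show ?thesis
  proof eventually_elim
    case (elim N)
    then have "s N * b < ln (moment N f)" by (simp add: good_def field_simps)
    then have "exp (s N * b) \<le> exp (ln (moment N f))" by simp
    then show ?case using moment_pos[OF elim(1) f] by simp
  qed
qed

text \<open>The variational formula provides a half space that contains \<open>\<mu>\<close> and on which the exponential
  Chebyshev inequality gives the rate \<open>a\<close>.\<close>

lemma local_upper_bound:
  assumes \<mu>: "\<mu> \<in> prob_measures" and a: "ereal a < relative_entropy \<mu> std_gauss"
  shows "\<exists>V. openin weak_topology V \<and> \<mu> \<in> V \<and> (\<forall>\<^sub>F N in sequentially. pr N V \<le> exp (- s N * a))"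
proof -
  obtain f where f: "f \<in> bcont" "a < (\<integral>x. f x \<partial>\<mu>) - log_laplace f"
    using donsker_varadhan_ge[OF assms] by blast
  have "log_laplace f + a < (\<integral>x. f x \<partial>\<mu>)" using f(2) by simp
  then obtain b where b: "log_laplace f + a < b" "b < (\<integral>x. f x \<partial>\<mu>)" using dense by blast
  define V where "V = {\<mu> \<in> prob_measures. (\<integral>x. f x \<partial>\<mu>) \<in> {b<..}}"
  have V: "openin weak_topology V" unfolding V_def by (rule openin_weak_integral[OF f(1)]) simp
  have "\<forall>\<^sub>F N in sequentially. moment N f \<le> exp (s N * (b - a))"
    using b by (intro eventually_moment_le[OF f(1)]) simp
  with eventually_good have "\<forall>\<^sub>F N in sequentially. pr N V \<le> exp (- s N * a)"
  proof eventually_elim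
    case (elim N)
    interpret prob_space "M N" by (rule prob)
    let ?A = "{\<omega> \<in> space (M N). Y N \<omega> \<in> V}"
    note A = good_open[OF elim(1) V]
    have "exp (s N * b) * pr N V = (\<integral>\<omega>. exp (s N * b) * indicator ?A \<omega> \<partial>M N)" using A by simp
    also have "\<dots> \<le> moment N f"
    proof (rule integral_mono)
      show "integrable (M N) (\<lambda>\<omega>. exp (s N * b) * indicator ?A \<omega>)" using A by (simp add: emeasure_eq_measure)
      show "exp (s N * b) * indicator ?A \<omega> \<le> exp (s N * (\<integral>x. f x \<partial>Y N \<omega>))" for \<omega>
        using elim(1) by (auto simp: indicator_def V_def good_def)
    qed (rule good_integrable_exp[OF elim(1) f(1)])
    also note elim(2)
    also have "exp (s N * (b - a)) = exp (s N * b) * exp (- s N * a)"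
      by (simp add: exp_add[symmetric] algebra_simps)
    finally show ?case by simp
  qed
  moreover have "\<mu> \<in> V" using \<mu> b by (simp add: V_def)
  ultimately show ?thesis using V by blast
qed

lemma closedin_moment_set: "closedin weak_topology (moment_set C)"
proof -
  have "moment_set C = (\<Inter>n::nat. {\<mu> \<in> prob_measures. (\<integral>x. min (x\<^sup>2) (real n) \<partial>\<mu>) \<le> C})"
    by (auto simp: moment_set_def)
  moreover have "closedin weak_topology \<dots>"
    by (intro closedin_INT closedin_weak_integral_le bcont_truncated_square) auto
  ultimately show ?thesis by simp
qed

text \<open>The complement of a large moment set is negligible. The remaining part of the closed set is compact
  and covered by finitely many of the neighbourhoods with rate \<open>b > a\<close>; their number is absorbed by the
  difference of \<open>b\<close> and \<open>a\<close>.\<close>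

lemma eventually_upper_bound:
  assumes C: "closedin weak_topology C" and a: "ereal a < (INF \<mu>\<in>C. relative_entropy \<mu> std_gauss)"
  shows "\<forall>\<^sub>F N in sequentially. pr N C \<le> exp (- s N * a)"
proof -
  obtain b where b: "a < b" "ereal b < (INF \<mu>\<in>C. relative_entropy \<mu> std_gauss)"
    using ereal_dense2[OF a] by auto
  obtain R where R: "\<forall>\<^sub>F N in sequentially.
      measure (M N) {\<omega> \<in> space (M N). Y N \<omega> \<notin> moment_set R} \<le> exp (- max b 0 * s N)"
    using tight[of "max b 0"] by auto
  define K where "K = C \<inter> moment_set R"
  have K: "compactin weak_topology K"
    unfolding K_def by (rule closed_Int_compactin[OF C compactin_moment_set])
  have "\<exists>V. openin weak_topology V \<and> \<mu> \<in> V \<and> (\<forall>\<^sub>F N in sequentially. pr N V \<le> exp (- s N * b))" if "\<mu> \<in> K" for \<mu>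
  proof (rule local_upper_bound)
    show "\<mu> \<in> prob_measures" using that by (simp add: K_def moment_set_def)
    show "ereal b < relative_entropy \<mu> std_gauss"
      using that by (intro less_le_trans[OF b(2)] INF_lower) (simp add: K_def)
  qed
  then have "\<exists>V. \<forall>\<mu>\<in>K. openin weak_topology (V \<mu>) \<and> \<mu> \<in> V \<mu> \<and> (\<forall>\<^sub>F N in sequentially. pr N (V \<mu>) \<le> exp (- s N * b))"
    by (intro bchoice) blast
  then obtain V where V: "\<And>\<mu>. \<mu> \<in> K \<Longrightarrow> openin weak_topology (V \<mu>)" "\<And>\<mu>. \<mu> \<in> K \<Longrightarrow> \<mu> \<in> V \<mu>"
    "\<And>\<mu>. \<mu> \<in> K \<Longrightarrow> \<forall>\<^sub>F N in sequentially. pr N (V \<mu>) \<le> exp (- s N * b)" by blast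
  have "\<exists>\<F>. finite \<F> \<and> \<F> \<subseteq> V ` K \<and> K \<subseteq> \<Union>\<F>"
  proof (rule compactinD[OF K])
    show "openin weak_topology W" if "W \<in> V ` K" for W using that V(1) by blast
    show "K \<subseteq> \<Union>(V ` K)" using V(2) by blast
  qed
  then obtain \<F> where \<F>: "finite \<F>" "\<F> \<subseteq> V ` K" "K \<subseteq> \<Union>\<F>" by blast
  obtain F where F0: "F \<subseteq> K" "finite F" "\<F> = V ` F" using finite_subset_image[OF \<F>(1,2)] by blast
  have F: "finite F" "F \<subseteq> K" "K \<subseteq> (\<Union>\<mu>\<in>F. V \<mu>)" using F0 \<F>(3) by simp_all
  have "\<forall>\<^sub>F N in sequentially. \<forall>\<mu>\<in>F. pr N (V \<mu>) \<le> exp (- s N * b)"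
    using F V(3) by (intro eventually_ball_finite) auto
  moreover have "\<forall>\<^sub>F N in sequentially. ln (1 + real (card F)) \<le> (b - a) * s N"
    using b by (intro eventually_speed_ge) simp
  ultimately show ?thesis using eventually_good R
  proof eventually_elim
    case (elim N)
    interpret prob_space "M N" by (rule prob)
    let ?E = "\<lambda>V. {\<omega> \<in> space (M N). Y N \<omega> \<in> V}" and ?T = "{\<omega> \<in> space (M N). Y N \<omega> \<notin> moment_set R}"
    have s: "0 < s N" using elim(3) by (simp add: good_def)
    have "?T = space (M N) - ?E (moment_set R)" by auto
    then have T: "?T \<in> sets (M N)"
      by (simp only: sets.compl_sets[OF good_closed[OF elim(3) closedin_moment_set]])
    have EV: "?E (V \<mu>) \<in> sets (M N)" if "\<mu> \<in> F" for \<mu>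
      using that F(2) by (intro good_open[OF elim(3)] V(1)) auto
    have "pr N C \<le> measure (M N) (?T \<union> (\<Union>\<mu>\<in>F. ?E (V \<mu>)))"
    proof (rule finite_measure_mono)
      show "?E C \<subseteq> ?T \<union> (\<Union>\<mu>\<in>F. ?E (V \<mu>))" using F(3) by (auto simp: K_def)
    qed (use T EV F(1) in auto)
    also have "\<dots> \<le> measure (M N) ?T + measure (M N) (\<Union>\<mu>\<in>F. ?E (V \<mu>))"
      using T EV F(1) by (intro measure_Un_le) auto
    also have "\<dots> \<le> exp (- s N * b) + (\<Sum>\<mu>\<in>F. exp (- s N * b))"
    proof (rule add_mono)
      have "- max b 0 * s N \<le> - s N * b" using s by (simp add: mult.commute mult_left_mono)
      then show "measure (M N) ?T \<le> exp (- s N * b)" using elim(4) by (meson exp_le_cancel_iff order_trans)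
      have "measure (M N) (\<Union>\<mu>\<in>F. ?E (V \<mu>)) \<le> (\<Sum>\<mu>\<in>F. pr N (V \<mu>))"
        using EV F(1) by (intro finite_measure_subadditive_finite) auto
      also have "\<dots> \<le> (\<Sum>\<mu>\<in>F. exp (- s N * b))" using elim(1) by (intro sum_mono) auto
      finally show "measure (M N) (\<Union>\<mu>\<in>F. ?E (V \<mu>)) \<le> (\<Sum>\<mu>\<in>F. exp (- s N * b))" .
    qed
    also have "\<dots> = (1 + real (card F)) * exp (- s N * b)" by (simp add: distrib_right)
    also have "\<dots> \<le> exp ((b - a) * s N) * exp (- s N * b)"
    proof (rule mult_right_mono)
      have "1 + real (card F) = exp (ln (1 + real (card F)))" by (rule exp_ln[symmetric]) simp
      also have "\<dots> \<le> exp ((b - a) * s N)" using elim(2) by (simp only: exp_le_cancel_iff)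
      finally show "1 + real (card F) \<le> exp ((b - a) * s N)" .
    qed simp
    also have "\<dots> = exp (- s N * a)" by (simp add: exp_add[symmetric] algebra_simps)
    finally show ?case .
  qed
qed

lemma upper_bound:
  assumes C: "closedin weak_topology C"
  shows "limsup (\<lambda>N. ereal (1 / s N) * log_ereal (pr N C)) \<le> - (INF \<mu>\<in>C. relative_entropy \<mu> std_gauss)"
    (is "?L \<le> - ?I")
proof (rule ccontr)
  assume "\<not> ?L \<le> - ?I"
  then have "- ?L < ?I" by (simp add: ereal_uminus_less_reorder not_le)
  then obtain a where a: "- ?L < ereal a" "ereal a < ?I" using ereal_dense2 by blast
  have "?L \<le> ereal (- a)"
    by (rule Limsup_bounded)
       (use eventually_upper_bound[OF C a(2)] eventually_good in \<open>eventually_elim, auto simp: good_def intro!: log_ereal_le\<close>)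
  moreover have "ereal (- a) < ?L" using a(1) by (simp add: ereal_uminus_less_reorder)
  ultimately show False by simp
qed

text \<open>Under the law reweighted by \<open>exp (s N * \<integral> f d\<nu>)\<close> the integral of \<open>g\<close> is unlikely to exceed its value
  for \<open>tilted f\<close> by \<open>\<delta>\<close>. This is the exponential Chebyshev inequality with the parameter \<open>t\<close>: the gain is
  \<open>t * \<delta>\<close>, whereas the exponential moment exceeds its linear part by \<open>t\<^sup>2 * K\<^sup>2 \<le> t * \<delta> / 2\<close> at most.\<close>

lemma tilted_concentration:
  assumes f: "f \<in> bcont" and g: "g \<in> bcont" and \<delta>: "0 < \<delta>"
  shows "\<exists>c>0. \<forall>\<^sub>F N in sequentially.
    (\<integral>\<omega>. exp (s N * (\<integral>x. f x \<partial>Y N \<omega>)) * indicator {\<omega> \<in> space (M N). (\<integral>x. g x \<partial>tilted f) + \<delta> \<le> (\<integral>x. g x \<partial>Y N \<omega>)} \<omega> \<partial>M N)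
      \<le> exp (- c * s N) * moment N f"
proof -
  obtain K where K: "0 < K" "\<And>x. \<bar>g x\<bar> \<le> K" using bcontE[OF g] by metis
  define m where "m = (\<integral>x. g x \<partial>tilted f)"
  define t where "t = min (1 / K) (\<delta> / (2 * K\<^sup>2))"
  have t: "0 < t" "t * K \<le> 1" "t * K\<^sup>2 \<le> \<delta> / 2"
  proof -
    show "0 < t" using K \<delta> by (simp add: t_def)
    have "t \<le> 1 / K" "t \<le> \<delta> / (2 * K\<^sup>2)" by (auto simp: t_def)
    then show "t * K \<le> 1" "t * K\<^sup>2 \<le> \<delta> / 2" using K by (auto simp: field_simps)
  qed
  define h where "h = (\<lambda>x. f x + t * g x)"
  have h: "h \<in> bcont" using bcont_linear[OF f g, of 1 t] by (simp add: h_def)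
  \<comment> \<open>Of the gain of \<open>8 * e\<close>, the second order term takes \<open>4 * e\<close> and the two approximations of
    moments by their limits take \<open>e\<close> each; a rate of \<open>2 * e\<close> remains.\<close>
  define e where "e = t * \<delta> / 8"
  have e: "0 < e" using t \<delta> by (simp add: e_def)
  have "log_laplace h \<le> log_laplace f + t * m + t\<^sup>2 * K\<^sup>2"
    unfolding h_def m_def using t by (intro log_laplace_perturbation[OF f g K(2)]) auto
  also have "t\<^sup>2 * K\<^sup>2 = t * (t * K\<^sup>2)" by (simp add: power2_eq_square)
  also have "\<dots> \<le> t * (\<delta> / 2)" using t by (intro mult_left_mono) auto
  finally have Lh: "log_laplace h < log_laplace f + t * m + 5 * e" using e by (simp add: e_def)
  have "\<forall>\<^sub>F N in sequentially. moment N h \<le> exp (s N * (log_laplace f + t * m + 5 * e))"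
    by (rule eventually_moment_le[OF h Lh])
  moreover have "\<forall>\<^sub>F N in sequentially. exp (s N * (log_laplace f - e)) \<le> moment N f"
    using e by (intro eventually_moment_ge[OF f]) simp
  ultimately have "\<forall>\<^sub>F N in sequentially.
    (\<integral>\<omega>. exp (s N * (\<integral>x. f x \<partial>Y N \<omega>)) * indicator {\<omega> \<in> space (M N). m + \<delta> \<le> (\<integral>x. g x \<partial>Y N \<omega>)} \<omega> \<partial>M N)
      \<le> exp (- (2 * e) * s N) * moment N f"
    using eventually_good
  proof eventually_elim
    case (elim N)
    interpret prob_space "M N" by (rule prob)
    let ?A = "{\<omega> \<in> space (M N). m + \<delta> \<le> (\<integral>x. g x \<partial>Y N \<omega>)}"
    have s: "0 < s N" using elim(3) by (simp add: good_def)
    have [measurable]: "(\<lambda>\<omega>. \<integral>x. g x \<partial>Y N \<omega>) \<in> borel_measurable (M N)" by (rule good_integral[OF elim(3) g])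
    have A: "?A \<in> sets (M N)" by measurable
    have "(\<integral>\<omega>. exp (s N * (\<integral>x. f x \<partial>Y N \<omega>)) * indicator ?A \<omega> \<partial>M N)
        \<le> (\<integral>\<omega>. exp (- s N * t * (m + \<delta>)) * exp (s N * (\<integral>x. h x \<partial>Y N \<omega>)) \<partial>M N)"
    proof (rule integral_mono)
      show "integrable (M N) (\<lambda>\<omega>. exp (s N * (\<integral>x. f x \<partial>Y N \<omega>)) * indicator ?A \<omega>)"
        using integrable_mult_indicator[OF A good_integrable_exp[OF elim(3) f]] by (simp add: mult.commute)
      show "integrable (M N) (\<lambda>\<omega>. exp (- s N * t * (m + \<delta>)) * exp (s N * (\<integral>x. h x \<partial>Y N \<omega>)))"
        using good_integrable_exp[OF elim(3) h] by simp
      fix \<omega> assume \<omega>: "\<omega> \<in> space (M N)"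
      show "exp (s N * (\<integral>x. f x \<partial>Y N \<omega>)) * indicator ?A \<omega> \<le> exp (- s N * t * (m + \<delta>)) * exp (s N * (\<integral>x. h x \<partial>Y N \<omega>))"
      proof (cases "\<omega> \<in> ?A")
        case True
        note pm = good_prob_measures[OF elim(3) \<omega>]
        have "(\<integral>x. h x \<partial>Y N \<omega>) = (\<integral>x. f x \<partial>Y N \<omega>) + t * (\<integral>x. g x \<partial>Y N \<omega>)"
          unfolding h_def using integrable_bcont[OF pm f] integrable_bcont[OF pm g] by simp
        moreover have "(s N * t) * (m + \<delta>) \<le> (s N * t) * (\<integral>x. g x \<partial>Y N \<omega>)"
          using True s t by (intro mult_left_mono) auto
        ultimately show ?thesis using True by (simp add: exp_add[symmetric] algebra_simps)
      qed simp
    qed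
    also have "\<dots> = exp (- s N * t * (m + \<delta>)) * moment N h" by simp
    also have "\<dots> \<le> exp (- s N * t * (m + \<delta>)) * exp (s N * (log_laplace f + t * m + 5 * e))"
      using elim(1) by simp
    also have "\<dots> = exp (- (2 * e) * s N) * exp (s N * (log_laplace f - e))"
      by (simp add: exp_add[symmetric] e_def algebra_simps)
    also have "\<dots> \<le> exp (- (2 * e) * s N) * moment N f" using elim(2) by simp
    finally show ?case .
  qed
  then show ?thesis using e by (intro exI[of _ "2 * e"]) (simp add: m_def)
qed

text \<open>At least half of the exponential moment of \<open>f\<close> comes from the event that the empirical measure is
  close to \<open>tilted f\<close>, in the integrals that define a neighbourhood inside \<open>U\<close> and in that of \<open>f\<close>.
  On this event the weight is at most \<open>exp (s N * (\<integral> f d(tilted f) + \<epsilon> / 3))\<close>, so the probability of \<open>U\<close> is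
  not smaller than the quotient.\<close>

lemma eventually_lower_bound:
  assumes f: "f \<in> bcont" and U: "openin weak_topology U" "tilted f \<in> U" and \<epsilon>: "0 < \<epsilon>"
  shows "\<forall>\<^sub>F N in sequentially. exp (- s N * ((\<integral>x. f x \<partial>tilted f) - log_laplace f + \<epsilon>)) \<le> pr N U"
proof -
  define m where "m g = (\<integral>x. g x \<partial>tilted f)" for g :: "real \<Rightarrow> real"
  obtain F \<delta>\<^sub>0 where F: "finite F" "F \<subseteq> bcont" and \<delta>0: "0 < \<delta>\<^sub>0"
    and FU: "\<And>\<nu>. \<nu> \<in> prob_measures \<Longrightarrow> (\<forall>g\<in>F. \<bar>(\<integral>x. g x \<partial>\<nu>) - m g\<bar> < \<delta>\<^sub>0) \<Longrightarrow> \<nu> \<in> U"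
    using weak_neighbourhood[OF U] unfolding m_def by auto
  define \<delta> where "\<delta> = min \<delta>\<^sub>0 (\<epsilon> / 3)"
  have \<delta>: "0 < \<delta>" "\<delta> \<le> \<delta>\<^sub>0" "\<delta> \<le> \<epsilon> / 3" using \<delta>0 \<epsilon> by (auto simp: \<delta>_def)
  \<comment> \<open>One-sided deviations of \<open>g\<close> and \<open>- g\<close> give two-sided control on \<open>F\<close>; for \<open>f\<close> itself only the
    upper bound on the weight is needed.\<close>
  define G where "G = insert f (F \<union> (\<lambda>g x. - g x) ` F)"
  have neg: "(\<lambda>x. - g x) \<in> bcont" if "g \<in> bcont" for g using bcont_linear[OF that that, of "- 1" 0] by simp
  have G: "finite G" "G \<subseteq> bcont" using F f neg by (auto simp: G_def)
  define bad where "bad N g = {\<omega> \<in> space (M N). m g + \<delta> \<le> (\<integral>x. g x \<partial>Y N \<omega>)}" for N g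
  have "\<forall>g\<in>G. \<exists>c>0. \<forall>\<^sub>F N in sequentially.
      (\<integral>\<omega>. exp (s N * (\<integral>x. f x \<partial>Y N \<omega>)) * indicator (bad N g) \<omega> \<partial>M N) \<le> exp (- c * s N) * moment N f"
    unfolding bad_def m_def using G by (intro ballI tilted_concentration[OF f _ \<delta>(1)]) auto
  from bchoice[OF this] obtain c where c: "\<And>g. g \<in> G \<Longrightarrow> 0 < c g" and bad: "\<And>g. g \<in> G \<Longrightarrow> \<forall>\<^sub>F N in sequentially.
      (\<integral>\<omega>. exp (s N * (\<integral>x. f x \<partial>Y N \<omega>)) * indicator (bad N g) \<omega> \<partial>M N) \<le> exp (- c g * s N) * moment N f"
    by blast
  have "\<forall>\<^sub>F N in sequentially. \<forall>g\<in>G.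
      (\<integral>\<omega>. exp (s N * (\<integral>x. f x \<partial>Y N \<omega>)) * indicator (bad N g) \<omega> \<partial>M N) \<le> exp (- c g * s N) * moment N f"
    using G bad by (intro eventually_ball_finite) auto
  moreover have "\<forall>\<^sub>F N in sequentially. \<forall>g\<in>G. ln (2 * card G) \<le> c g * s N"
    using G c by (intro eventually_ball_finite ballI eventually_speed_ge) auto
  moreover have "\<forall>\<^sub>F N in sequentially. ln 2 \<le> \<epsilon> / 3 * s N"
    using \<epsilon> by (intro eventually_speed_ge) simp
  moreover have "\<forall>\<^sub>F N in sequentially. exp (s N * (log_laplace f - \<epsilon> / 3)) \<le> moment N f"
    using \<epsilon> by (intro eventually_moment_ge[OF f]) simp
  ultimately show ?thesis using eventually_good
  proof eventually_elim
    case (elim N)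
    interpret prob_space "M N" by (rule prob)
    let ?e = "\<lambda>\<omega>. exp (s N * (\<integral>x. f x \<partial>Y N \<omega>))" and ?U = "{\<omega> \<in> space (M N). Y N \<omega> \<in> U}"
    have s: "0 < s N" using elim(5) by (simp add: good_def)
    note int = good_integrable_exp[OF elim(5) f]
    have U_sets: "?U \<in> sets (M N)" by (rule good_open[OF elim(5) U(1)])
    have bad_sets: "bad N g \<in> sets (M N)" if "g \<in> G" for g
    proof -
      have [measurable]: "(\<lambda>\<omega>. \<integral>x. g x \<partial>Y N \<omega>) \<in> borel_measurable (M N)"
        using that G by (intro good_integral[OF elim(5)]) auto
      show ?thesis unfolding bad_def by measurable
    qed
    have int_bad: "integrable (M N) (\<lambda>\<omega>. ?e \<omega> * indicator (bad N g) \<omega>)" if "g \<in> G" for g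
      using integrable_mult_indicator[OF bad_sets[OF that] int] by (simp add: mult.commute)
    have cover: "?e \<omega> \<le> exp (s N * (m f + \<epsilon> / 3)) * indicator ?U \<omega> + (\<Sum>g\<in>G. ?e \<omega> * indicator (bad N g) \<omega>)"
      if \<omega>: "\<omega> \<in> space (M N)" for \<omega>
    proof (cases "\<exists>g\<in>G. \<omega> \<in> bad N g")
      case True
      then obtain g where g: "g \<in> G" "\<omega> \<in> bad N g" by auto
      have "?e \<omega> = ?e \<omega> * indicator (bad N g) \<omega>" using g by simp
      also have "\<dots> \<le> (\<Sum>g\<in>G. ?e \<omega> * indicator (bad N g) \<omega>)"
        using G g by (intro member_le_sum) auto
      finally show ?thesis by (rule add_increasing[rotated]) simp
    next
      case False
      then have small: "(\<integral>x. g x \<partial>Y N \<omega>) < m g + \<delta>" if "g \<in> G" for g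
        using that \<omega> by (auto simp: bad_def not_le)
      have "Y N \<omega> \<in> U"
      proof (rule FU[OF good_prob_measures[OF elim(5) \<omega>]], rule ballI)
        fix g assume g: "g \<in> F"
        have "(\<integral>x. g x \<partial>Y N \<omega>) < m g + \<delta>" using g by (intro small) (simp add: G_def)
        moreover have "(\<integral>x. - g x \<partial>Y N \<omega>) < m (\<lambda>x. - g x) + \<delta>" using g by (intro small) (simp add: G_def)
        ultimately show "\<bar>(\<integral>x. g x \<partial>Y N \<omega>) - m g\<bar> < \<delta>\<^sub>0" using \<delta> by (simp add: m_def abs_less_iff)
      qed
      moreover have "(\<integral>x. f x \<partial>Y N \<omega>) \<le> m f + \<epsilon> / 3"
        using small[of f] \<delta> by (simp add: G_def)
      ultimately have "?e \<omega> \<le> exp (s N * (m f + \<epsilon> / 3)) * indicator ?U \<omega>"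
        using \<omega> s by simp
      then show ?thesis by (rule add_increasing2[rotated]) (simp add: sum_nonneg)
    qed
    have int_U: "integrable (M N) (\<lambda>\<omega>. exp (s N * (m f + \<epsilon> / 3)) * indicator ?U \<omega>)"
      using U_sets by (simp add: emeasure_eq_measure)
    have int_sum: "integrable (M N) (\<lambda>\<omega>. \<Sum>g\<in>G. ?e \<omega> * indicator (bad N g) \<omega>)"
      by (rule Bochner_Integration.integrable_sum) (rule int_bad)
    have "moment N f \<le> (\<integral>\<omega>. exp (s N * (m f + \<epsilon> / 3)) * indicator ?U \<omega> + (\<Sum>g\<in>G. ?e \<omega> * indicator (bad N g) \<omega>) \<partial>M N)"
      using int_U int_sum by (intro integral_mono[OF int _ cover] Bochner_Integration.integrable_add)
    also have "\<dots> = exp (s N * (m f + \<epsilon> / 3)) * pr N U + (\<Sum>g\<in>G. \<integral>\<omega>. ?e \<omega> * indicator (bad N g) \<omega> \<partial>M N)"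
      by (simp only: Bochner_Integration.integral_add[OF int_U int_sum] Bochner_Integration.integral_sum[OF int_bad]) (simp add: U_sets)
    also have "(\<Sum>g\<in>G. \<integral>\<omega>. ?e \<omega> * indicator (bad N g) \<omega> \<partial>M N) \<le> (\<Sum>g\<in>G. moment N f / (2 * card G))"
    proof (rule sum_mono)
      fix g assume g: "g \<in> G"
      then have card: "0 < card G" using G by (auto simp: card_gt_0_iff)
      have "exp (- c g * s N) \<le> exp (- ln (2 * card G))" using elim(2) g by simp
      also have "\<dots> = 1 / (2 * card G)" using card by (simp add: exp_minus inverse_eq_divide)
      finally have "exp (- c g * s N) * moment N f \<le> 1 / (2 * card G) * moment N f"
        using moment_pos[OF elim(5) f] by (intro mult_right_mono) auto
      moreover have "(\<integral>\<omega>. ?e \<omega> * indicator (bad N g) \<omega> \<partial>M N) \<le> exp (- c g * s N) * moment N f"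
        using elim(1) g by (rule bspec)
      ultimately show "(\<integral>\<omega>. ?e \<omega> * indicator (bad N g) \<omega> \<partial>M N) \<le> moment N f / (2 * card G)" by simp
    qed
    also have "(\<Sum>g\<in>G. moment N f / (2 * card G)) = moment N f / 2"
    proof -
      have "card G \<noteq> 0" using G(1) by (simp add: G_def)
      then show ?thesis by simp
    qed
    finally have "moment N f / 2 \<le> exp (s N * (m f + \<epsilon> / 3)) * pr N U" by simp
    have "exp (- s N * (m f - log_laplace f + \<epsilon>)) = exp (s N * (log_laplace f - \<epsilon> / 3)) * exp (- (\<epsilon> / 3 * s N)) * exp (- s N * (m f + \<epsilon> / 3))"
      by (simp add: exp_add[symmetric] algebra_simps)
    also have "\<dots> \<le> moment N f * (1 / 2) * exp (- s N * (m f + \<epsilon> / 3))"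
    proof (intro mult_right_mono mult_mono)
      have "exp (- (\<epsilon> / 3 * s N)) \<le> exp (- ln 2)" using elim(3) by (simp only: exp_le_cancel_iff neg_le_iff_le)
      then show "exp (- (\<epsilon> / 3 * s N)) \<le> 1 / 2" by (simp add: exp_minus)
    qed (use elim(4) moment_pos[OF elim(5) f] in auto)
    also have "\<dots> \<le> (exp (s N * (m f + \<epsilon> / 3)) * pr N U) * exp (- s N * (m f + \<epsilon> / 3))"
      using \<open>moment N f / 2 \<le> exp (s N * (m f + \<epsilon> / 3)) * pr N U\<close> by (intro mult_right_mono) auto
    also have "\<dots> = pr N U * exp (s N * (m f + \<epsilon> / 3) + - s N * (m f + \<epsilon> / 3))"
      by (simp only: exp_add ac_simps)
    also have "\<dots> = pr N U" by simp
    finally show ?case by (simp only: m_def)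
  qed
qed

lemma lower_bound:
  assumes U: "openin weak_topology U"
  shows "- (INF \<mu>\<in>U. relative_entropy \<mu> std_gauss) \<le> liminf (\<lambda>N. ereal (1 / s N) * log_ereal (pr N U))"
    (is "_ \<le> ?L")
proof -
  have "- ?L \<le> relative_entropy \<mu> std_gauss" if \<mu>U: "\<mu> \<in> U" for \<mu>
  proof (cases "relative_entropy \<mu> std_gauss")
    case (real h)
    have \<mu>: "\<mu> \<in> prob_measures" using openin_subset[OF U] \<mu>U by auto
    have "ereal (- (h + \<epsilon>)) \<le> ?L" if \<epsilon>: "0 < \<epsilon>" for \<epsilon>
    proof -
      obtain f where f: "f \<in> bcont" "tilted f \<in> U" "(\<integral>x. f x \<partial>tilted f) - log_laplace f < h + \<epsilon> / 2"
        using tilted_approximation[OF \<mu> real U \<mu>U, of "\<epsilon> / 2"] \<epsilon> by auto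
      have "\<forall>\<^sub>F N in sequentially. exp (- s N * ((\<integral>x. f x \<partial>tilted f) - log_laplace f + \<epsilon> / 2)) \<le> pr N U"
        using \<epsilon> by (intro eventually_lower_bound[OF f(1) U f(2)]) simp
      then have "\<forall>\<^sub>F N in sequentially. ereal (- (h + \<epsilon>)) \<le> ereal (1 / s N) * log_ereal (pr N U)"
        using eventually_good
      proof eventually_elim
        case (elim N)
        have s: "0 < s N" using elim(2) by (simp add: good_def)
        have "ereal (- (h + \<epsilon>)) \<le> ereal (- ((\<integral>x. f x \<partial>tilted f) - log_laplace f + \<epsilon> / 2))"
          using f(3) by simp
        also have "\<dots> \<le> ereal (1 / s N) * log_ereal (pr N U)" by (rule log_ereal_ge[OF s elim(1)])
        finally show ?case .
      qed
      then show ?thesis by (rule Liminf_bounded)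
    qed
    then have le: "- ereal (h + \<epsilon>) \<le> ?L" if "0 < \<epsilon>" for \<epsilon>
      using that by (simp only: uminus_ereal.simps)
    have "- ?L \<le> ereal h + ereal \<epsilon>" if "0 < \<epsilon>" for \<epsilon>
      using ereal_uminus_le_reorder[THEN iffD1, OF le[OF that]] by (simp only: plus_ereal.simps)
    then show ?thesis unfolding real by (rule ereal_le_epsilon2)
  next
    case MInf
    have "\<mu> \<in> prob_measures" using openin_subset[OF U] \<mu>U by auto
    then have "0 \<le> relative_entropy \<mu> std_gauss" by (rule relative_entropy_nonneg)
    with MInf have False by simp
    then show ?thesis ..
  next
    case PInf
    show ?thesis unfolding PInf by (rule ereal_less_eq(1))
  qed
  then have "- ?L \<le> (INF \<mu>\<in>U. relative_entropy \<mu> std_gauss)" by (rule INF_greatest)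
  then show ?thesis by (rule ereal_uminus_le_reorder[THEN iffD1])
qed

theorem satisfies_LDP_relative_entropy:
  "satisfies_LDP weak_topology M Y s (\<lambda>\<mu>. relative_entropy \<mu> std_gauss)"
  unfolding satisfies_LDP_def
proof (intro conjI allI impI)
  show "rate_function weak_topology (\<lambda>\<mu>. relative_entropy \<mu> std_gauss)" by (rule rate_function_relative_entropy)
  show "- (INF \<mu>\<in>U. relative_entropy \<mu> std_gauss) \<le> liminf (\<lambda>N. ereal (1 / s N) * log_ereal (pr N U))"
    if "openin weak_topology U" for U by (rule lower_bound[OF that])
  show "limsup (\<lambda>N. ereal (1 / s N) * log_ereal (pr N C)) \<le> - (INF \<mu>\<in>C. relative_entropy \<mu> std_gauss)"
    if "closedin weak_topology C" for C by (rule upper_bound[OF that])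
qed (fact meas speed)+

end

section \<open>Empirical measures of the entries\<close>

text \<open>The empirical measure is the law of an entry at a uniformly chosen position. In this form integrals
  against it are finite averages.\<close>

lemma entry_empirical_measure_eq_distr:
  assumes Z: "dim_row Z = m" "dim_col Z = k" and mk: "0 < m * k"
  shows "entry_empirical_measure Z = distr (measure_pmf (pmf_of_set ({..<m} \<times> {..<k}))) borel (($$) Z)"
proof (rule measure_eqI)
  fix B assume "B \<in> sets (entry_empirical_measure Z)"
  then have B: "B \<in> sets borel" by simp
  let ?S = "{..<m} \<times> {..<k}"
  have S: "finite ?S" "?S \<noteq> {}" using mk by auto
  have "(\<Sum>i<m. \<Sum>j<k. indicator B (Z $$ (i, j))) = (\<Sum>ij\<in>?S. indicator B (Z $$ ij) :: ennreal)"
    by (simp add: sum.cartesian_product)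
  also have "\<dots> = of_nat (card (?S \<inter> ($$) Z -` B))"
    by (simp add: indicator_def of_bool_def sum.If_cases[OF S(1)] vimage_def Int_def)
  finally have "emeasure (entry_empirical_measure Z) B = of_nat (card (?S \<inter> ($$) Z -` B)) / of_nat (m * k)"
    using B by (simp add: emeasure_entry_empirical_measure Z)
  also have "\<dots> = ennreal (card (?S \<inter> ($$) Z -` B) / card ?S)"
    using mk by (simp add: ennreal_of_nat_eq_real_of_nat divide_ennreal flip: of_nat_mult)
  also have "\<dots> = emeasure (measure_pmf (pmf_of_set ?S)) (($$) Z -` B)"
    by (rule emeasure_pmf_of_set[OF S(2,1), symmetric])
  also have "\<dots> = emeasure (distr (measure_pmf (pmf_of_set ?S)) borel (($$) Z)) B"
    using B by (subst emeasure_distr) auto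
  finally show "emeasure (entry_empirical_measure Z) B = emeasure (distr (measure_pmf (pmf_of_set ?S)) borel (($$) Z)) B" .
qed simp

lemma entry_empirical_measure_prob:
  assumes "dim_row Z = m" "dim_col Z = k" "0 < m * k"
  shows "entry_empirical_measure Z \<in> prob_measures"
  unfolding entry_empirical_measure_eq_distr[OF assms]
  by (auto simp: prob_measures_def intro!: measure_pmf.prob_space_distr)

lemma integral_entry_empirical_measure:
  assumes Z: "dim_row Z = m" "dim_col Z = k" "0 < m * k" and f: "f \<in> borel_measurable borel"
  shows "(\<integral>x. f x \<partial>entry_empirical_measure Z) = (\<Sum>i<m. \<Sum>j<k. f (Z $$ (i, j)) :: real) / (m * k)"
proof -
  let ?S = "{..<m} \<times> {..<k}"
  have S: "finite ?S" "?S \<noteq> {}" using Z(3) by auto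
  have "(\<integral>x. f x \<partial>entry_empirical_measure Z) = (\<integral>ij. f (Z $$ ij) \<partial>measure_pmf (pmf_of_set ?S))"
    unfolding entry_empirical_measure_eq_distr[OF Z] using f by (subst integral_distr) auto
  also have "\<dots> = (\<Sum>ij\<in>?S. f (Z $$ ij)) / card ?S" by (rule integral_pmf_of_set[OF S(2,1)])
  finally show ?thesis by (simp add: sum.cartesian_product)
qed

text \<open>Measurability for the Borel sets of a topology follows from the preimages of subbasic sets only in
  the presence of a countable base. Continuity in the entries avoids this question, since the Borel
  sets of the domain are generated by the coordinates.\<close>

lemma continuous_map_empirical_measure:
  assumes mk: "0 < m * k"
  shows "continuous_map euclidean weak_topology (\<lambda>y. entry_empirical_measure (mat m k y))"
  unfolding weak_topology_def
proof (rule continuous_on_generated_topo)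
  let ?\<S> = "{{\<mu> \<in> prob_measures. (\<integral>x. f x \<partial>\<mu>) \<in> U} | (f :: real \<Rightarrow> real) (U :: real set).
        continuous_on UNIV f \<and> bounded (range f) \<and> open U}"
  have prob: "entry_empirical_measure (mat m k y) \<in> prob_measures" for y
    by (rule entry_empirical_measure_prob[OF _ _ mk]) auto
  show "(\<lambda>y. entry_empirical_measure (mat m k y)) ` topspace euclidean \<subseteq> \<Union>?\<S>"
    using prob topspace_weak_topology unfolding weak_topology_def topology_generated_by_topspace by auto
  fix U assume "U \<in> ?\<S>"
  then obtain f :: "real \<Rightarrow> real" and V :: "real set"
    where U: "U = {\<mu> \<in> prob_measures. (\<integral>x. f x \<partial>\<mu>) \<in> V}"
    and f: "continuous_on UNIV f" and V: "open V" by blast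
  have int: "(\<integral>x. f x \<partial>entry_empirical_measure (mat m k y)) = (\<Sum>i<m. \<Sum>j<k. f (y (i, j))) / (m * k)" for y
    using integral_entry_empirical_measure[of "mat m k y" m k f] mk borel_measurable_continuous_onI[OF f] by simp
  have "continuous_on UNIV (\<lambda>y :: nat \<times> nat \<Rightarrow> real. (\<Sum>i<m. \<Sum>j<k. f (y (i, j))) / (m * k))"
    using mk by (intro continuous_intros continuous_on_compose2[OF f]) auto
  then have "open ((\<lambda>y. (\<Sum>i<m. \<Sum>j<k. f (y (i, j))) / (m * k)) -` V)"
    using V by (simp add: continuous_on_open_vimage)
  moreover have "(\<lambda>y. entry_empirical_measure (mat m k y)) -` U \<inter> topspace euclidean
      = (\<lambda>y. (\<Sum>i<m. \<Sum>j<k. f (y (i, j))) / (m * k)) -` V"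
    using prob by (auto simp: U int)
  ultimately show "openin euclidean ((\<lambda>y. entry_empirical_measure (mat m k y)) -` U \<inter> topspace euclidean)"
    by (simp only: open_openin[symmetric])
qed

lemma measurable_empirical_measure:
  assumes mk: "0 < m * k"
    and meas: "\<And>i j. i < m \<Longrightarrow> j < k \<Longrightarrow> (\<lambda>\<omega>. Z \<omega> $$ (i, j)) \<in> borel_measurable M"
    and dim: "\<And>\<omega>. Z \<omega> \<in> carrier_mat m k"
  shows "(\<lambda>\<omega>. entry_empirical_measure (Z \<omega>)) \<in> M \<rightarrow>\<^sub>M sigma (topspace weak_topology) {U. openin weak_topology U}"
proof (rule measurable_measure_of)
  define y where "y \<omega> ij = (if ij \<in> {..<m} \<times> {..<k} then Z \<omega> $$ ij else 0)" for \<omega> ij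
  have Zy: "Z \<omega> = mat m k (y \<omega>)" for \<omega>
    using dim[of \<omega>] by (intro eq_matI) (auto simp: y_def)
  have y: "y \<in> borel_measurable M"
  proof (rule measurable_coordinatewise_then_product)
    fix ij
    show "(\<lambda>\<omega>. y \<omega> ij) \<in> borel_measurable M"
      by (cases "ij \<in> {..<m} \<times> {..<k}") (auto simp: y_def meas)
  qed
  show "{U. openin weak_topology U} \<subseteq> Pow (topspace weak_topology)" using openin_subset by blast
  show "(\<lambda>\<omega>. entry_empirical_measure (Z \<omega>)) \<in> space M \<rightarrow> topspace weak_topology"
    using entry_empirical_measure_prob[OF _ _ mk] dim by auto
  fix U assume "U \<in> {U. openin weak_topology U}"
  then have U: "openin weak_topology U" by simp
  have "open ((\<lambda>y. entry_empirical_measure (mat m k y)) -` U)"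
    using openin_continuous_map_preimage[OF continuous_map_empirical_measure[OF mk] U]
    by (simp add: vimage_def)
  then have "y -` ((\<lambda>y. entry_empirical_measure (mat m k y)) -` U) \<inter> space M \<in> sets M"
    by (intro measurable_sets[OF y]) simp
  also have "y -` ((\<lambda>y. entry_empirical_measure (mat m k y)) -` U) \<inter> space M
      = (\<lambda>\<omega>. entry_empirical_measure (Z \<omega>)) -` U \<inter> space M"
    by (auto simp: Zy)
  finally show "(\<lambda>\<omega>. entry_empirical_measure (Z \<omega>)) -` U \<inter> space M \<in> sets M" .
qed

theorem theorem1:
  fixes M :: "nat \<Rightarrow> 'w measure"
    and A :: "nat \<Rightarrow> 'w \<Rightarrow> real mat"
    and m k :: "nat \<Rightarrow> nat"
    and \<nu> :: "nat \<Rightarrow> 'w \<Rightarrow> real measure"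
    and I :: "real measure \<Rightarrow> ereal"
  assumes prob: "\<And>N. prob_space (M N)"
    and rv: "\<And>N. A N \<in> M N \<rightarrow>\<^sub>M orthogonal_borel N"
    and haar: "\<And>N. is_haar_orthogonal N (distr (M N) (orthogonal_borel N) (A N))"
    and p_infinity: "filterlim (\<lambda>N. m N * k N) at_top sequentially"
    and p_small: "(\<lambda>N. real (m N * k N)) \<in> o(\<lambda>N. real N)"
  defines "\<nu> \<equiv> \<lambda>N \<omega>. entry_empirical_measure
      (sqrt (real N) \<cdot>\<^sub>m upper_left_block (m N) (k N) (A N \<omega>))"
    and "I \<equiv> \<lambda>\<mu>. relative_entropy \<mu> std_normal_distribution"
  shows "satisfies_LDP weak_topology M \<nu> (\<lambda>N. real (m N * k N)) I
    \<and> good_rate_function weak_topology I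
    \<and> convex_rate I"
proof -
  define P where "P N = distr (M N) (orthogonal_borel N) (A N)" for N
  have haarP: "is_haar_orthogonal N (P N)" for N unfolding P_def by (rule haar)
  note block = eventually_haar_block[OF haarP p_infinity p_small]
    and mk_pos = eventually_mk_pos[OF haarP p_infinity p_small]
  define Z where "Z N \<omega> = sqrt (real N) \<cdot>\<^sub>m upper_left_block (m N) (k N) (A N \<omega>)" for N \<omega>
  have Z_dim: "dim_row (Z N \<omega>) = m N" "dim_col (Z N \<omega>) = k N" for N \<omega>
    by (simp_all add: Z_def upper_left_block_def)
  have Z_entry: "Z N \<omega> $$ (i, j) = scaled_entries N (A N \<omega>) i j" if "i < m N" "j < k N" for N \<omega> i j
    using that by (simp add: Z_def upper_left_block_def scaled_entries_def)
  have \<nu>: "\<nu> N \<omega> = entry_empirical_measure (Z N \<omega>)" for N \<omega> by (simp add: \<nu>_def Z_def)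
  have entry_meas: "(\<lambda>A. scaled_entries N A i j) \<in> borel_measurable (orthogonal_borel N)"
    if "m N \<le> N" "k N \<le> N" "i < m N" "j < k N" for N i j
    unfolding scaled_entries_def using that
    by (intro borel_measurable_times borel_measurable_const measurable_orthogonal_entry) auto
  have int_\<nu>: "(\<integral>x. f x \<partial>\<nu> N \<omega>) = (\<Sum>i<m N. \<Sum>j<k N. f (scaled_entries N (A N \<omega>) i j)) / (m N * k N)"
    if "1 \<le> m N \<and> 1 \<le> k N" "f \<in> bcont" for N \<omega> f
    using integral_entry_empirical_measure[OF Z_dim[of N \<omega>] _ bcont_measurable[OF that(2)]] that(1)
    by (simp add: \<nu> Z_entry)
  interpret laplace_ldp M \<nu> "\<lambda>N. real (m N * k N)"
  proof (rule laplace_ldp.intro)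
    show "prob_space (M N)" for N by (rule prob)
    show "filterlim (\<lambda>N. real (m N * k N)) at_top sequentially"
      by (rule filterlim_compose[OF filterlim_real_sequentially p_infinity])
    show "\<forall>\<^sub>F N in sequentially. \<nu> N \<in> M N \<rightarrow>\<^sub>M sigma (topspace weak_topology) {U. openin weak_topology U}"
      using mk_pos block
    proof eventually_elim
      case (elim N)
      interpret haar_block N "m N" "k N" "P N" by fact
      have "(\<lambda>\<omega>. entry_empirical_measure (Z N \<omega>)) \<in> M N \<rightarrow>\<^sub>M sigma (topspace weak_topology) {U. openin weak_topology U}"
      proof (rule measurable_empirical_measure)
        show "0 < m N * k N" using elim(1) by simp
        show "Z N \<omega> \<in> carrier_mat (m N) (k N)" for \<omega> using Z_dim by auto
        show "(\<lambda>\<omega>. Z N \<omega> $$ (i, j)) \<in> borel_measurable (M N)" if "i < m N" "j < k N" for i j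
          using measurable_compose[OF rv entry_meas[OF m k(2) that]] by (simp add: Z_entry[OF that])
      qed
      then show ?case by (simp add: \<nu>[abs_def])
    qed
    show "(\<lambda>N. ln (\<integral>\<omega>. exp (real (m N * k N) * (\<integral>x. f x \<partial>\<nu> N \<omega>)) \<partial>M N) / real (m N * k N)) \<longlonglongrightarrow> log_laplace f"
      if f: "f \<in> bcont" for f
    proof -
      obtain K where K: "\<And>x. \<bar>f x\<bar> \<le> K" using bcontE[OF f] by metis
      have "\<forall>\<^sub>F N in sequentially.
          ln (\<integral>A. exp (\<Sum>j<m N. \<Sum>c<k N. f (scaled_entries N A j c)) \<partial>P N) / (m N * k N)
          = ln (\<integral>\<omega>. exp (real (m N * k N) * (\<integral>x. f x \<partial>\<nu> N \<omega>)) \<partial>M N) / real (m N * k N)"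
        using mk_pos block
      proof eventually_elim
        case (elim N)
        interpret haar_block N "m N" "k N" "P N" by fact
        have [measurable]: "f \<in> borel_measurable borel" by (rule bcont_measurable[OF f])
        have [measurable]: "(\<lambda>A. scaled_entries N A i j) \<in> borel_measurable (orthogonal_borel N)"
          if "i \<in> {..<m N}" "j \<in> {..<k N}" for i j
          using that by (intro entry_meas m k) auto
        have "(\<integral>A. exp (\<Sum>j<m N. \<Sum>c<k N. f (scaled_entries N A j c)) \<partial>P N)
            = (\<integral>\<omega>. exp (\<Sum>j<m N. \<Sum>c<k N. f (scaled_entries N (A N \<omega>) j c)) \<partial>M N)"
          unfolding P_def by (rule integral_distr[OF rv]) measurable
        also have "\<dots> = (\<integral>\<omega>. exp (real (m N * k N) * (\<integral>x. f x \<partial>\<nu> N \<omega>)) \<partial>M N)"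
          using elim(1) by (simp add: int_\<nu>[OF elim(1) f])
        finally show ?case by simp
      qed
      from Lim_transform_eventually[OF laplace_functional_limit[OF haarP p_infinity p_small bcont_continuous[OF f] K] this]
      show ?thesis by (simp add: log_laplace_def)
    qed
    show "\<exists>C. \<forall>\<^sub>F N in sequentially.
        measure (M N) {\<omega> \<in> space (M N). \<nu> N \<omega> \<notin> moment_set C} \<le> exp (- \<Lambda> * real (m N * k N))"
      if \<Lambda>: "0 \<le> \<Lambda>" for \<Lambda>
    proof -
      obtain C :: real where tail: "\<forall>\<^sub>F N in sequentially.
          emeasure (P N) {A \<in> space (P N). C * (m N * k N) < sq_norm (m N) (k N) (scaled_entries N A)}
            \<le> ennreal (exp (- \<Lambda> * (m N * k N)))"
        using sq_norm_exponentially_tight[OF haarP p_infinity p_small \<Lambda>] by blast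
      have "\<forall>\<^sub>F N in sequentially.
        measure (M N) {\<omega> \<in> space (M N). \<nu> N \<omega> \<notin> moment_set C} \<le> exp (- \<Lambda> * real (m N * k N))"
        using mk_pos block tail
      proof eventually_elim
        case (elim N)
        interpret haar_block N "m N" "k N" "P N" by fact
        interpret M: prob_space "M N" by (rule prob)
        have pos: "0 < real (m N * k N)" using elim(1) by simp
        let ?T = "{A \<in> space (orthogonal_borel N). C * (m N * k N) < sq_norm (m N) (k N) (scaled_entries N A)}"
        let ?E = "A N -` ?T \<inter> space (M N)"
        have [measurable]: "(\<lambda>A. scaled_entries N A i j) \<in> borel_measurable (orthogonal_borel N)"
          if "i \<in> {..<m N}" "j \<in> {..<k N}" for i j
          using that by (intro entry_meas m k) auto
        have T: "?T \<in> sets (orthogonal_borel N)" unfolding sq_norm_def by measurable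
        have E: "?E \<in> sets (M N)" by (rule measurable_sets[OF rv T])
        have "{\<omega> \<in> space (M N). \<nu> N \<omega> \<notin> moment_set C} \<subseteq> ?E"
        proof (rule subsetI, rule ccontr)
          fix \<omega> assume \<omega>: "\<omega> \<in> {\<omega> \<in> space (M N). \<nu> N \<omega> \<notin> moment_set C}" "\<omega> \<notin> ?E"
          then have le: "sq_norm (m N) (k N) (scaled_entries N (A N \<omega>)) \<le> C * (m N * k N)"
            using measurable_space[OF rv] by auto
          have "(\<integral>x. min (x\<^sup>2) (real n) \<partial>\<nu> N \<omega>) \<le> C" for n
          proof -
            have "(\<Sum>i<m N. \<Sum>j<k N. min ((scaled_entries N (A N \<omega>) i j)\<^sup>2) (real n)) \<le> C * (m N * k N)"
              using le unfolding sq_norm_def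
              by (rule order_trans[rotated]) (intro sum_mono min.cobounded1)
            then show ?thesis using pos by (simp only: int_\<nu>[OF elim(1) bcont_truncated_square] pos_divide_le_eq)
          qed
          moreover have "\<nu> N \<omega> \<in> prob_measures"
            unfolding \<nu> by (rule entry_empirical_measure_prob[OF Z_dim]) (use elim(1) in simp)
          ultimately show False using \<omega>(1) by (simp add: moment_set_def)
        qed
        then have "measure (M N) {\<omega> \<in> space (M N). \<nu> N \<omega> \<notin> moment_set C} \<le> measure (M N) ?E"
          by (rule M.finite_measure_mono[OF _ E])
        also have "\<dots> \<le> exp (- \<Lambda> * real (m N * k N))"
        proof -
          have "emeasure (M N) ?E = emeasure (P N) ?T" unfolding P_def by (rule emeasure_distr[OF rv T, symmetric])
          also have "\<dots> \<le> ennreal (exp (- \<Lambda> * (m N * k N)))" using elim(3) by (simp add: P_def)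
          finally show ?thesis by (simp add: M.emeasure_eq_measure)
        qed
        finally show ?case .
      qed
      then show ?thesis by blast
    qed
  qed
  show ?thesis
    unfolding I_def
    using satisfies_LDP_relative_entropy good_rate_function_relative_entropy convex_rate_relative_entropy by blast
qed

end
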